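(* Let $N\ge 2$ be an integer and let $\lambda\in(0,N)$ be real. Let $$m_* = \Big( \frac{2^{1/N}-1}{1-2^{(\lambda-N)/N}} \cdot \frac{\operatorname{Per} B_1 }{D(B_1)}\Big)^{N/(N+1-\lambda)} |B_1|,$$ where $B_1$ is the unit ball in $\mathbb{R}^N$. Then for every $0<m\le m_*$ the variational problem $E(m)$ has a minimizer, i.e. there is a measurable set $\Omega\subset\mathbb{R}^N$ with $|\Omega|=m$ and $\mathcal{E}(\Omega)=E(m)$.
   Context: For $N\ge2$, $\lambda\in(0,N)$ and a measurable set $\Omega\subset\mathbb{R}^N$, $|\Omega|$ denotes its Lebesgue measure. The perimeter (in the sense of De Giorgi) is $$\operatorname{Per}\Omega=\sup\Big\{\int_\Omega \operatorname{div}F(x)\,dx \;:\; F\in C_0^1(\mathbb{R}^N,\mathbb{R}^N),\ |F|\le 1\Big\},$$ where $C^1_0$ denotes compactly supported $C^1$ vector fields (the value $+\infty$ is allowed). Set $$D(\Omega)=\frac12\iint_{\Omega\times\Omega}\frac{dx\,dy}{|x-y|^\lambda},\qquad \mathcal{E}(\Omega)=\operatorname{Per}\Omega+D(\Omega).$$ For $m>0$ let $E(m)=\inf\{\mathcal{E}(\Omega): \Omega\subset\mathbb{R}^N \text{ measurable},\ |\Omega|=m\}$. A minimizer for $E(m)$ is a measurable set $\Omega$ with $|\Omega|=m$ and $\mathcal{E}(\Omega)=E(m)$. The number $m_*$ is the unique $m>0$ for which the energy of a ball of volume $m$ equals twice the energy of a ball of volume $m/2$. *)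

theory Defs
  imports "HOL-Analysis.Analysis"
begin

definition divergence :: "('a::euclidean_space \<Rightarrow> 'a) \<Rightarrow> 'a \<Rightarrow> real" where
  "divergence F x = (\<Sum>b\<in>Basis. frechet_derivative F (at x) b \<bullet> b)"

definition C1_compact_support :: "('a::euclidean_space \<Rightarrow> 'a) \<Rightarrow> bool" where
  "C1_compact_support F \<longleftrightarrow>
     (\<exists>F' :: 'a \<Rightarrow> 'a \<Rightarrow>\<^sub>L 'a. (\<forall>x. (F has_derivative blinfun_apply (F' x)) (at x))
        \<and> continuous_on UNIV F') \<and>
     compact (closure {x. F x \<noteq> 0})"

text \<open>
  The coercion \<open>ennreal\<close> sends negative integrals to \<open>0\<close>. This does not change the supremum,
  because the admissible field \<open>F = 0\<close> already contributes the value \<open>0\<close>.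
\<close>

definition perimeter :: "'a::euclidean_space set \<Rightarrow> ennreal" where
  "perimeter \<Omega> =
     (SUP F \<in> {F. C1_compact_support F \<and> (\<forall>x. norm (F x) \<le> 1)}.
        ennreal (LINT x:\<Omega>|lebesgue. divergence F x))"

text \<open>
  On the diagonal the integrand below is \<open>0\<close> (as \<open>1 / 0 = 0\<close>) rather than infinite; the
  diagonal is a null set, so the integral is not affected.
\<close>

definition riesz_energy :: "real \<Rightarrow> 'a::euclidean_space set \<Rightarrow> ennreal" where
  "riesz_energy \<alpha> \<Omega> =
     (\<integral>\<^sup>+x\<in>\<Omega>. (\<integral>\<^sup>+y\<in>\<Omega>. ennreal (1 / norm (x - y) powr \<alpha>) \<partial>lebesgue) \<partial>lebesgue) / 2"

definition energy :: "real \<Rightarrow> 'a::euclidean_space set \<Rightarrow> ennreal" where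
  "energy \<alpha> \<Omega> = perimeter \<Omega> + riesz_energy \<alpha> \<Omega>"

definition min_energy :: "'a::euclidean_space itself \<Rightarrow> real \<Rightarrow> real \<Rightarrow> ennreal" where
  "min_energy _ \<alpha> m =
     (INF \<Omega> \<in> {\<Omega> :: 'a set. \<Omega> \<in> sets lebesgue \<and> emeasure lebesgue \<Omega> = ennreal m}. energy \<alpha> \<Omega>)"

definition is_minimizer :: "real \<Rightarrow> real \<Rightarrow> 'a::euclidean_space set \<Rightarrow> bool" where
  "is_minimizer \<alpha> m \<Omega> \<longleftrightarrow>
     \<Omega> \<in> sets lebesgue \<and> emeasure lebesgue \<Omega> = ennreal m \<and>
     energy \<alpha> \<Omega> = min_energy TYPE('a) \<alpha> m"

text \<open>
  The perimeter and the interaction energy of the unit ball are finite (for exponents below the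
  dimension), so nothing is lost in passing to real numbers with \<open>enn2real\<close>.
\<close>

definition m_star :: "'a::euclidean_space itself \<Rightarrow> real \<Rightarrow> real" where
  "m_star _ \<alpha> =
     (let N = real DIM('a); B = ball (0::'a) 1
      in ((2 powr (1 / N) - 1) / (1 - 2 powr ((\<alpha> - N) / N))
            * (enn2real (perimeter B) / enn2real (riesz_energy \<alpha> B))) powr (N / (N + 1 - \<alpha>))
         * measure lebesgue B)"

end

(* Let E be the infimum of the energy at volume m, and let e be the energy of the ball of volume m.

   If a minimizing sequence loses volume at infinity, then it splits into two far apart pieces of
   volumes xm and (1-x)m whose energies asymptotically add up to E.  Rescaling each piece to volume
   m and using the isoperimetric inequality for its perimeter yields, with N a = N - 1 and
   N b = 2N - alpha,
     (E - P) (1 - x^b - (1-x)^b) >= P (x^a + (1-x)^a - 1)   with P the perimeter of that ball.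
   The quotient of the two power sums is smallest at x = 1/2, where it is the constant in the
   definition of m_star; for m <= m_star this gives E >= e, so the ball is a minimizer.

   If no volume is lost, then the sequence converges and its limit is a minimizer by lower
   semicontinuity.  Vanishing is excluded and compactness is obtained from the estimate
   |(Omega - h) symmetric difference Omega| <= |h| Per Omega.  This estimate and the sharp
   isoperimetric inequality both follow by mollifying the indicator function; the latter is then
   the Brunn-Minkowski inequality for the superlevel sets, integrated over the levels. *)

theory Submission
  imports Defs "HOL-Complex_Analysis.Great_Picard"
begin

section \<open>Compactly supported vector fields and the perimeter of Borel sets\<close>

text \<open>The splitting argument uses dilations only: a piece of volume y m, enlarged to volume m,
  competes for E. Relative to its Riesz energy, its perimeter then counts with the smaller weight
  y^(b-a), and the isoperimetric inequality turns the remaining part of the perimeter into the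
  explicit gain P (y^a - y^b). The outcome is E >= P + P c, with c the extremal quotient, and m <=
  m_star says precisely that the Riesz energy of the ball of volume m is at most c P. The obstacle
  is that the perimeter is only a supremum over test fields, so every surface estimate has to come
  from a choice of fields. Convolution makes bounded measurable fields of bounded support
  admissible, which bounds the L1 norm of the gradient of a mollified indicator by the perimeter.
  Two fields glued across a thin shell bound the sum of the perimeters of the two parts cut off by a
  sphere, at the cost of the volume in the shell over its thickness; some radius in [R, 2R] keeps
  this cost of order m / R. The Riesz energy of a set dominates the sum over two disjoint parts,
  whatever their distance.\<close>

lemma C1_compact_supportI:
  fixes F :: "'a::euclidean_space \<Rightarrow> 'a"
  assumes D: "\<And>x. (F has_derivative F' x) (at x)"
    and C: "\<And>v. continuous_on UNIV (\<lambda>x. F' x v)"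
    and S: "\<And>x. norm x > R \<Longrightarrow> F x = 0"
  shows "C1_compact_support F"
proof -
  have bl: "bounded_linear (F' x)" for x
    using D has_derivative_bounded_linear by blast
  have eq: "blinfun_apply (Blinfun (F' x)) = F' x" for x
    using bl by (simp add: bounded_linear_Blinfun_apply)
  have "{x. F x \<noteq> 0} \<subseteq> cball 0 R"
    using S by (force simp: not_le[symmetric])
  then have "bounded {x. F x \<noteq> 0}"
    by (rule bounded_subset[OF bounded_cball])
  then have "compact (closure {x. F x \<noteq> 0})"
    by (simp add: compact_closure)
  \<comment> \<open>In finite dimension, continuity of the derivative applied to each fixed vector
    is continuity in operator norm.\<close>
  moreover have "continuous_on UNIV (\<lambda>x. Blinfun (F' x))"
    by (rule continuous_on_blinfun_componentwise) (simp add: eq C)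
  ultimately show ?thesis
    unfolding C1_compact_support_def using D eq
    by (intro conjI exI[of _ "\<lambda>x. Blinfun (F' x)"]) auto
qed

lemma C1_compact_supportE:
  fixes F :: "'a::euclidean_space \<Rightarrow> 'a"
  assumes "C1_compact_support F"
  obtains F' R where "\<And>x. (F has_derivative F' x) (at x)"
    "\<And>v. continuous_on UNIV (\<lambda>x. F' x v)" "R > 0"
    "\<And>x. norm x > R \<Longrightarrow> F x = 0" "\<And>x v. norm x > R \<Longrightarrow> F' x v = 0"
proof -
  obtain F' where F': "\<And>x. (F has_derivative blinfun_apply (F' x)) (at x)"
    "continuous_on UNIV F'" and "compact (closure {x. F x \<noteq> 0})"
    using assms unfolding C1_compact_support_def by blast
  then obtain R0 where R0: "\<And>x. x \<in> closure {x. F x \<noteq> 0} \<Longrightarrow> norm x \<le> R0"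
    by (meson bounded_iff compact_imp_bounded)
  define R where "R = max R0 1"
  have z: "F x = 0" if "norm x > R" for x
    using R0[of x] that closure_subset[of "{x. F x \<noteq> 0}"] by (force simp: R_def)
  have z': "F' x v = 0" if "norm x > R" for x v
  proof -
    have "(F has_derivative (\<lambda>_. 0)) (at x)"
      by (rule has_derivative_transform_within_open[of "\<lambda>_. 0" _ _ _ "- cball 0 R"])
         (use that z in \<open>auto simp: not_le\<close>)
    with F'(1) have "blinfun_apply (F' x) = (\<lambda>_. 0)"
      by (rule has_derivative_unique)
    then show ?thesis by simp
  qed
  show ?thesis
    by (rule that[of "\<lambda>x. blinfun_apply (F' x)" R])
       (use F' z z' in \<open>auto intro!: continuous_intros simp: R_def\<close>)
qed

lemma divergence_eq:
  assumes "(F has_derivative F') (at x)"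
  shows "divergence F x = (\<Sum>b\<in>Basis. F' b \<bullet> b)"
  using frechet_derivative_at[OF assms] by (simp add: divergence_def)

lemma divergence_props:
  fixes F :: "'a::euclidean_space \<Rightarrow> 'a"
  assumes "C1_compact_support F"
  obtains R M where "continuous_on UNIV (divergence F)" "R > 0" "M > 0"
    "\<And>x. norm x > R \<Longrightarrow> divergence F x = 0" "\<And>x. \<bar>divergence F x\<bar> \<le> M"
proof -
  obtain F' R where F': "\<And>x. (F has_derivative F' x) (at x)"
    "\<And>v. continuous_on UNIV (\<lambda>x. F' x v)" "R > 0"
    "\<And>x v. norm x > R \<Longrightarrow> F' x v = 0"
    using C1_compact_supportE[OF assms] by metis
  have eq: "divergence F = (\<lambda>x. \<Sum>b\<in>Basis. F' x b \<bullet> b)"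
    using F'(1) divergence_eq by blast
  have c: "continuous_on UNIV (divergence F)"
    unfolding eq by (intro continuous_intros F')
  have z: "divergence F x = 0" if "norm x > R" for x
    using F'(4)[OF that] by (simp add: eq)
  have "compact (divergence F ` cball 0 R)"
    by (intro compact_continuous_image continuous_on_subset[OF c]) auto
  then obtain M where "\<And>x. norm x \<le> R \<Longrightarrow> \<bar>divergence F x\<bar> \<le> M"
    by (force simp: bounded_iff dest!: compact_imp_bounded)
  then have "\<bar>divergence F x\<bar> \<le> max M 1" for x
    using z[of x] by (cases "norm x > R") (auto simp: not_less le_max_iff_disj)
  then show ?thesis using that[OF c F'(3) _ z, of "max M 1"] by auto
qed

lemma borel_measurable_divergence:
  fixes F :: "'a::euclidean_space \<Rightarrow> 'a"
  assumes "C1_compact_support F"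
  shows "divergence F \<in> borel_measurable borel"
  using divergence_props[OF assms] by (metis borel_measurable_continuous_onI)

lemma integrable_bounded_support:
  fixes f :: "'a::euclidean_space \<Rightarrow> 'b::{banach, second_countable_topology}"
  assumes [measurable]: "f \<in> borel_measurable borel"
    and "\<And>x. norm x > R \<Longrightarrow> f x = 0" "\<And>x. norm (f x) \<le> M"
  shows "integrable lborel f"
proof -
  have "integrable lborel (\<lambda>x. indicator (cball (0::'a) R) x * M)"
    using emeasure_lborel_cball_finite[of "0::'a" R] by (intro integrable_mult_left) (auto simp: integrable_real_indicator)
  then show ?thesis
    by (rule Bochner_Integration.integrable_bound)
       (use assms(2,3) in \<open>auto simp: indicator_def not_le intro!: AE_I2 order_trans[OF assms(3)]\<close>)
qed

lemma integrable_divergence: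
  fixes F :: "'a::euclidean_space \<Rightarrow> 'a"
  assumes "C1_compact_support F"
  shows "integrable lborel (divergence F)"
  using divergence_props[OF assms] borel_measurable_divergence[OF assms]
  by (metis integrable_bounded_support real_norm_def)

lemma integrable_indicator_divergence:
  fixes F :: "'a::euclidean_space \<Rightarrow> 'a"
  assumes "C1_compact_support F" "\<Omega> \<in> sets borel"
  shows "integrable lborel (\<lambda>x. indicator \<Omega> x * divergence F x)"
  using integrable_mult_indicator[OF _ integrable_divergence[OF assms(1)], of \<Omega>] assms(2)
  by simp

text \<open>By \<open>borel_representative\<close> it is enough to treat Borel sets, and on
  \<open>lborel\<close> Fubini and affine substitutions apply directly.\<close>

lemma set_integral_lebesgue_eq:
  fixes F :: "'a::euclidean_space \<Rightarrow> 'a"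
  assumes "C1_compact_support F" "\<Omega> \<in> sets borel"
  shows "(LINT x:\<Omega>|lebesgue. divergence F x) = (LINT x|lborel. indicator \<Omega> x * divergence F x)"
  unfolding set_lebesgue_integral_def
  using borel_measurable_integrable[OF integrable_indicator_divergence[OF assms]]
  by (subst integral_completion) auto

lemma perimeter_leI:
  fixes \<Omega> :: "'a::euclidean_space set"
  assumes "\<Omega> \<in> sets borel" "p \<ge> 0"
    and "\<And>F. C1_compact_support F \<Longrightarrow> (\<And>x. norm (F x) \<le> 1) \<Longrightarrow>
           (LINT x|lborel. indicator \<Omega> x * divergence F x) \<le> p"
  shows "perimeter \<Omega> \<le> ennreal p"
  unfolding perimeter_def
  by (intro SUP_least ennreal_leI) (use assms in \<open>auto simp: set_integral_lebesgue_eq\<close>)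

lemma perimeter_geD:
  fixes \<Omega> :: "'a::euclidean_space set"
  assumes "\<Omega> \<in> sets borel" "perimeter \<Omega> \<le> ennreal p" "p \<ge> 0"
    and "C1_compact_support F" "\<And>x. norm (F x) \<le> 1"
  shows "(LINT x|lborel. indicator \<Omega> x * divergence F x) \<le> p"
proof -
  have "ennreal (LINT x:\<Omega>|lebesgue. divergence F x) \<le> perimeter \<Omega>"
    unfolding perimeter_def by (rule SUP_upper) (use assms in auto)
  also have "\<dots> \<le> ennreal p" by fact
  finally have "(LINT x:\<Omega>|lebesgue. divergence F x) \<le> p"
    using assms(3) by (simp add: ennreal_le_iff)
  then show ?thesis using assms by (simp add: set_integral_lebesgue_eq)
qed

section \<open>An inequality between powers\<close>

text \<open>The product-to-sum formula turns both sides into sums of two cosh. The arguments compare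
  in pairs because (p - q) (t - s), (p + q) (t - s) and (p - q) (t + s) are nonnegative. In other
  words, cosh (p t) / cosh (q t) increases with t.\<close>

lemma cosh_mult_le_cosh_mult:
  fixes p q s t :: real
  assumes "0 \<le> q" "q \<le> p" "0 \<le> s" "s \<le> t"
  shows "cosh (p * s) * cosh (q * t) \<le> cosh (p * t) * cosh (q * s)"
proof -
  have *: "2 * (cosh x * cosh y) = cosh (x + y) + cosh (x - y)" for x y :: real
    by (simp add: cosh_add cosh_diff)
  have m: "cosh x \<le> cosh y" if "\<bar>x\<bar> \<le> y" for x y :: real
    using that cosh_real_nonneg_le_iff[of "\<bar>x\<bar>" y] by simp
  have "0 \<le> (p - q) * (t - s)" "0 \<le> (p - q) * (t + s)" "0 \<le> (p + q) * (t - s)" "0 \<le> p * s" "0 \<le> q * t"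
    using assms by auto
  then have "cosh (p * s + q * t) \<le> cosh (p * t + q * s)" "cosh (p * s - q * t) \<le> cosh (p * t - q * s)"
    by (auto intro!: m simp: algebra_simps abs_le_iff)
  then show ?thesis using *[of "p * s" "q * t"] *[of "p * t" "q * s"] by linarith
qed

text \<open>With \<open>A\<close> the mean of ln z and ln (1 - z) and \<open>L\<close> half their
  difference, the sum with exponent -r equals 2 exp (-r A) cosh (r L). The ratio of the sums for p
  and q is therefore exp (-(p - q) A) cosh (p L) / cosh (q L). As z grows towards 1/2,
  \<open>A\<close> increases and \<open>L\<close> decreases, so both factors decrease.\<close>

lemma powr_sum_ratio_mono:
  fixes p q x y :: real
  assumes "0 \<le> q" "q \<le> p" "0 < x" "x \<le> y" "y \<le> 1/2"
  shows "(y powr -p + (1 - y) powr -p) * (x powr -q + (1 - x) powr -q)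
       \<le> (x powr -p + (1 - x) powr -p) * (y powr -q + (1 - y) powr -q)"
proof -
  define A where "A z = (ln z + ln (1 - z)) / 2" for z :: real
  define L where "L z = (ln (1 - z) - ln z) / 2" for z :: real
  have e: "z powr -r + (1 - z) powr -r = 2 * exp (- (r * A z)) * cosh (r * L z)"
    if "0 < z" "z < 1" for z r
  proof -
    have 1: "z powr -r = exp (- (r * A z)) * exp (r * L z)"
      using that by (simp add: powr_def A_def L_def exp_add[symmetric] field_simps)
    have 2: "(1 - z) powr -r = exp (- (r * A z)) * exp (- (r * L z))"
      using that by (simp add: powr_def A_def L_def exp_add[symmetric] field_simps)
    show ?thesis unfolding 1 2 by (simp add: cosh_def algebra_simps)
  qed
  have L: "0 \<le> L y" "L y \<le> L x"
    using assms by (auto simp: L_def intro!: diff_mono)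
  have "x * (1 - x) \<le> y * (1 - y)"
  proof -
    have "0 \<le> (y - x) * (1 - x - y)" using assms by (intro mult_nonneg_nonneg) auto
    then show ?thesis by (simp add: algebra_simps)
  qed
  then have "ln (x * (1 - x)) \<le> ln (y * (1 - y))"
    using assms by (subst ln_le_cancel_iff) auto
  then have A: "A x \<le> A y"
    using assms by (simp add: A_def ln_mult)
  have "exp (- (p * A y)) * exp (- (q * A x)) \<le> exp (- (p * A x)) * exp (- (q * A y))"
  proof -
    have "0 \<le> (p - q) * (A y - A x)" using A assms by auto
    then show ?thesis by (simp add: exp_add[symmetric] algebra_simps)
  qed
  moreover have "cosh (p * L y) * cosh (q * L x) \<le> cosh (p * L x) * cosh (q * L y)"
    by (rule cosh_mult_le_cosh_mult) (use assms L in auto)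
  ultimately have "(exp (- (p * A y)) * exp (- (q * A x))) * (cosh (p * L y) * cosh (q * L x))
      \<le> (exp (- (p * A x)) * exp (- (q * A y))) * (cosh (p * L x) * cosh (q * L y))"
    by (rule mult_mono) auto
  then show ?thesis
    using assms by (simp add: e algebra_simps)
qed

text \<open>The value of \<open>c\<close> makes the defect \<open>g\<close> vanish at 1/2, and it
  vanishes at 0 for any \<open>c\<close>. A negative value would give an interior negative minimum
  \<open>z\<close>; the sign of the second derivative at \<open>z\<close> decides from which
  endpoint this is refuted.\<close>

lemma powr_split_inequality_half:
  fixes a b c x :: real
  assumes a: "0 < a" "a < 1" and b: "1 < b" "b < 2"
    and c: "c * (1 - 2 powr (1 - b)) = 2 powr (1 - a) - 1"
    and x: "0 \<le> x" "x \<le> 1/2"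
  shows "c * (1 - x powr b - (1 - x) powr b) \<le> x powr a + (1 - x) powr a - 1"
proof (rule ccontr)
  \<comment> \<open>The second derivative \<open>W\<close> of \<open>g\<close> changes sign at most once on \<open>(0, 1/2)\<close>, from negative to positive, because \<open>P / Q\<close> decreases.\<close>
  assume neg: "\<not> ?thesis"
  define g where "g x = x powr a + (1 - x) powr a - 1 - c * (1 - x powr b - (1 - x) powr b)" for x
  define g' where "g' x = a * (x powr (a-1) - (1 - x) powr (a-1)) + c * b * (x powr (b-1) - (1 - x) powr (b-1))" for x
  define P where "P x = x powr -(2-a) + (1 - x) powr -(2-a)" for x :: real
  define Q where "Q x = x powr -(2-b) + (1 - x) powr -(2-b)" for x :: real
  define W where "W x = c * (b * (b-1)) * Q x - a * (1-a) * P x" for x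
  have cpos: "0 < c"
  proof -
    have "2 powr (1 - b) < 2 powr 0" using b by (intro powr_less_mono) auto
    moreover have "2 powr 0 < (2::real) powr (1 - a)" using a by (intro powr_less_mono) auto
    ultimately show ?thesis using c by (smt (verit) mult_nonneg_nonpos powr_zero_eq_one zero_less_mult_iff)
  qed
  have g0: "g 0 = 0" using a b by (simp add: g_def)
  have half: "(1/2::real) powr r = 2 powr (1 - r) / 2" for r
    by (simp add: powr_diff powr_divide)
  have g12: "g (1/2) = 0"
    using c by (simp add: g_def half algebra_simps)
  have Dg: "(g has_real_derivative g' z) (at z)" if "0 < z" "z < 1" for z
    unfolding g_def g'_def using that a b
    by (auto intro!: derivative_eq_intros simp: algebra_simps powr_diff)
  have Dg': "(g' has_real_derivative W z) (at z)" if "0 < z" "z < 1" for z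
  proof -
    have "(g' has_real_derivative (a * ((a-1) * z powr (a-1-1) + (a-1) * (1 - z) powr (a-1-1))
        + c * b * ((b-1) * z powr (b-1-1) + (b-1) * (1 - z) powr (b-1-1)))) (at z)"
      unfolding g'_def using that
      by (auto intro!: derivative_eq_intros simp: algebra_simps)
    moreover have "a - 1 - 1 = -(2-a)" "b - 1 - 1 = -(2-b)" by auto
    ultimately show ?thesis by (simp add: W_def P_def Q_def algebra_simps)
  qed
  have cont: "continuous_on {0..1/2} g"
    unfolding g_def using a b by (intro continuous_intros continuous_on_powr') auto
  have "\<exists>z\<in>{0..1/2}. \<forall>y\<in>{0..1/2}. g z \<le> g y"
    by (rule continuous_attains_inf) (use cont in auto)
  then obtain z where z: "0 \<le> z" "z \<le> 1/2" "\<And>y. 0 \<le> y \<Longrightarrow> y \<le> 1/2 \<Longrightarrow> g z \<le> g y" by auto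
  have "g z \<le> g x" using z x by auto
  then have gz: "g z < 0" using neg by (simp add: g_def)
  then have z': "0 < z" "z < 1/2" using z g0 g12 by (metis less_eq_real_def less_irrefl)+
  have Qpos: "Q y > 0" if "0 < y" "y < 1" for y using that unfolding Q_def by (intro add_pos_pos) auto
  have ratio: "P w * Q y \<le> P y * Q w" if "0 < y" "y \<le> w" "w \<le> 1/2" for y w
    unfolding P_def Q_def by (rule powr_sum_ratio_mono) (use that a b in auto)
  have Wm: "W y * Q w \<le> W w * Q y" if "0 < y" "y \<le> w" "w \<le> 1/2" for y w
  proof -
    have "a * (1-a) * (P w * Q y) \<le> a * (1-a) * (P y * Q w)"
      using ratio[OF that] a by (intro mult_left_mono) auto
    then show ?thesis by (simp add: W_def algebra_simps)
  qed
  have g'12: "g' (1/2) = 0" by (simp add: g'_def)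
  show False
  proof (cases "W z \<ge> 0")
    \<comment> \<open>Here \<open>g\<close> is convex on [z, 1/2] with slope 0 at 1/2 by symmetry,
      hence nonincreasing there, so its value at \<open>z\<close> is at least that at 1/2.\<close>
    case True
    have W0: "W w \<ge> 0" if "z \<le> w" "w \<le> 1/2" for w
    proof -
      have "0 \<le> W z * Q w" using True Qpos[of w] that z' by auto
      also have "\<dots> \<le> W w * Q z" using Wm that z' by auto
      finally show ?thesis using Qpos[of z] z' by (simp add: zero_le_mult_iff)
    qed
    have g'n: "g' w \<le> 0" if "z \<le> w" "w \<le> 1/2" for w
    proof -
      have "g' w \<le> g' (1/2)"
      proof (rule DERIV_nonneg_imp_nondecreasing[where f=g'])
        fix v assume "w \<le> v" "v \<le> 1/2"
        then show "\<exists>y. (g' has_real_derivative y) (at v) \<and> 0 \<le> y"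
          using Dg'[of v] W0[of v] that z' by auto
      qed (use that in auto)
      then show ?thesis using g'12 by simp
    qed
    have "g (1/2) \<le> g z"
    proof (rule DERIV_nonpos_imp_nonincreasing[where f=g])
      fix v assume "z \<le> v" "v \<le> 1/2"
      then show "\<exists>y. (g has_real_derivative y) (at v) \<and> y \<le> 0"
        using Dg[of v] g'n[of v] z' by auto
    qed (use z' in auto)
    then show False using gz g12 by simp
  next
    \<comment> \<open>Here \<open>g\<close> is concave on (0, z] with slope 0 at the minimum
      \<open>z\<close>, hence nondecreasing there, so its value at \<open>z\<close> is at least that
      at 0.\<close>
    case False
    have W0: "W w \<le> 0" if "0 < w" "w \<le> z" for w
    proof -
      have "W w * Q z \<le> W z * Q w" using Wm that z' by auto
      also have "\<dots> \<le> 0" using False Qpos[of w] that z' by (simp add: mult_nonpos_nonneg)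
      finally show ?thesis using Qpos[of z] z' by (simp add: mult_le_0_iff)
    qed
    have "g' z = 0"
    proof (rule DERIV_local_min)
      show "(g has_real_derivative g' z) (at z)" using Dg z' by auto
      show "0 < min z (1/2 - z)" using z' by auto
      show "\<forall>y. \<bar>z - y\<bar> < min z (1/2 - z) \<longrightarrow> g z \<le> g y"
        by (auto intro!: z(3))
    qed
    then have g'n: "g' w \<ge> 0" if "0 < w" "w \<le> z" for w
    proof -
      have "g' z \<le> g' w"
      proof (rule DERIV_nonpos_imp_nonincreasing[where f=g'])
        fix v assume "w \<le> v" "v \<le> z"
        then show "\<exists>y. (g' has_real_derivative y) (at v) \<and> y \<le> 0"
          using Dg'[of v] W0[of v] that z' by auto
      qed (use that in auto)
      then show ?thesis using \<open>g' z = 0\<close> by simp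
    qed
    have "g 0 \<le> g z"
    proof (rule DERIV_nonneg_imp_increasing_open[where f=g])
      show "continuous_on {0..z} g" using cont z' by (rule_tac continuous_on_subset[OF cont]) auto
      fix v assume "0 < v" "v < z"
      then show "\<exists>y. (g has_real_derivative y) (at v) \<and> 0 \<le> y"
        using Dg[of v] g'n[of v] z' by auto
    qed (use z' in auto)
    then show False using gz g0 by simp
  qed
qed

lemma powr_split_inequality:
  fixes a b c x :: real
  assumes "0 < a" "a < 1" "1 < b" "b < 2"
    and "c * (1 - 2 powr (1 - b)) = 2 powr (1 - a) - 1"
    and "0 \<le> x" "x \<le> 1"
  shows "c * (1 - x powr b - (1 - x) powr b) \<le> x powr a + (1 - x) powr a - 1"
  using powr_split_inequality_half[OF assms(1-5), of x]
    powr_split_inequality_half[OF assms(1-5), of "1 - x"] assms(6,7)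
  by (cases "x \<le> 1/2") (auto simp: algebra_simps)

section \<open>The Brunn--Minkowski inequality\<close>

text \<open>Open boxes can be literally disjoint and stay open boxes when cut by an open half-space;
  what falls on the hyperplane is a null set.\<close>

definition box_family :: "'a::euclidean_space set set \<Rightarrow> bool" where
  "box_family \<A> \<longleftrightarrow> finite \<A> \<and> \<A> \<noteq> {} \<and> disjoint \<A> \<and> (\<forall>D\<in>\<A>. D \<noteq> {} \<and> (\<exists>a b. D = box a b))"

text \<open>The Minkowski sum, in the shape in which \<open>open_sums\<close> and
  \<open>bounded_sums\<close> state it.\<close>

definition set_sum :: "'a::euclidean_space set \<Rightarrow> 'a set \<Rightarrow> 'a set" where
  "set_sum A B = (\<Union>x\<in>A. \<Union>y\<in>B. {x + y})"

lemma set_sumI: "x \<in> A \<Longrightarrow> y \<in> B \<Longrightarrow> x + y \<in> set_sum A B"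
  by (auto simp: set_sum_def)

lemma set_sumE:
  assumes "z \<in> set_sum A B" obtains x y where "z = x + y" "x \<in> A" "y \<in> B"
  using assms by (auto simp: set_sum_def)

lemma set_sum_mono: "A \<subseteq> A' \<Longrightarrow> B \<subseteq> B' \<Longrightarrow> set_sum A B \<subseteq> set_sum A' B'"
  by (auto simp: set_sum_def)

lemma set_sum_commute: "set_sum A B = set_sum B A"
  by (auto simp: set_sum_def add.commute)

lemma open_set_sum: "open A \<Longrightarrow> open (set_sum A B)"
  unfolding set_sum_def by (rule open_sums) simp

lemma bounded_set_sum: "bounded A \<Longrightarrow> bounded B \<Longrightarrow> bounded (set_sum A B)"
  unfolding set_sum_def by (rule bounded_sums)

section \<open>Volumes of bounded open sets and box families\<close>

lemma emeasure_bounded_eq: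
  fixes A :: "'a::euclidean_space set"
  assumes "bounded A"
  shows "emeasure lborel A = ennreal (measure lborel A)"
  using emeasure_bounded_finite[OF assms] by (simp add: emeasure_eq_ennreal_measure top.not_eq_extremum)

lemma measure_open_pos:
  fixes A :: "'a::euclidean_space set"
  assumes "open A" "bounded A" "A \<noteq> {}"
  shows "0 < measure lborel A"
proof -
  obtain a b where ab: "box a b \<subseteq> A" "box a b \<noteq> {}"
    using assms open_contains_box by (metis all_not_in_conv rational_boxes)
  then have "0 < measure lborel (box a b)"
    by (auto simp: measure_lborel_box_eq box_ne_empty inner_simps intro!: prod_pos)
  also have "\<dots> \<le> measure lborel A"
    using assms ab(1) by (intro measure_mono_fmeasurable fmeasurableI emeasure_bounded_finite) auto
  finally show ?thesis .
qed

lemma box_family_bounded: "box_family \<A> \<Longrightarrow> bounded (\<Union>\<A>)"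
  unfolding box_family_def by (metis bounded_Union bounded_box)

lemma box_family_open: "box_family \<A> \<Longrightarrow> open (\<Union>\<A>)"
  unfolding box_family_def by (metis open_Union open_box)

lemma box_family_nonempty: "box_family \<A> \<Longrightarrow> \<Union>\<A> \<noteq> {}"
  by (auto simp: box_family_def)

lemma box_family_measure_pos: "box_family \<A> \<Longrightarrow> 0 < measure lborel (\<Union>\<A>)"
  by (intro measure_open_pos box_family_open box_family_bounded box_family_nonempty)

section \<open>Cutting box families along coordinate hyperplanes\<close>

definition box_cutter :: "'a::euclidean_space set \<Rightarrow> bool" where
  "box_cutter H \<longleftrightarrow> (\<forall>a b. \<exists>c d. box a b \<inter> H = box c d)"

lemma box_cutter_less:
  fixes i :: "'a::euclidean_space"
  assumes "i \<in> Basis"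
  shows "box_cutter {x. x \<bullet> i < t}"
  unfolding box_cutter_def
proof (intro allI exI)
  fix a b :: 'a
  let ?d = "b + (min (b \<bullet> i) t - b \<bullet> i) *\<^sub>R i"
  have "?d \<bullet> j = (if j = i then min (b \<bullet> i) t else b \<bullet> j)" if "j \<in> Basis" for j
    using that assms by (auto simp: inner_simps inner_Basis)
  then have d: "x \<in> box a ?d \<longleftrightarrow> (\<forall>j\<in>Basis. a \<bullet> j < x \<bullet> j \<and> x \<bullet> j < (if j = i then min (b \<bullet> i) t else b \<bullet> j))" for x
    by (simp add: mem_box)
  have *: "(\<forall>j\<in>Basis. f j \<and> g j < (if j = i then min (h i) t else h j)) \<longleftrightarrow> (\<forall>j\<in>Basis. f j \<and> g j < h j) \<and> g i < t"
    (is "?L f g h \<longleftrightarrow> ?R f g h")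
    for f and g h :: "'a \<Rightarrow> real"
  proof
    assume L: "?L f g h"
    have "f j \<and> g j < h j" if "j \<in> Basis" for j using bspec[OF L that] by (cases "j = i") auto
    moreover have "g i < t" using bspec[OF L assms] by auto
    ultimately show "?R f g h" by blast
  qed auto
  show "box a b \<inter> {x. x \<bullet> i < t} = box a ?d"
  proof (rule set_eqI)
    fix x
    show "x \<in> box a b \<inter> {x. x \<bullet> i < t} \<longleftrightarrow> x \<in> box a ?d"
      unfolding d using *[where f="\<lambda>j. a \<bullet> j < x \<bullet> j" and g="\<lambda>j. x \<bullet> j" and h="\<lambda>j. b \<bullet> j"]
      by (simp only: Int_iff mem_Collect_eq mem_box(1))
  qed
qed

lemma box_cutter_greater:
  fixes i :: "'a::euclidean_space"
  assumes "i \<in> Basis"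
  shows "box_cutter {x. t < x \<bullet> i}"
  unfolding box_cutter_def
proof (intro allI exI)
  fix a b :: 'a
  let ?d = "a + (max (a \<bullet> i) t - a \<bullet> i) *\<^sub>R i"
  have "?d \<bullet> j = (if j = i then max (a \<bullet> i) t else a \<bullet> j)" if "j \<in> Basis" for j
    using that assms by (auto simp: inner_simps inner_Basis)
  then have d: "x \<in> box ?d b \<longleftrightarrow> (\<forall>j\<in>Basis. (if j = i then max (a \<bullet> i) t else a \<bullet> j) < x \<bullet> j \<and> x \<bullet> j < b \<bullet> j)" for x
    by (simp add: mem_box)
  have *: "(\<forall>j\<in>Basis. (if j = i then max (h i) t else h j) < g j \<and> f j) \<longleftrightarrow> (\<forall>j\<in>Basis. h j < g j \<and> f j) \<and> t < g i"
    (is "?L f g h \<longleftrightarrow> ?R f g h")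
    for f and g h :: "'a \<Rightarrow> real"
  proof
    assume L: "?L f g h"
    have "h j < g j \<and> f j" if "j \<in> Basis" for j using bspec[OF L that] by (cases "j = i") auto
    moreover have "t < g i" using bspec[OF L assms] by auto
    ultimately show "?R f g h" by blast
  qed auto
  show "box a b \<inter> {x. t < x \<bullet> i} = box ?d b"
  proof (rule set_eqI)
    fix x
    show "x \<in> box a b \<inter> {x. t < x \<bullet> i} \<longleftrightarrow> x \<in> box ?d b"
      unfolding d using *[where f="\<lambda>j. x \<bullet> j < b \<bullet> j" and g="\<lambda>j. x \<bullet> j" and h="\<lambda>j. a \<bullet> j"]
      by (simp only: Int_iff mem_Collect_eq mem_box(1))
  qed
qed

text \<open>Empty pieces are discarded: members of a box family are nonempty, and the loss of a box
  is what lowers the cardinality.\<close>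

definition cut_family :: "'a::euclidean_space set \<Rightarrow> 'a set set \<Rightarrow> 'a set set" where
  "cut_family H \<A> = (\<lambda>D. D \<inter> H) ` {D\<in>\<A>. D \<inter> H \<noteq> {}}"

lemma cut_family:
  assumes "box_family \<A>" "box_cutter H" "\<Union>\<A> \<inter> H \<noteq> {}"
  shows "box_family (cut_family H \<A>)"
  unfolding box_family_def
proof (intro conjI ballI)
  show "finite (cut_family H \<A>)" using assms by (auto simp: box_family_def cut_family_def)
  show "cut_family H \<A> \<noteq> {}" using assms(3) by (auto simp: cut_family_def)
  have dj: "D = E \<or> D \<inter> E = {}" if "D \<in> \<A>" "E \<in> \<A>" for D E
    using assms(1) that by (auto simp: box_family_def disjoint_def)
  show "disjoint (cut_family H \<A>)"
    unfolding cut_family_def by (rule disjointI) (use dj in blast)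
  fix X assume "X \<in> cut_family H \<A>"
  then obtain D where D: "D \<in> \<A>" "X = D \<inter> H" "X \<noteq> {}" by (auto simp: cut_family_def)
  then obtain a b where "D = box a b" using assms(1) unfolding box_family_def by metis
  then show "X \<noteq> {}" "\<exists>a b. X = box a b" using D assms(2) by (auto simp: box_cutter_def)
qed

lemma Union_cut_family: "\<Union>(cut_family H \<A>) = \<Union>\<A> \<inter> H"
  by (auto simp: cut_family_def)

lemma card_cut_family_le: "finite \<A> \<Longrightarrow> card (cut_family H \<A>) \<le> card \<A>"
  unfolding cut_family_def
  by (rule order_trans[OF card_image_le card_mono]) auto

text \<open>A box on the far side of the cut disappears. This strict decrease drives the induction
  in \<open>brunn_minkowski_box_families\<close>.\<close>

lemma card_cut_family_less:
  assumes "finite \<A>" "D \<in> \<A>" "D \<inter> H = {}"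
  shows "card (cut_family H \<A>) < card \<A>"
proof -
  have "card (cut_family H \<A>) \<le> card {D\<in>\<A>. D \<inter> H \<noteq> {}}"
    unfolding cut_family_def using assms by (intro card_image_le) auto
  also have "\<dots> < card \<A>"
    using assms by (intro psubset_card_mono) auto
  finally show ?thesis .
qed

lemma hyperplane_null_lborel:
  fixes i :: "'a::euclidean_space"
  assumes "i \<in> Basis"
  shows "{x. x \<bullet> i = s} \<in> null_sets lborel"
proof -
  have "{x. x \<bullet> i = s} \<in> null_sets lebesgue"
    using negligible_standard_hyperplane[OF assms] by (simp add: negligible_iff_null_sets)
  moreover have "{x. x \<bullet> i = s} \<in> sets borel" by measurable
  ultimately show ?thesis
    by (simp add: null_sets_completion_iff)
qed

text \<open>Supplies the continuity for the intermediate value theorem that places the second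
  hyperplane. Off the null set where the coordinate equals \<open>s\<close>, the indicators are
  eventually constant, and the bounded set \<open>B\<close> dominates them.\<close>

lemma continuous_measure_halfspace:
  fixes i :: "'a::euclidean_space"
  assumes "i \<in> Basis" "bounded B" "open B"
  shows "continuous_on UNIV (\<lambda>s. measure lborel (B \<inter> {x. x \<bullet> i < s}))"
proof -
  have [measurable]: "B \<in> sets borel" using assms by auto
  have fin: "integrable lborel (indicator B :: 'a \<Rightarrow> real)"
    using emeasure_bounded_finite[OF assms(2)] by (simp add: integrable_real_indicator)
  have "(\<lambda>n. measure lborel (B \<inter> {x. x \<bullet> i < u n})) \<longlonglongrightarrow> measure lborel (B \<inter> {x. x \<bullet> i < s})"
    if "u \<longlonglongrightarrow> s" for u s
  proof -
    have "(\<lambda>n. LINT x|lborel. indicat_real (B \<inter> {x. x \<bullet> i < u n}) x)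
      \<longlonglongrightarrow> (LINT x|lborel. indicat_real (B \<inter> {x. x \<bullet> i < s}) x)"
    proof (rule integral_dominated_convergence[OF _ _ fin])
      show "AE x in lborel. (\<lambda>n. indicat_real (B \<inter> {x. x \<bullet> i < u n}) x) \<longlonglongrightarrow> indicat_real (B \<inter> {x. x \<bullet> i < s}) x"
      proof (rule AE_I'[OF hyperplane_null_lborel[OF assms(1), of s]], safe)
        fix x assume *: "\<not> (\<lambda>n. indicat_real (B \<inter> {x. x \<bullet> i < u n}) x) \<longlonglongrightarrow> indicat_real (B \<inter> {x. x \<bullet> i < s}) x"
        show "x \<bullet> i = s"
        proof (rule ccontr)
          assume "x \<bullet> i \<noteq> s"
          then have "\<forall>\<^sub>F n in sequentially. (x \<bullet> i < u n) = (x \<bullet> i < s)"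
            using order_tendstoD[OF that, of "x \<bullet> i"] by (cases "x \<bullet> i < s") (auto elim!: eventually_mono)
          then have "\<forall>\<^sub>F n in sequentially. indicat_real (B \<inter> {x. x \<bullet> i < u n}) x = indicat_real (B \<inter> {x. x \<bullet> i < s}) x"
            by eventually_elim (auto simp: indicator_def)
          then have "(\<lambda>n. indicat_real (B \<inter> {x. x \<bullet> i < u n}) x) \<longlonglongrightarrow> indicat_real (B \<inter> {x. x \<bullet> i < s}) x"
            by (rule tendsto_eventually)
          then show False using * by contradiction
        qed
      qed
      show "indicat_real (B \<inter> {x. x \<bullet> i < s}) \<in> borel_measurable lborel" by measurable
      show "indicat_real (B \<inter> {x. x \<bullet> i < u n}) \<in> borel_measurable lborel" for n by measurable
    qed (auto simp: indicator_def)
    then show ?thesis by simp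
  qed
  then show ?thesis
    by (auto simp: continuous_on_eq_continuous_at continuous_at_sequentially o_def)
qed

text \<open>Divided by the volume of the sum box, the two volumes are the products of the ratios
  l/(l + m) and m/(l + m) over the axes. By the inequality of arithmetic and geometric means their
  N-th roots are at most the mean ratios, and these two means add up to 1.\<close>

lemma brunn_minkowski_two_boxes:
  fixes a b c d :: "'a::euclidean_space"
  assumes "box a b \<noteq> {}" "box c d \<noteq> {}"
  shows "(root DIM('a) (measure lborel (box a b)) + root DIM('a) (measure lborel (box c d))) ^ DIM('a)
    \<le> measure lborel (set_sum (box a b) (box c d))"
proof -
  let ?N = "DIM('a)"
  have Npos: "?N > 0" by simp
  define l where "l i = b \<bullet> i - a \<bullet> i" for i
  define m where "m i = d \<bullet> i - c \<bullet> i" for i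
  have l: "l i > 0" and m: "m i > 0" if "i \<in> Basis" for i
    using assms that by (auto simp: l_def m_def box_ne_empty)
  have sub: "box (a + c) (b + d) \<subseteq> set_sum (box a b) (box c d)"
  proof
    fix z assume z: "z \<in> box (a + c) (b + d)"
    \<comment> \<open>The relative position of \<open>z\<close> along axis \<open>i\<close> of the
      sum box; both summands take the same relative position in their own boxes.\<close>
    define s where "s i = (z \<bullet> i - a \<bullet> i - c \<bullet> i) / (l i + m i)" for i
    define x where "x = (\<Sum>i\<in>Basis. (a \<bullet> i + s i * l i) *\<^sub>R i)"
    have s: "0 < s i" "s i < 1" if "i \<in> Basis" for i
      using z l[OF that] m[OF that] that
      by (auto simp: s_def mem_box inner_simps divide_less_eq l_def m_def)
    have xi: "x \<bullet> i = a \<bullet> i + s i * l i" if "i \<in> Basis" for i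
      using that by (simp add: x_def)
    have zi: "z \<bullet> i = a \<bullet> i + c \<bullet> i + s i * l i + s i * m i" if "i \<in> Basis" for i
    proof -
      have "s i * (l i + m i) = z \<bullet> i - a \<bullet> i - c \<bullet> i" 
        using l[OF that] m[OF that] by (simp add: s_def)
      then show ?thesis by (simp add: algebra_simps)
    qed
    have "x \<in> box a b"
      unfolding mem_box
    proof (intro ballI conjI)
      fix i :: 'a assume i: "i \<in> Basis"
      have "0 < s i * l i" "s i * l i < 1 * l i"
        using s[OF i] l[OF i] by (auto intro: mult_strict_right_mono)
      then show "a \<bullet> i < x \<bullet> i" "x \<bullet> i < b \<bullet> i" using xi[OF i] by (auto simp: l_def)
    qed
    moreover have "z - x \<in> box c d"
      unfolding mem_box
    proof (intro ballI conjI)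
      fix i :: 'a assume i: "i \<in> Basis"
      have "0 < s i * m i" "s i * m i < 1 * m i"
        using s[OF i] m[OF i] by (auto intro: mult_strict_right_mono)
      then show "c \<bullet> i < (z - x) \<bullet> i" "(z - x) \<bullet> i < d \<bullet> i"
        using xi[OF i] zi[OF i] by (auto simp: m_def inner_simps)
    qed
    ultimately show "z \<in> set_sum (box a b) (box c d)"
      using set_sumI[of x "box a b" "z - x" "box c d"] by simp
  qed
  have mab: "measure lborel (box a b) = (\<Prod>i\<in>Basis. l i)"
    using assms by (simp add: measure_lborel_box_eq box_ne_empty l_def inner_simps less_imp_le)
  have mcd: "measure lborel (box c d) = (\<Prod>i\<in>Basis. m i)"
    using assms by (simp add: measure_lborel_box_eq box_ne_empty m_def inner_simps less_imp_le)
  have mac: "measure lborel (box (a + c) (b + d)) = (\<Prod>i\<in>Basis. l i + m i)"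
  proof -
    have "\<forall>i\<in>Basis. (a + c) \<bullet> i \<le> (b + d) \<bullet> i"
      using l m by (force simp: l_def m_def inner_simps)
    then show ?thesis
      by (simp add: measure_lborel_box_eq l_def m_def inner_simps algebra_simps)
  qed
  have q: "root ?N (\<Prod>i\<in>Basis. f i / (l i + m i)) \<le> (\<Sum>i\<in>Basis. f i / (l i + m i)) / ?N"
    if "\<And>i. i \<in> Basis \<Longrightarrow> f i > 0" for f :: "'a \<Rightarrow> real"
  proof -
    have "0 < (\<Prod>i\<in>Basis. f i / (l i + m i))"
      using that l m by (intro prod_pos) (simp add: add_pos_pos)
    then have "root ?N (\<Prod>i\<in>Basis. f i / (l i + m i)) = (\<Prod>i\<in>Basis. f i / (l i + m i)) powr (1 / ?N)"
      using Npos by (intro root_powr_inverse) auto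
    also have "\<dots> \<le> (\<Sum>i\<in>(Basis::'a set). f i / (l i + m i) / ?N)"
      using that l m by (intro arith_geom_mean) (auto simp: add_pos_pos less_imp_le)
    finally show ?thesis by (simp add: sum_divide_distrib)
  qed
  define S where "S = (\<Prod>i\<in>Basis. l i + m i)"
  have Spos: "S > 0" unfolding S_def using l m by (intro prod_pos) (simp add: add_pos_pos)
  have "root ?N (prod l Basis / S) + root ?N (prod m Basis / S)
     \<le> (\<Sum>i\<in>Basis. l i / (l i + m i)) / ?N + (\<Sum>i\<in>Basis. m i / (l i + m i)) / ?N"
    using q[of l] q[of m] l m by (simp add: prod_dividef S_def)
  also have "\<dots> = (\<Sum>i\<in>(Basis::'a set). l i / (l i + m i) + m i / (l i + m i)) / ?N"
    by (simp add: sum.distrib add_divide_distrib)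
  also have "\<dots> = (\<Sum>i\<in>(Basis::'a set). 1) / ?N"
  proof -
    have "l i / (l i + m i) + m i / (l i + m i) = 1" if "i \<in> Basis" for i
      using l[OF that] m[OF that] by (simp add: add_divide_distrib[symmetric])
    then show ?thesis by simp
  qed
  also have "\<dots> = 1" by simp
  finally have "(root ?N (prod l Basis) + root ?N (prod m Basis)) / root ?N S \<le> 1"
    by (simp add: real_root_divide add_divide_distrib)
  then have "root ?N (prod l Basis) + root ?N (prod m Basis) \<le> root ?N S"
    using Spos Npos by (simp add: divide_le_eq)
  moreover have "0 \<le> prod l Basis" "0 \<le> prod m Basis"
    using l m by (auto intro!: prod_nonneg intro: less_imp_le)
  ultimately have "(root ?N (prod l Basis) + root ?N (prod m Basis)) ^ ?N \<le> root ?N S ^ ?N"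
    by (intro power_mono) auto
  also have "\<dots> = measure lborel (box (a + c) (b + d))"
    using Spos Npos by (simp add: mac S_def)
  also have "\<dots> \<le> measure lborel (set_sum (box a b) (box c d))"
    using sub open_set_sum[OF open_box, of a b "box c d"]
    by (intro measure_mono_fmeasurable fmeasurableI emeasure_bounded_finite bounded_set_sum) auto
  finally show ?thesis by (simp add: mab mcd)
qed

text \<open>The Brunn-Minkowski bound is homogeneous of degree one in the pair of volumes, so
  cutting both sets in the ratio \<theta> to 1 - \<theta> splits the bound exactly.\<close>

lemma root_sum_scale:
  assumes "0 \<le> \<theta>" "0 < n"
  shows "(root n (\<theta> * x) + root n (\<theta> * y)) ^ n = \<theta> * (root n x + root n y) ^ n"
  using assms by (simp add: real_root_mult distrib_left[symmetric] power_mult_distrib)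

definition bm_holds :: "'a::euclidean_space set \<Rightarrow> 'a set \<Rightarrow> bool" where
  "bm_holds A B \<longleftrightarrow> (root DIM('a) (measure lborel A) + root DIM('a) (measure lborel B)) ^ DIM('a)
    \<le> measure lborel (set_sum A B)"

lemma bm_holds_commute: "bm_holds A B \<Longrightarrow> bm_holds B A"
  by (simp add: bm_holds_def set_sum_commute add.commute)

lemma measure_split_hyperplane:
  fixes A :: "'a::euclidean_space set"
  assumes "i \<in> Basis" "open A" "bounded A"
  shows "measure lborel A = measure lborel (A \<inter> {x. x \<bullet> i < t}) + measure lborel (A \<inter> {x. t < x \<bullet> i})"
proof -
  have A: "A \<in> fmeasurable lborel"
    using assms by (intro fmeasurableI emeasure_bounded_finite) auto
  have "measure lborel A = measure lborel (A - {x. x \<bullet> i = t})"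
    using hyperplane_null_lborel[OF assms(1), of t] assms(2) by (simp add: measure_Diff_null_set)
  also have "A - {x. x \<bullet> i = t} = (A \<inter> {x. x \<bullet> i < t}) \<union> (A \<inter> {x. t < x \<bullet> i})" by auto
  also have "measure lborel \<dots> = measure lborel (A \<inter> {x. x \<bullet> i < t}) + measure lborel (A \<inter> {x. t < x \<bullet> i})"
  proof -
    have [measurable]: "A \<in> sets borel" using assms by auto
    show ?thesis
      by (rule measure_Un_AE) (use A in \<open>auto intro!: fmeasurable_Int_fmeasurable\<close>)
  qed
  finally show ?thesis .
qed

text \<open>
  The argument of Hadwiger and Ohmann: cut \<open>\<A>\<close> along a hyperplane that separates two of its boxes, and \<open>\<B>\<close> along
  a parallel hyperplane in the same volume ratio. The sums of corresponding parts lie on different sides of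
  a hyperplane.
\<close>

lemma brunn_minkowski_cut_step:
  fixes \<A> \<B> :: "'a::euclidean_space set set"
  assumes fam: "box_family \<A>" "box_family \<B>"
    and card: "2 \<le> card \<A>"
    and IH: "\<And>\<A>' \<B>' :: 'a set set. box_family \<A>' \<Longrightarrow> box_family \<B>' \<Longrightarrow>
       card \<A>' + card \<B>' < card \<A> + card \<B> \<Longrightarrow> bm_holds (\<Union>\<A>') (\<Union>\<B>')"
  shows "bm_holds (\<Union>\<A>) (\<Union>\<B>)"
proof -
  let ?N = "DIM('a)"
  let ?A = "\<Union>\<A>" let ?B = "\<Union>\<B>"
  have Npos: "?N > 0" by simp
  obtain D E where DE: "D \<in> \<A>" "E \<in> \<A>" "D \<noteq> E"
    using card by (metis card_2_iff' card_le_Suc0_iff_eq card.infinite not_less_eq_eq numeral_2_eq_2 one_le_numeral zero_le_numeral le_zero_eq zero_neq_numeral)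
  then have disj: "D \<inter> E = {}" using fam(1) by (auto simp: box_family_def disjoint_def)
  obtain a b c d where D: "D = box a b" "box a b \<noteq> {}" and E: "E = box c d" "box c d \<noteq> {}"
    using DE fam(1) unfolding box_family_def by metis
  \<comment> \<open>Disjoint nonempty boxes have disjoint projections on some axis, and a facet of
    the lower one separates them.\<close>
  have "\<exists>i\<in>Basis. \<exists>t. (D \<subseteq> {x. x \<bullet> i < t} \<and> E \<subseteq> {x. t < x \<bullet> i}) \<or> (E \<subseteq> {x. x \<bullet> i < t} \<and> D \<subseteq> {x. t < x \<bullet> i})"
  proof -
    obtain i where i: "i \<in> Basis" "b \<bullet> i \<le> c \<bullet> i \<or> d \<bullet> i \<le> a \<bullet> i"
      using disj D E unfolding D(1) E(1) disjoint_interval box_ne_empty by force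
    then show ?thesis
      unfolding D E by (intro bexI[of _ i] exI[of _ "if b \<bullet> i \<le> c \<bullet> i then b \<bullet> i else d \<bullet> i"])
        (auto simp: mem_box dest!: bspec[of _ _ i])
  qed
  then obtain i t P Q where i: "i \<in> Basis" and PQ: "P \<in> \<A>" "Q \<in> \<A>" "P \<subseteq> {x. x \<bullet> i < t}" "Q \<subseteq> {x. t < x \<bullet> i}"
    using DE by meson
  have PQne: "P \<noteq> {}" "Q \<noteq> {}" using PQ fam(1) by (auto simp: box_family_def)
  note op = box_family_open[OF fam(1)] box_family_open[OF fam(2)]
  note bd = box_family_bounded[OF fam(1)] box_family_bounded[OF fam(2)]
  let ?L = "\<lambda>t. {x. x \<bullet> i < t}" let ?R = "\<lambda>t. {x. t < x \<bullet> i}"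
  have Lop: "open (?L t)" for t by (simp add: open_halfspace_component_lt)
  have Rop: "open (?R t)" for t by (simp add: open_halfspace_component_gt)
  define \<alpha> where "\<alpha> = measure lborel ?A"
  define \<beta> where "\<beta> = measure lborel ?B"
  have pos: "0 < \<alpha>" "0 < \<beta>"
    using fam by (auto simp: \<alpha>_def \<beta>_def box_family_measure_pos)
  have A1: "0 < measure lborel (?A \<inter> ?L t)" "0 < measure lborel (?A \<inter> ?R t)"
    using PQ PQne by (auto intro!: measure_open_pos open_Int op Lop Rop bounded_Int bd)
  have Asum: "\<alpha> = measure lborel (?A \<inter> ?L t) + measure lborel (?A \<inter> ?R t)"
    unfolding \<alpha>_def by (rule measure_split_hyperplane[OF i op(1) bd(1)])
  define \<theta> where "\<theta> = measure lborel (?A \<inter> ?L t) / \<alpha>"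
  have \<theta>: "0 < \<theta>" "\<theta> < 1" using A1 Asum pos by (auto simp: \<theta>_def)
  have mA: "measure lborel (?A \<inter> ?L t) = \<theta> * \<alpha>" "measure lborel (?A \<inter> ?R t) = (1 - \<theta>) * \<alpha>"
    using Asum pos by (auto simp: \<theta>_def field_simps)
  obtain r where r: "\<And>x. x \<in> ?B \<Longrightarrow> norm x < r" "0 < r"
    using bd(2) by (auto simp: bounded_pos_less)
  have Br: "- r < x \<bullet> i \<and> x \<bullet> i < r" if "x \<in> ?B" for x
    using r(1)[OF that] Basis_le_norm[OF i, of x] by auto
  \<comment> \<open>As the second hyperplane moves from -r to r, the part of \<open>?B\<close> below
    it grows from nothing to everything, so some position carries the fraction \<theta>.\<close>
  have "?B \<inter> ?L (-r) = {}" "?B \<inter> ?L r = ?B" using Br by fastforce+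
  then have "\<exists>s\<ge>-r. s \<le> r \<and> measure lborel (?B \<inter> ?L s) = \<theta> * \<beta>"
    using \<theta> pos r(2) continuous_measure_halfspace[OF i bd(2) op(2)]
    by (intro IVT') (auto simp: \<beta>_def[symmetric] intro: continuous_on_subset)
  then obtain s where s: "measure lborel (?B \<inter> ?L s) = \<theta> * \<beta>" by blast
  have s': "measure lborel (?B \<inter> ?R s) = (1 - \<theta>) * \<beta>"
    using measure_split_hyperplane[OF i op(2) bd(2), of s] s by (simp add: \<beta>_def algebra_simps)
  have Bne: "?B \<inter> ?L s \<noteq> {}" "?B \<inter> ?R s \<noteq> {}"
    using s s' \<theta> pos by (metis measure_empty mult_eq_0_iff less_irrefl right_minus_eq)+
  have finA: "finite \<A>" "finite \<B>" using fam by (auto simp: box_family_def)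
  have BL: "bm_holds (?A \<inter> ?L t) (?B \<inter> ?L s)"
  proof -
    have "box_family (cut_family (?L t) \<A>)"
      using A1 by (intro cut_family[OF fam(1) box_cutter_less[OF i]]) auto
    moreover have "box_family (cut_family (?L s) \<B>)"
      by (rule cut_family[OF fam(2) box_cutter_less[OF i] Bne(1)])
    \<comment> \<open>\<open>Q\<close> lies above the hyperplane and drops out of the lower half;
      \<open>P\<close> drops out of the upper half in the same way.\<close>
    moreover have "card (cut_family (?L t) \<A>) < card \<A>"
      using PQ(4) by (intro card_cut_family_less[OF finA(1) PQ(2)]) force
    moreover have "card (cut_family (?L s) \<B>) \<le> card \<B>"
      by (rule card_cut_family_le[OF finA(2)])
    ultimately show ?thesis
      using IH[of "cut_family (?L t) \<A>" "cut_family (?L s) \<B>"] by (simp add: Union_cut_family)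
  qed
  have BR: "bm_holds (?A \<inter> ?R t) (?B \<inter> ?R s)"
  proof -
    have "box_family (cut_family (?R t) \<A>)"
      using A1 by (intro cut_family[OF fam(1) box_cutter_greater[OF i]]) auto
    moreover have "box_family (cut_family (?R s) \<B>)"
      by (rule cut_family[OF fam(2) box_cutter_greater[OF i] Bne(2)])
    moreover have "card (cut_family (?R t) \<A>) < card \<A>"
      using PQ(3) by (intro card_cut_family_less[OF finA(1) PQ(1)]) force
    moreover have "card (cut_family (?R s) \<B>) \<le> card \<B>"
      by (rule card_cut_family_le[OF finA(2)])
    ultimately show ?thesis
      using IH[of "cut_family (?R t) \<A>" "cut_family (?R s) \<B>"] by (simp add: Union_cut_family)
  qed
  define SL where "SL = set_sum (?A \<inter> ?L t) (?B \<inter> ?L s)"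
  define SR where "SR = set_sum (?A \<inter> ?R t) (?B \<inter> ?R s)"
  have SLop: "open SL" "open SR" unfolding SL_def SR_def by (auto intro!: open_set_sum open_Int op Lop Rop)
  have SLbd: "bounded SL" "bounded SR" unfolding SL_def SR_def by (auto intro!: bounded_set_sum bounded_Int bd)
  have sub: "SL \<subseteq> set_sum ?A ?B" "SR \<subseteq> set_sum ?A ?B" unfolding SL_def SR_def by (intro set_sum_mono; blast)+
  have dis: "SL \<inter> SR = {}"
    \<comment> \<open>The \<open>i\<close>-th coordinate is below t + s on \<open>SL\<close> and
      above it on \<open>SR\<close>.\<close>
    unfolding SL_def SR_def by (force elim!: set_sumE simp: inner_simps dest: arg_cong[of _ _ "\<lambda>x. x \<bullet> i"])
  have fm: "X \<in> fmeasurable lborel" if "open X" "bounded X" for X :: "'a set"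
    using that by (intro fmeasurableI emeasure_bounded_finite) auto
  have "(root ?N \<alpha> + root ?N \<beta>) ^ ?N = \<theta> * (root ?N \<alpha> + root ?N \<beta>) ^ ?N + (1 - \<theta>) * (root ?N \<alpha> + root ?N \<beta>) ^ ?N"
    by (simp add: algebra_simps)
  also have "\<dots> = (root ?N (\<theta> * \<alpha>) + root ?N (\<theta> * \<beta>)) ^ ?N + (root ?N ((1 - \<theta>) * \<alpha>) + root ?N ((1 - \<theta>) * \<beta>)) ^ ?N"
    using \<theta> Npos by (simp only: root_sum_scale less_imp_le diff_ge_0_iff_ge)
  also have "\<dots> \<le> measure lborel SL + measure lborel SR"
    using BL BR unfolding bm_holds_def mA s s' SL_def SR_def by (rule add_mono)
  also have "\<dots> = measure lborel (SL \<union> SR)"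
    using dis SLop SLbd by (intro measure_Un_AE[symmetric] fm) auto
  also have "\<dots> \<le> measure lborel (set_sum ?A ?B)"
    using sub by (intro measure_mono_fmeasurable fm open_set_sum bounded_set_sum bd op) (use SLop in auto)
  finally show ?thesis by (simp add: bm_holds_def \<alpha>_def \<beta>_def)
qed

text \<open>Induction on the total number of boxes: the cut step applies to whichever family has at
  least two, and a pair of single boxes is the base case.\<close>

lemma brunn_minkowski_box_families:
  fixes \<A> \<B> :: "'a::euclidean_space set set"
  assumes "box_family \<A>" "box_family \<B>"
  shows "bm_holds (\<Union>\<A>) (\<Union>\<B>)"
  using assms
proof (induction "card \<A> + card \<B>" arbitrary: \<A> \<B> rule: less_induct)
  case less
  have c: "card \<A> \<ge> 1" "card \<B> \<ge> 1"
    using less.prems by (auto simp: box_family_def Suc_le_eq card_gt_0_iff)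
  consider "2 \<le> card \<A>" | "2 \<le> card \<B>" | "card \<A> = 1" "card \<B> = 1" using c by linarith
  then show ?case
  proof cases
    case 1
    then show ?thesis using brunn_minkowski_cut_step[OF less.prems 1] less.hyps by blast
  next
    case 2
    have "bm_holds (\<Union>\<B>) (\<Union>\<A>)"
      by (rule brunn_minkowski_cut_step[OF less.prems(2,1) 2]) (use less.hyps in \<open>auto simp: add.commute\<close>)
    then show ?thesis by (rule bm_holds_commute)
  next
    case 3
    then obtain D E where "\<A> = {D}" "\<B> = {E}" by (metis card_1_singletonE)
    moreover from this obtain a b c d where "D = box a b" "box a b \<noteq> {}" "E = box c d" "box c d \<noteq> {}"
      using less.prems unfolding box_family_def by auto
    ultimately show ?thesis using brunn_minkowski_two_boxes by (simp add: bm_holds_def)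
  qed
qed

text \<open>An open set is a countable union of closed boxes, and finitely many of them already
  carry more than \<open>c\<close>. A division of that finite union into nonoverlapping boxes keeps
  its volume when each box is replaced by its interior.\<close>

lemma open_inner_box_family:
  fixes S :: "'a::euclidean_space set"
  assumes "open S" "ennreal c < emeasure lborel S" "0 \<le> c"
  obtains \<D> where "box_family \<D>" "\<Union>\<D> \<subseteq> S" "c < measure lborel (\<Union>\<D>)"
proof -
  obtain \<C> where C: "countable \<C>" "\<C> \<subseteq> Pow S" "\<And>X. X \<in> \<C> \<Longrightarrow> \<exists>a b. X = cbox a b" "\<Union>\<C> = S"
    using open_countable_Union_open_cbox[OF assms(1)] by metis
  have Cne: "\<C> \<noteq> {}" using C(4) assms by auto
  define U where "U n = (\<Union>k<n. from_nat_into \<C> k)" for n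
  have rng: "range (from_nat_into \<C>) = \<C>" using Cne C(1) by simp
  have Ubor: "U n \<in> sets lborel" for n
    unfolding U_def using C(3) from_nat_into[OF Cne] by (auto intro!: sets.finite_UN) (metis borel_closed closed_cbox sets_lborel)
  have "(\<lambda>n. emeasure lborel (U n)) \<longlonglongrightarrow> emeasure lborel (\<Union>n. U n)"
    using Ubor by (intro Lim_emeasure_incseq) (auto simp: incseq_def U_def intro: less_le_trans)
  moreover have "(\<Union>n. U n) = S"
    using C(4) rng unfolding U_def by (auto) (metis lessI UN_iff lessThan_iff rangeE rng)+
  ultimately have "\<forall>\<^sub>F n in sequentially. ennreal c < emeasure lborel (U n)"
    using assms(2) by (auto dest: order_tendstoD)
  then obtain n where n: "ennreal c < emeasure lborel (U n)"
    by (auto simp: eventually_sequentially)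
  have "\<exists>a b. X = cbox a b" if "X \<in> from_nat_into \<C> ` {..<n}" for X
    using C(3) from_nat_into[OF Cne] that by auto
  then obtain p where p: "p division_of (U n)"
    using elementary_unions_intervals[of "from_nat_into \<C> ` {..<n}"] unfolding U_def by blast
  define \<D> where "\<D> = interior ` p - {{}}"
  have fin: "finite p" using p by auto
  have mem: "\<exists>a b. K = cbox a b" if "K \<in> p" for K using p that by (meson division_ofD(4))
  have disj: "disjoint \<D>"
    using division_ofD(5)[OF p] by (auto simp: \<D>_def disjoint_def)
  have "emeasure lborel (U n) \<le> (\<Sum>K\<in>p. emeasure lborel K)"
    unfolding division_ofD(6)[OF p, symmetric]
    using emeasure_subadditive_finite[of p id lborel] fin mem by force
  also have "\<dots> = (\<Sum>K\<in>p. emeasure lborel (interior K))"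
    using mem by (intro sum.cong) (force simp: interior_cbox emeasure_lborel_cbox_eq emeasure_lborel_box_eq)+
  also have "\<dots> = emeasure lborel (\<Union>K\<in>p. interior K)"
    using fin division_ofD(5)[OF p] by (intro sum_emeasure) (auto simp: disjoint_family_on_def)
  also have "(\<Union>K\<in>p. interior K) = \<Union>\<D>" by (auto simp: \<D>_def)
  finally have big: "ennreal c < emeasure lborel (\<Union>\<D>)" using n by simp
  have fam: "box_family \<D>"
    unfolding box_family_def
  proof (intro conjI)
    show "finite \<D>" using fin by (auto simp: \<D>_def)
    show "\<D> \<noteq> {}" using big by auto
    show "\<forall>D\<in>\<D>. D \<noteq> {} \<and> (\<exists>a b. D = box a b)"
      using mem by (force simp: \<D>_def interior_cbox)
  qed (rule disj)
  have "\<Union>\<D> \<subseteq> U n" using division_ofD(6)[OF p] interior_subset by (fastforce simp: \<D>_def)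
  also have "\<dots> \<subseteq> S" using C(2) from_nat_into[OF Cne] by (auto simp: U_def)
  finally show ?thesis
    using that[OF fam] big assms(3) emeasure_bounded_eq[OF box_family_bounded[OF fam]] by (simp add: ennreal_less_iff)
qed

theorem brunn_minkowski_open:
  fixes A B :: "'a::euclidean_space set"
  assumes "open A" "emeasure lborel A = ennreal \<alpha>" "0 < \<alpha>"
    and "open B" "emeasure lborel B = ennreal \<beta>" "0 < \<beta>"
  shows "ennreal ((root DIM('a) \<alpha> + root DIM('a) \<beta>) ^ DIM('a)) \<le> emeasure lborel (set_sum A B)"
proof -
  let ?N = "DIM('a)"
  \<comment> \<open>Finite families inside reach every volume strictly below the full one; the
    factor \<open>s n\<close> stays below 1 and tends to 1, and the bound is continuous in the
    volumes.\<close>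
  define s where "s n = 1 - 1 / real (Suc (Suc n))" for n
  have s: "0 < s n" "s n < 1" for n by (auto simp: s_def)
  have slim: "s \<longlonglongrightarrow> 1 - 0"
    unfolding s_def
    by (intro tendsto_intros LIMSEQ_Suc[where f="\<lambda>n. 1 / real (Suc n)"]) (use lim_inverse_n' LIMSEQ_Suc in blast)
  have ineq: "ennreal ((root ?N (s n * \<alpha>) + root ?N (s n * \<beta>)) ^ ?N) \<le> emeasure lborel (set_sum A B)" for n
  proof -
    obtain \<D> where D: "box_family \<D>" "\<Union>\<D> \<subseteq> A" "s n * \<alpha> < measure lborel (\<Union>\<D>)"
      using open_inner_box_family[OF assms(1), of "s n * \<alpha>"] assms s[of n] by (auto simp: ennreal_less_iff)
    obtain \<E> where E: "box_family \<E>" "\<Union>\<E> \<subseteq> B" "s n * \<beta> < measure lborel (\<Union>\<E>)"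
      using open_inner_box_family[OF assms(4), of "s n * \<beta>"] assms s[of n] by (auto simp: ennreal_less_iff)
    have "(root ?N (s n * \<alpha>) + root ?N (s n * \<beta>)) ^ ?N
        \<le> (root ?N (measure lborel (\<Union>\<D>)) + root ?N (measure lborel (\<Union>\<E>))) ^ ?N"
      using D(3) E(3) s[of n] assms by (intro power_mono add_mono) (auto intro!: add_nonneg_nonneg real_root_ge_zero)
    also have "\<dots> \<le> measure lborel (set_sum (\<Union>\<D>) (\<Union>\<E>))"
      using brunn_minkowski_box_families[OF D(1) E(1)] by (simp add: bm_holds_def)
    finally have "ennreal ((root ?N (s n * \<alpha>) + root ?N (s n * \<beta>)) ^ ?N) \<le> emeasure lborel (set_sum (\<Union>\<D>) (\<Union>\<E>))"
      using D E by (subst emeasure_bounded_eq) (auto intro!: bounded_set_sum box_family_bounded ennreal_leI)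
    also have "\<dots> \<le> emeasure lborel (set_sum A B)"
      using D E open_set_sum[OF assms(1), of B] by (intro emeasure_mono set_sum_mono) auto
    finally show ?thesis .
  qed
  have "(\<lambda>n. (root ?N (s n * \<alpha>) + root ?N (s n * \<beta>)) ^ ?N) \<longlonglongrightarrow> (root ?N ((1 - 0) * \<alpha>) + root ?N ((1 - 0) * \<beta>)) ^ ?N"
    by (intro tendsto_intros slim)
  then have "(\<lambda>n. ennreal ((root ?N (s n * \<alpha>) + root ?N (s n * \<beta>)) ^ ?N)) \<longlonglongrightarrow> ennreal ((root ?N \<alpha> + root ?N \<beta>) ^ ?N)"
    by (intro tendsto_ennrealI) simp
  then show ?thesis
    by (rule LIMSEQ_le_const2) (use ineq in auto)
qed

section \<open>Mollification\<close>

lemma lborel_nn_integral_affine: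
  fixes f :: "'a::euclidean_space \<Rightarrow> ennreal"
  assumes [measurable]: "f \<in> borel_measurable borel" and c: "c \<noteq> 0"
  shows "(\<integral>\<^sup>+x. f x \<partial>lborel) = ennreal (\<bar>c\<bar> ^ DIM('a)) * (\<integral>\<^sup>+x. f (t + c *\<^sub>R x) \<partial>lborel)"
  by (subst lborel_affine[OF c, of t])
     (simp add: nn_integral_density nn_integral_distr nn_integral_cmult)

lemma lborel_nn_integral_translate:
  fixes f :: "'a::euclidean_space \<Rightarrow> ennreal"
  assumes "f \<in> borel_measurable borel"
  shows "(\<integral>\<^sup>+x. f (x + t) \<partial>lborel) = (\<integral>\<^sup>+x. f x \<partial>lborel)"
  using lborel_nn_integral_affine[OF assms, of 1 t] by (simp add: add.commute)

lemma lborel_integrable_affine: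
  fixes f :: "'a::euclidean_space \<Rightarrow> 'b::{banach, second_countable_topology}"
  assumes c: "c \<noteq> 0" and f: "integrable lborel f"
  shows "integrable lborel (\<lambda>x. f (t + c *\<^sub>R x))"
proof -
  have [measurable]: "f \<in> borel_measurable borel" using borel_measurable_integrable[OF f] by simp
  show ?thesis
    using f c unfolding integrable_iff_bounded
    by (subst (asm) lborel_nn_integral_affine[where c=c and t=t]) (auto simp: ennreal_mult_less_top)
qed

lemma lborel_integral_affine:
  fixes f :: "'a::euclidean_space \<Rightarrow> real"
  assumes [measurable]: "f \<in> borel_measurable borel" and c: "c \<noteq> 0"
  shows "(\<integral>x. f x \<partial>lborel) = \<bar>c\<bar> ^ DIM('a) * (\<integral>x. f (t + c *\<^sub>R x) \<partial>lborel)"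
  by (subst lborel_affine[OF c, of t])
     (simp add: integral_density integral_distr)

lemma lborel_integral_reflect:
  fixes f :: "'a::euclidean_space \<Rightarrow> real"
  assumes "f \<in> borel_measurable borel"
  shows "(\<integral>x. f (t - x) \<partial>lborel) = (\<integral>x. f x \<partial>lborel)"
  using lborel_integral_affine[OF assms, of "-1" t] by simp

lemma lborel_integral_translate:
  fixes f :: "'a::euclidean_space \<Rightarrow> real"
  assumes "f \<in> borel_measurable borel"
  shows "(\<integral>x. f (x + t) \<partial>lborel) = (\<integral>x. f x \<partial>lborel)"
  using lborel_integral_affine[OF assms, of 1 t] by (simp add: add.commute)

lemma emeasure_lborel_translate:
  fixes A :: "'a::euclidean_space set"
  assumes [measurable]: "A \<in> sets borel"
  shows "emeasure lborel {x. x + t \<in> A} = emeasure lborel A"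
proof -
  have "emeasure lborel {x. x + t \<in> A} = (\<integral>\<^sup>+x. indicator {x. x + t \<in> A} x \<partial>lborel)"
    by simp
  also have "\<dots> = (\<integral>\<^sup>+x. indicator A (x + t) \<partial>lborel)"
    by (rule nn_integral_cong) (simp add: indicator_def)
  also have "\<dots> = emeasure lborel A"
    by (subst lborel_nn_integral_translate) auto
  finally show ?thesis .
qed

lemma bochner_integral_norm_le:
  fixes f :: "'a \<Rightarrow> 'b::{banach, second_countable_topology}" and g :: "'a \<Rightarrow> real"
  assumes "integrable M f" "integrable M g" "\<And>x. norm (f x) \<le> g x"
  shows "norm (integral\<^sup>L M f) \<le> integral\<^sup>L M g"
  using assms by (intro order_trans[OF integral_norm_bound integral_mono]) auto

text \<open>
  Requiring a Lipschitz gradient rather than a \<open>C\<^sup>1\<close> kernel makes the first order Taylor estimate uniform,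
  so that integrals can be differentiated without dominated convergence.
\<close>

locale mollifier =
  fixes k :: "'a::euclidean_space \<Rightarrow> real" and \<kappa> :: "'a \<Rightarrow> 'a" and d L :: real
  assumes d_pos: "0 < d" and L_nonneg: "0 \<le> L"
    and k_nonneg: "0 \<le> k x" and k_supp: "d \<le> norm x \<Longrightarrow> k x = 0"
    and grad_supp: "d \<le> norm x \<Longrightarrow> \<kappa> x = 0"
    and k_even: "k (- x) = k x" and grad_odd: "\<kappa> (- x) = - \<kappa> x"
    and grad_lipschitz: "norm (\<kappa> x - \<kappa> y) \<le> L * norm (x - y)"
    and taylor: "\<bar>k (x + v) - k x - \<kappa> x \<bullet> v\<bar> \<le> L * (norm v)\<^sup>2"
    and k_borel [measurable]: "k \<in> borel_measurable borel"
    and k_bounded: "\<exists>M. \<forall>x. k x \<le> M"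
    and k_integral: "(\<integral>x. k x \<partial>lborel) = 1"

text \<open>The square lets the gradient pass continuously through 0 at the sphere of radius
  \<open>d\<close>; the first power would have a kink there.\<close>

definition bump :: "real \<Rightarrow> 'a::euclidean_space \<Rightarrow> real" where
  "bump d x = (max 0 (d\<^sup>2 - x \<bullet> x))\<^sup>2"

definition bump_grad :: "real \<Rightarrow> 'a::euclidean_space \<Rightarrow> 'a" where
  "bump_grad d x = (- 4 * max 0 (d\<^sup>2 - x \<bullet> x)) *\<^sub>R x"

text \<open>The first order remainder is at most (t - s)^2 for every combination of signs, in
  particular at the kink s = 0.\<close>

lemma max_square_deriv: "((\<lambda>s. (max 0 s)\<^sup>2) has_real_derivative 2 * max 0 s) (at s)" for s :: real
proof -
  have *: "\<bar>(max 0 t)\<^sup>2 - (max 0 s)\<^sup>2 - 2 * max 0 s * (t - s)\<bar> \<le> \<bar>t - s\<bar> * \<bar>t - s\<bar>" for t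
  proof (cases "t \<le> 0"; cases "s \<le> 0")
    assume "t \<le> 0" "\<not> s \<le> 0"
    then have "(max 0 t)\<^sup>2 - (max 0 s)\<^sup>2 - 2 * max 0 s * (t - s) = s * s - 2 * s * t"
      by (simp add: max_def power2_eq_square algebra_simps)
    moreover have "0 \<le> s * s - 2 * s * t" "s * s - 2 * s * t \<le> (t - s) * (t - s)"
      using \<open>t \<le> 0\<close> \<open>\<not> s \<le> 0\<close> mult_nonneg_nonpos[of s t] zero_le_square[of t] by (auto simp: algebra_simps add_nonneg_nonneg)
    ultimately show ?thesis by (simp add: abs_mult_self_eq)
  next
    assume "\<not> t \<le> 0" "s \<le> 0"
    then have "t * t \<le> (t - s) * (t - s)" by (intro mult_mono) auto
    then show ?thesis using \<open>\<not> t \<le> 0\<close> \<open>s \<le> 0\<close> by (simp add: max_def power2_eq_square)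
  next
    assume "t \<le> 0" "s \<le> 0"
    then show ?thesis by (simp add: max_def)
  next
    assume "\<not> t \<le> 0" "\<not> s \<le> 0"
    then have "(max 0 t)\<^sup>2 - (max 0 s)\<^sup>2 - 2 * max 0 s * (t - s) = (t - s) * (t - s)"
      by (simp add: max_def power2_eq_square algebra_simps)
    then show ?thesis by (simp add: abs_mult_self_eq)
  qed
  show ?thesis
    unfolding has_field_derivative_def has_derivative_at_alt
  proof (intro conjI allI impI)
    show "bounded_linear ((*) (2 * max 0 s))" by (rule bounded_linear_mult_right)
    fix e :: real assume "0 < e"
    then show "\<exists>d>0. \<forall>y. norm (y - s) < d \<longrightarrow>
       norm ((max 0 y)\<^sup>2 - (max 0 s)\<^sup>2 - 2 * max 0 s * (y - s)) \<le> e * norm (y - s)"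
      by (intro exI[of _ e]) (auto intro!: order_trans[OF *] mult_right_mono)
  qed
qed

lemma bump_derivative: "(bump d has_derivative (\<lambda>v. bump_grad d x \<bullet> v)) (at x)"
proof -
  have "((\<lambda>x::'a. d\<^sup>2 - x \<bullet> x) has_derivative (\<lambda>v. - (2 * (x \<bullet> v)))) (at x)"
    by (auto intro!: derivative_eq_intros simp: inner_commute)
  then have "((\<lambda>x. (max 0 (d\<^sup>2 - x \<bullet> x))\<^sup>2) has_derivative (\<lambda>v. 2 * max 0 (d\<^sup>2 - x \<bullet> x) * (- (2 * (x \<bullet> v))))) (at x)"
    using has_derivative_compose[OF _ max_square_deriv[unfolded has_field_derivative_def]] by fastforce
  then show ?thesis
    unfolding bump_def[abs_def] bump_grad_def by (simp add: mult.assoc)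
qed

text \<open>The gradient is -4 p(x) x with p at most d^2. In the difference of the products p(x) x,
  changing x costs d^2 |x - y|, and changing p costs 2 d |x - y| times a norm at most d. Together
  this is 3 d^2, and the factor 4 gives 12 d^2.\<close>

lemma bump_grad_lipschitz:
  fixes x y :: "'a::euclidean_space"
  assumes "0 < d"
  shows "norm (bump_grad d x - bump_grad d y) \<le> 12 * d\<^sup>2 * norm (x - y)"
proof -
  define p where "p x = max 0 (d\<^sup>2 - x \<bullet> x)" for x :: 'a
  have p0: "0 \<le> p x" "p x \<le> d\<^sup>2" for x by (auto simp: p_def)
  have psmall: "norm x \<le> d \<Longrightarrow> p x = (d - norm x) * (d + norm x)" for x
    using power_mono[of "norm x" d 2] by (simp add: p_def power2_norm_eq_inner[symmetric] power2_eq_square algebra_simps)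
  have plarge: "d \<le> norm x \<Longrightarrow> p x = 0" for x
    using power_mono[of d "norm x" 2] assms by (simp add: p_def power2_norm_eq_inner[symmetric] max_def)
  have tri: "\<bar>norm x - norm y\<bar> \<le> norm (x - y)" for x y :: 'a by (rule norm_triangle_ineq3)
  have main: "norm (p x *\<^sub>R x - p y *\<^sub>R y) \<le> 3 * d\<^sup>2 * norm (x - y)" if "norm x \<le> d" for x y
  proof (cases "norm y \<le> d")
    case True
    have "p x *\<^sub>R x - p y *\<^sub>R y = p x *\<^sub>R (x - y) + (p x - p y) *\<^sub>R y"
      by (simp add: algebra_simps)
    then have "norm (p x *\<^sub>R x - p y *\<^sub>R y) \<le> p x * norm (x - y) + \<bar>p x - p y\<bar> * norm y"
      by (metis norm_triangle_ineq norm_scaleR abs_of_nonneg p0(1))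
    also have "\<dots> \<le> d\<^sup>2 * norm (x - y) + (norm (x - y) * (2 * d)) * d"
    proof (intro add_mono mult_mono)
      have "p x - p y = (norm y - norm x) * (norm x + norm y)"
        using that True psmall by (simp add: algebra_simps)
      then show "\<bar>p x - p y\<bar> \<le> norm (x - y) * (2 * d)"
        using that True tri[of x y] by (auto simp: abs_mult intro!: mult_mono)
    qed (use p0 True assms in auto)
    finally show ?thesis by (simp add: power2_eq_square algebra_simps)
  next
    case False
    have "norm (p x *\<^sub>R x - p y *\<^sub>R y) = p x * norm x" using plarge[of y] False p0 by simp
    also have "\<dots> \<le> (norm (x - y) * (2 * d)) * d"
      unfolding psmall[OF that] using that False tri[of x y] assms by (intro mult_mono) auto
    also have "\<dots> \<le> 3 * d\<^sup>2 * norm (x - y)"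
    proof -
      have "0 \<le> d\<^sup>2 * norm (x - y)" by simp
      then show ?thesis by (simp add: power2_eq_square algebra_simps)
    qed
    finally show ?thesis .
  qed
  have "norm (p x *\<^sub>R x - p y *\<^sub>R y) \<le> 3 * d\<^sup>2 * norm (x - y)"
  proof (cases "norm x \<le> d \<or> norm y \<le> d")
    case True
    then show ?thesis using main[of x y] main[of y x] by (auto simp: norm_minus_commute)
  next
    case False
    then show ?thesis using plarge[of x] plarge[of y] by simp
  qed
  moreover have "bump_grad d x - bump_grad d y = (-4) *\<^sub>R (p x *\<^sub>R x - p y *\<^sub>R y)"
    by (simp add: bump_grad_def p_def scaleR_diff_right)
  ultimately show ?thesis by (simp only: norm_scaleR)
qed

lemma bump_taylor:
  fixes x v :: "'a::euclidean_space"
  assumes "0 < d"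
  shows "\<bar>bump d (x + v) - bump d x - bump_grad d x \<bullet> v\<bar> \<le> 12 * d\<^sup>2 * (norm v)\<^sup>2"
proof -
  have "((\<lambda>t. bump d (x + t *\<^sub>R v)) has_derivative (\<lambda>s. bump_grad d (x + t *\<^sub>R v) \<bullet> (s *\<^sub>R v))) (at t within {0..1})" for t
    by (rule has_derivative_compose[OF _ bump_derivative]) (auto intro!: derivative_eq_intros)
  then obtain t where t: "t \<in> {0<..<1}" "bump d (x + 1 *\<^sub>R v) - bump d (x + 0 *\<^sub>R v) = bump_grad d (x + t *\<^sub>R v) \<bullet> ((1 - 0) *\<^sub>R v)"
    using mvt_simple[of 0 1 "\<lambda>t. bump d (x + t *\<^sub>R v)" "\<lambda>t s. bump_grad d (x + t *\<^sub>R v) \<bullet> (s *\<^sub>R v)"] by auto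
  then have "bump d (x + v) - bump d x - bump_grad d x \<bullet> v = (bump_grad d (x + t *\<^sub>R v) - bump_grad d x) \<bullet> v"
    by (simp add: inner_diff_left)
  also have "\<bar>\<dots>\<bar> \<le> norm (bump_grad d (x + t *\<^sub>R v) - bump_grad d x) * norm v"
    by (rule Cauchy_Schwarz_ineq2)
  also have "\<dots> \<le> (12 * d\<^sup>2 * norm v) * norm v"
  proof (rule mult_right_mono)
    have "norm (bump_grad d (x + t *\<^sub>R v) - bump_grad d x) \<le> 12 * d\<^sup>2 * norm (x + t *\<^sub>R v - x)"
      by (rule bump_grad_lipschitz[OF assms])
    also have "\<dots> \<le> 12 * d\<^sup>2 * norm v"
      using t(1) by (intro mult_left_mono) (auto intro: mult_left_le_one_le)
    finally show "norm (bump_grad d (x + t *\<^sub>R v) - bump_grad d x) \<le> 12 * d\<^sup>2 * norm v" .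
  qed simp
  finally show ?thesis by (simp add: power2_eq_square mult.assoc)
qed

lemma mollifier_exists:
  assumes d: "0 < d"
  obtains k :: "'a::euclidean_space \<Rightarrow> real" and \<kappa> L where "mollifier k \<kappa> d L"
proof -
  define Z where "Z = (\<integral>x. bump d (x::'a) \<partial>lborel)"
  have cont: "continuous_on UNIV (bump d :: 'a \<Rightarrow> real)"
    unfolding bump_def[abs_def] by (intro continuous_intros)
  then have [measurable]: "bump d \<in> borel_measurable (borel :: 'a measure)"
    by (rule borel_measurable_continuous_onI)
  have out: "d\<^sup>2 - x \<bullet> x \<le> 0" if "d \<le> norm x" for x :: 'a
    using power_mono[OF that, of 2] d by (simp add: power2_norm_eq_inner[symmetric])
  have supp: "bump d x = 0" "bump_grad d x = 0" if "d \<le> norm x" for x :: 'a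
    using out[OF that] by (auto simp: bump_def bump_grad_def max_def)
  have bnd: "bump d x \<le> (d\<^sup>2)\<^sup>2" for x :: 'a
    unfolding bump_def by (intro power_mono) auto
  have nn: "0 \<le> bump d x" for x :: 'a by (simp add: bump_def)
  have int: "integrable lborel (bump d :: 'a \<Rightarrow> real)"
    by (rule integrable_bounded_support[where R=d and M="(d\<^sup>2)\<^sup>2"]) (use supp bnd nn in auto)
  \<comment> \<open>The normalising constant could vanish only if the kernel were zero almost
    everywhere, but it is positive on the open ball of radius \<open>d\<close>.\<close>
  have Z: "Z > 0"
  proof -
    have "Z \<noteq> 0"
    proof
      assume "Z = 0"
      then have "AE x in lborel. bump d (x::'a) = 0"
        using integral_nonneg_eq_0_iff_AE[OF int] nn by (auto simp: Z_def)
      then have "emeasure lborel {x::'a. bump d x \<noteq> 0} = 0"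
        by (subst (asm) AE_iff_measurable[OF _ refl]) auto
      moreover have "ball 0 d \<subseteq> {x::'a. bump d x \<noteq> 0}"
      proof
        fix x :: 'a assume "x \<in> ball 0 d"
        then have "(norm x)\<^sup>2 < d\<^sup>2" using d by (intro power_strict_mono) auto
        then show "x \<in> {x. bump d x \<noteq> 0}" by (simp add: bump_def power2_norm_eq_inner max_def)
      qed
      then have "emeasure lborel (ball (0::'a) d) \<le> emeasure lborel {x::'a. bump d x \<noteq> 0}"
        by (intro emeasure_mono) auto
      moreover have "emeasure lborel (ball (0::'a) d) > 0"
        using d by (simp add: emeasure_ball)
      ultimately show False by simp
    qed
    moreover have "Z \<ge> 0" unfolding Z_def by (simp add: nn)
    ultimately show ?thesis by simp
  qed
  have "mollifier (\<lambda>x::'a. bump d x / Z) (\<lambda>x. bump_grad d x /\<^sub>R Z) d (12 * d\<^sup>2 / Z)"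
  proof
    fix x y v :: 'a
    show "bump d (-x) / Z = bump d x / Z" "bump_grad d (-x) /\<^sub>R Z = - (bump_grad d x /\<^sub>R Z)"
      by (auto simp: bump_def bump_grad_def)
    have "norm (bump_grad d x /\<^sub>R Z - bump_grad d y /\<^sub>R Z) = norm (bump_grad d x - bump_grad d y) / Z"
      using Z by (simp add: scaleR_diff_right[symmetric] divide_inverse mult.commute)
    also have "\<dots> \<le> 12 * d\<^sup>2 * norm (x - y) / Z"
      using Z bump_grad_lipschitz[OF d] by (intro divide_right_mono) auto
    finally show "norm (bump_grad d x /\<^sub>R Z - bump_grad d y /\<^sub>R Z) \<le> 12 * d\<^sup>2 / Z * norm (x - y)" by simp
    have "bump d (x + v) / Z - bump d x / Z - (bump_grad d x /\<^sub>R Z) \<bullet> v = (bump d (x + v) - bump d x - bump_grad d x \<bullet> v) / Z"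
      using Z by (simp add: field_simps)
    also have "\<bar>\<dots>\<bar> = \<bar>bump d (x + v) - bump d x - bump_grad d x \<bullet> v\<bar> / Z" using Z by simp
    also have "\<dots> \<le> 12 * d\<^sup>2 * (norm v)\<^sup>2 / Z"
      using Z bump_taylor[OF d] by (intro divide_right_mono) auto
    finally show "\<bar>bump d (x + v) / Z - bump d x / Z - (bump_grad d x /\<^sub>R Z) \<bullet> v\<bar> \<le> 12 * d\<^sup>2 / Z * (norm v)\<^sup>2" by simp
    show "\<exists>M. \<forall>x::'a. bump d x / Z \<le> M"
      using Z bnd by (intro exI[of _ "(d\<^sup>2)\<^sup>2 / Z"]) (auto intro!: divide_right_mono)
    show "(\<integral>x. bump d (x::'a) / Z \<partial>lborel) = 1"
      using Z int by (simp add: Z_def)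
  qed (use d Z supp nn in auto)
  then show ?thesis by (rule that)
qed

section \<open>Convolution of vector fields\<close>

context mollifier
begin

lemma grad_bounded: "norm (\<kappa> x) \<le> L * d"
proof (cases "norm x \<le> d")
  case True
  have "\<kappa> 0 = 0" using grad_odd[of 0] by (simp add: eq_neg_iff_add_eq_0 scaleR_2[symmetric])
  then have "norm (\<kappa> x) \<le> L * norm x" using grad_lipschitz[of x 0] by simp
  also have "\<dots> \<le> L * d" using True L_nonneg by (intro mult_left_mono)
  finally show ?thesis .
next
  case False
  then show ?thesis using grad_supp[of x] d_pos L_nonneg by simp
qed

lemma continuous_on_grad: "continuous_on UNIV \<kappa>"
  using grad_lipschitz L_nonneg
  by (intro lipschitz_on_continuous_on[of L]) (auto simp: lipschitz_on_def dist_norm)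

lemma grad_borel [measurable]: "\<kappa> \<in> borel_measurable borel"
  by (rule borel_measurable_continuous_onI[OF continuous_on_grad])

lemma integrable_k: "integrable lborel k"
proof -
  obtain M where "\<And>x. k x \<le> M" using k_bounded by auto
  then show ?thesis
    by (intro integrable_bounded_support[where R=d and M=M]) (use k_supp k_nonneg in auto)
qed

lemma nn_integral_k: "(\<integral>\<^sup>+x. ennreal (k x) \<partial>lborel) = 1"
  using nn_integral_eq_integral[OF integrable_k] k_nonneg k_integral by simp

lemma integrable_shift_mult:
  fixes f :: "'a \<Rightarrow> 'a" and h :: "'a \<Rightarrow> real"
  assumes [measurable]: "f \<in> borel_measurable borel" "h \<in> borel_measurable borel"
    and "\<And>y. norm (f y) \<le> 1" "\<And>y. norm y > R \<Longrightarrow> f y = 0" "\<And>y. \<bar>h y\<bar> \<le> M"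
  shows "integrable lborel (\<lambda>y. h (x - y) *\<^sub>R f y)"
proof (rule integrable_bounded_support[where R=R and M="M"])
  fix y show "norm (h (x - y) *\<^sub>R f y) \<le> M"
    using mult_mono[OF assms(5)[of "x - y"] assms(3)[of y]] assms(5)[of y] by force
qed (use assms in auto)

text \<open>Convolution makes a merely measurable field admissible with the same bound on its norm.
  The derivative falls on the kernel: the Taylor remainder is at most L |v|^2, integrated over a
  ball that carries \<open>f\<close>, which is differentiation under the integral sign.\<close>

lemma mollified_field:
  fixes f :: "'a \<Rightarrow> 'a" and x :: 'a
  assumes [measurable]: "f \<in> borel_measurable borel"
    and f1: "\<And>y. norm (f y) \<le> 1" and f0: "\<And>y. norm y > R \<Longrightarrow> f y = 0"
  defines "G \<equiv> \<lambda>x. \<integral>y. k (x - y) *\<^sub>R f y \<partial>lborel"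
  shows "C1_compact_support G" "norm (G x) \<le> 1"
    "divergence G x = (\<integral>y. \<kappa> (x - y) \<bullet> f y \<partial>lborel)"
proof -
  define G' where "G' x v = (\<integral>y. (\<kappa> (x - y) \<bullet> v) *\<^sub>R f y \<partial>lborel)" for x v
  define m where "m = measure lborel (cball (0::'a) R)"
  obtain M where M: "\<And>x. k x \<le> M" using k_bounded by auto
  have kM: "\<bar>k x\<bar> \<le> M" for x using M k_nonneg by simp
  have intk: "integrable lborel (\<lambda>y. k (x - y) *\<^sub>R f y)" for x
    by (rule integrable_shift_mult[where R=R and M=M]) (use f1 f0 kM in auto)
  have gb: "\<bar>\<kappa> x \<bullet> v\<bar> \<le> L * d * norm v" for x v
    using Cauchy_Schwarz_ineq2[of "\<kappa> x" v] mult_right_mono[OF grad_bounded, of "norm v" x] by simp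
  have intg: "integrable lborel (\<lambda>y. (\<kappa> (x - y) \<bullet> v) *\<^sub>R f y)" for x v
    by (rule integrable_shift_mult[where R=R and M="L * d * norm v" and h="\<lambda>z. \<kappa> z \<bullet> v"]) (use f1 f0 gb in auto)
  have bound: "norm (\<integral>y. h y *\<^sub>R f y \<partial>lborel) \<le> c * m"
    if "\<And>y. \<bar>h y\<bar> \<le> c" "integrable lborel (\<lambda>y. h y *\<^sub>R f y)" for h c
  proof -
    have c0: "0 \<le> c" using that(1)[of 0] by simp
    have "norm (\<integral>y. h y *\<^sub>R f y \<partial>lborel) \<le> (\<integral>y. c * indicator (cball (0::'a) R) y \<partial>lborel)"
    proof (rule bochner_integral_norm_le[OF that(2)])
      show "integrable lborel (\<lambda>y. c * indicat_real (cball (0::'a) R) y)"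
        using emeasure_lborel_cball_finite[of "0::'a" R] by (intro integrable_mult_right integrable_real_indicator) auto
      show "norm (h y *\<^sub>R f y) \<le> c * indicat_real (cball 0 R) y" for y
        using mult_mono[OF that(1)[of y] f1[of y]] c0 f0[of y] by (auto simp: indicator_def)
    qed
    then show ?thesis by (simp add: m_def)
  qed
  have m0: "0 \<le> m" by (simp add: m_def)
  have lin: "bounded_linear (G' x)" for x
  proof (rule bounded_linear_intro[where K="L * d * m"])
    show "G' x (v + w) = G' x v + G' x w" for v w
      unfolding G'_def by (subst Bochner_Integration.integral_add[symmetric]) (auto intro: intg simp: inner_add_right scaleR_add_left)
    show "G' x (r *\<^sub>R v) = r *\<^sub>R G' x v" for r v
    proof -
      have eq: "(\<lambda>y. (\<kappa> (x - y) \<bullet> r *\<^sub>R v) *\<^sub>R f y) = (\<lambda>y. r *\<^sub>R ((\<kappa> (x - y) \<bullet> v) *\<^sub>R f y))"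
        by (rule ext) (simp only: inner_scaleR_right scaleR_scaleR)
      show ?thesis unfolding G'_def eq by (rule integral_scaleR_right)
    qed
    show "norm (G' x v) \<le> norm v * (L * d * m)" for v
      using bound[of "\<lambda>y. \<kappa> (x - y) \<bullet> v", OF gb intg] by (simp add: G'_def mult_ac)
  qed
  have der: "(G has_derivative G' x) (at x)" for x
    unfolding has_derivative_at_alt
  proof (intro conjI lin allI impI)
    fix e :: real assume e: "0 < e"
    have est: "norm (G z - G x - G' x (z - x)) \<le> (L * m * norm (z - x)) * norm (z - x)" for z
    proof -
      have eq: "G z - G x - G' x (z - x) = (\<integral>y. (k (z - y) - k (x - y) - \<kappa> (x - y) \<bullet> (z - x)) *\<^sub>R f y \<partial>lborel)"
        unfolding G_def G'_def
        by (simp add: intk intg scaleR_diff_left)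
      have "norm (G z - G x - G' x (z - x)) \<le> (L * (norm (z - x))\<^sup>2) * m"
        unfolding eq
      proof (rule bound)
        show "\<bar>k (z - y) - k (x - y) - \<kappa> (x - y) \<bullet> (z - x)\<bar> \<le> L * (norm (z - x))\<^sup>2" for y
          using taylor[of "x - y" "z - x"] by simp
        show "integrable lborel (\<lambda>y. (k (z - y) - k (x - y) - \<kappa> (x - y) \<bullet> (z - x)) *\<^sub>R f y)"
          using intk intg by (simp add: scaleR_diff_left)
      qed
      then show ?thesis by (simp add: power2_eq_square mult_ac)
    qed
    show "\<exists>\<delta>>0. \<forall>z. norm (z - x) < \<delta> \<longrightarrow> norm (G z - G x - G' x (z - x)) \<le> e * norm (z - x)"
    \<comment> \<open>The summand 1 keeps the denominator positive when L m = 0.\<close>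
    proof (intro exI[of _ "e / (L * m + 1)"] conjI allI impI)
      show "0 < e / (L * m + 1)" using e m0 L_nonneg by (intro divide_pos_pos) (auto simp: add_nonneg_pos)
      fix z assume z: "norm (z - x) < e / (L * m + 1)"
      have Lm: "0 \<le> L * m" using m0 L_nonneg by simp
      have "L * m * norm (z - x) \<le> (L * m + 1) * norm (z - x)" by (intro mult_right_mono) auto
      also have "\<dots> \<le> e" using z Lm by (simp add: field_simps less_eq_real_def)
      finally show "norm (G z - G x - G' x (z - x)) \<le> e * norm (z - x)"
        by (intro order_trans[OF est] mult_right_mono) auto
    qed
  qed
  show "C1_compact_support G"
  proof (rule C1_compact_supportI[OF der])
    fix v
    have "norm (G' x v - G' z v) \<le> (L * norm v * m) * norm (x - z)" for x z
    proof -
      have eq: "G' x v - G' z v = (\<integral>y. ((\<kappa> (x - y) - \<kappa> (z - y)) \<bullet> v) *\<^sub>R f y \<partial>lborel)"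
        unfolding G'_def by (simp add: intg scaleR_diff_left inner_diff_left)
      have "norm (G' x v - G' z v) \<le> (L * norm (x - z) * norm v) * m"
        unfolding eq
      proof (rule bound)
        fix y
        have "\<bar>(\<kappa> (x - y) - \<kappa> (z - y)) \<bullet> v\<bar> \<le> norm (\<kappa> (x - y) - \<kappa> (z - y)) * norm v" by (rule Cauchy_Schwarz_ineq2)
        also have "\<dots> \<le> L * norm (x - z) * norm v"
          using grad_lipschitz[of "x - y" "z - y"] by (intro mult_right_mono) auto
        finally show "\<bar>(\<kappa> (x - y) - \<kappa> (z - y)) \<bullet> v\<bar> \<le> L * norm (x - z) * norm v" .
      next
        show "integrable lborel (\<lambda>y. ((\<kappa> (x - y) - \<kappa> (z - y)) \<bullet> v) *\<^sub>R f y)"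
          using intg by (simp add: scaleR_diff_left inner_diff_left)
      qed
      then show ?thesis by (simp add: mult_ac)
    qed
    then show "continuous_on UNIV (\<lambda>x. G' x v)"
      using L_nonneg m0
      by (intro lipschitz_on_continuous_on[of "L * norm v * m"]) (auto simp: lipschitz_on_def dist_norm)
  next
    \<comment> \<open>The field lives within radius \<open>R\<close> and the kernel reaches
      \<open>d\<close> further.\<close>
    fix x :: 'a assume x: "norm x > R + d"
    have "k (x - y) *\<^sub>R f y = 0" for y
      using f0[of y] k_supp[of "x - y"] norm_triangle_sub[of x y] x by (cases "norm y > R") auto
    then have "(\<lambda>y. k (x - y) *\<^sub>R f y) = (\<lambda>_. 0)" by (rule ext)
    then show "G x = 0" by (simp only: G_def Bochner_Integration.integral_zero)
  qed
  show "norm (G x) \<le> 1"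
  proof -
    have ik: "integrable lborel (\<lambda>y. k (x - y))"
      using lborel_integrable_affine[of "-1" k x] integrable_k by simp
    have "norm (G x) \<le> (\<integral>y. k (x - y) \<partial>lborel)"
      unfolding G_def
      by (rule bochner_integral_norm_le[OF intk ik])
         (use f1 k_nonneg mult_left_mono in fastforce)
    also have "\<dots> = 1" using lborel_integral_reflect[OF k_borel, of x] k_integral by simp
    finally show ?thesis .
  qed
  have "divergence G x = (\<Sum>b\<in>Basis. G' x b \<bullet> b)" by (rule divergence_eq[OF der])
  also have "\<dots> = (\<Sum>b\<in>Basis. \<integral>y. (\<kappa> (x - y) \<bullet> b) * (f y \<bullet> b) \<partial>lborel)"
    unfolding G'_def by (subst integral_inner_left[symmetric]) (auto intro: intg)
  also have "\<dots> = (\<integral>y. (\<Sum>b\<in>Basis. (\<kappa> (x - y) \<bullet> b) * (f y \<bullet> b)) \<partial>lborel)"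
  proof (rule Bochner_Integration.integral_sum[symmetric])
    show "integrable lborel (\<lambda>y. (\<kappa> (x - y) \<bullet> b) * (f y \<bullet> b))" for b
      using integrable_inner_left[OF intg[of x b], of b] by simp
  qed
  also have "\<dots> = (\<integral>y. \<kappa> (x - y) \<bullet> f y \<partial>lborel)"
    by (simp add: euclidean_inner[symmetric])
  finally show "divergence G x = (\<integral>y. \<kappa> (x - y) \<bullet> f y \<partial>lborel)" .
qed

end

text \<open>Test fields have bounded support, so integral bounds are first obtained on balls;
  monotone convergence removes the restriction.\<close>

lemma nn_integral_le_if_on_balls:
  fixes g :: "'a::euclidean_space \<Rightarrow> ennreal"
  assumes [measurable]: "g \<in> borel_measurable borel"
    and le: "\<And>n::nat. (\<integral>\<^sup>+x. g x * indicator (cball 0 (real n)) x \<partial>lborel) \<le> C"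
  shows "(\<integral>\<^sup>+x. g x \<partial>lborel) \<le> C"
proof -
  have eq: "(SUP n::nat. g x * indicator (cball 0 (real n)) x) = g x" for x
  proof (rule antisym)
    show "(SUP n::nat. g x * indicator (cball 0 (real n)) x) \<le> g x"
      by (rule SUP_least) (auto simp: indicator_def)
    obtain n :: nat where "norm x \<le> real n" using real_arch_simple by blast
    then have "g x = g x * indicator (cball 0 (real n)) x" by simp
    also have "\<dots> \<le> (SUP n::nat. g x * indicator (cball 0 (real n)) x)" by (rule SUP_upper) simp
    finally show "g x \<le> (SUP n::nat. g x * indicator (cball 0 (real n)) x)" .
  qed
  have "(\<integral>\<^sup>+x. g x \<partial>lborel) = (\<integral>\<^sup>+x. (SUP n::nat. g x * indicator (cball 0 (real n)) x) \<partial>lborel)"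
    by (simp only: eq)
  also have "\<dots> = (SUP n::nat. \<integral>\<^sup>+x. g x * indicator (cball 0 (real n)) x \<partial>lborel)"
    by (rule nn_integral_monotone_convergence_SUP)
       (auto simp: incseq_def le_fun_def indicator_def intro: order_trans)
  also have "\<dots> \<le> C" by (rule SUP_least) (rule le)
  finally show ?thesis .
qed

lemma measurable_diff_in_ball [measurable (raw)]:
  fixes f g :: "'b \<Rightarrow> 'a::euclidean_space"
  assumes [measurable]: "f \<in> borel_measurable M" "g \<in> borel_measurable M"
  shows "Measurable.pred M (\<lambda>x. f x - g x \<in> ball 0 r)"
  unfolding mem_ball dist_norm by measurable

section \<open>Convolution of indicator functions\<close>

context mollifier
begin

definition avg :: "'a set \<Rightarrow> 'a \<Rightarrow> real" where
  "avg \<Omega> x = (\<integral>y. indicator \<Omega> y * k (x - y) \<partial>lborel)"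

definition avg_grad :: "'a set \<Rightarrow> 'a \<Rightarrow> 'a" where
  "avg_grad \<Omega> x = (\<integral>y. indicator \<Omega> y *\<^sub>R \<kappa> (x - y) \<partial>lborel)"

text \<open>The volume of \<Omega> within distance d + 1 of \<open>x\<close>. For shifts of length
  at most 1, only these points contribute to the Taylor remainder of \<open>avg\<close>; unlike a
  constant, this weight is integrable over the whole space.\<close>

definition nbhd_mass :: "'a set \<Rightarrow> 'a \<Rightarrow> real" where
  "nbhd_mass \<Omega> x = (\<integral>y. indicator \<Omega> y * indicator (ball 0 (d + 1)) (x - y) \<partial>lborel)"

context
  fixes \<Omega> :: "'a set"
  assumes \<Omega> [measurable]: "\<Omega> \<in> sets borel" and fin: "emeasure lborel \<Omega> < \<infinity>"
begin

lemma integrable_indicator_\<Omega>: "integrable lborel (indicator \<Omega> :: 'a \<Rightarrow> real)"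
  using fin by (intro integrable_real_indicator) auto

lemma integrable_avg: "integrable lborel (\<lambda>y. indicator \<Omega> y * k (x - y))"
proof -
  obtain M where M: "\<And>x. k x \<le> M" using k_bounded by auto
  have "integrable lborel (\<lambda>y. indicator \<Omega> y * M)"
    using integrable_indicator_\<Omega> by simp
  then show ?thesis
  proof (rule Bochner_Integration.integrable_bound)
    show "AE y in lborel. norm (indicat_real \<Omega> y * k (x - y)) \<le> norm (indicat_real \<Omega> y * M)"
      using M k_nonneg by (intro AE_I2) (auto simp: indicator_def intro: order_trans[OF _ abs_ge_self])
  qed measurable
qed

lemma integrable_avg_grad: "integrable lborel (\<lambda>y. indicator \<Omega> y *\<^sub>R \<kappa> (x - y))"
proof -
  have "integrable lborel (\<lambda>y. indicator \<Omega> y * (L * d))"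
    using integrable_indicator_\<Omega> by simp
  then show ?thesis
    by (rule Bochner_Integration.integrable_bound)
       (use grad_bounded L_nonneg d_pos in \<open>auto simp: indicator_def\<close>)
qed

lemma avg_grad_lipschitz:
  "norm (avg_grad \<Omega> x - avg_grad \<Omega> z) \<le> (L * measure lborel \<Omega>) * norm (x - z)"
proof -
  have eq: "avg_grad \<Omega> x - avg_grad \<Omega> z = (\<integral>y. indicator \<Omega> y *\<^sub>R (\<kappa> (x - y) - \<kappa> (z - y)) \<partial>lborel)"
    unfolding avg_grad_def
    by (simp add: integrable_avg_grad scaleR_diff_right)
  have "norm (avg_grad \<Omega> x - avg_grad \<Omega> z) \<le> (\<integral>y. indicator \<Omega> y * (L * norm (x - z)) \<partial>lborel)"
    unfolding eq
  proof (rule bochner_integral_norm_le)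
    show "integrable lborel (\<lambda>y. indicator \<Omega> y *\<^sub>R (\<kappa> (x - y) - \<kappa> (z - y)))"
      using integrable_avg_grad by (simp add: scaleR_diff_right)
    show "integrable lborel (\<lambda>y. indicator \<Omega> y * (L * norm (x - z)))"
      using integrable_indicator_\<Omega> by simp
    show "norm (indicator \<Omega> y *\<^sub>R (\<kappa> (x - y) - \<kappa> (z - y))) \<le> indicator \<Omega> y * (L * norm (x - z))" for y
      using grad_lipschitz[of "x - y" "z - y"] by (auto simp: indicator_def)
  qed
  then show ?thesis by (simp add: mult_ac)
qed

lemma avg_grad_borel [measurable]: "avg_grad \<Omega> \<in> borel_measurable borel"
proof -
  have "continuous_on UNIV (avg_grad \<Omega>)"
    using avg_grad_lipschitz L_nonneg
    by (intro lipschitz_on_continuous_on[of "L * measure lborel \<Omega>"]) (auto simp: lipschitz_on_def dist_norm)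
  then show ?thesis by (rule borel_measurable_continuous_onI)
qed

text \<open>Fubini moves the kernel from the field to the indicator; the oddness of \<kappa>
  produces the sign. This links the definition of the perimeter to the gradient of the mollified
  indicator.\<close>

lemma integral_divergence_mollified_field:
  fixes f :: "'a \<Rightarrow> 'a"
  assumes [measurable]: "f \<in> borel_measurable borel"
    and f1: "\<And>y. norm (f y) \<le> 1" and f0: "\<And>y. norm y > R \<Longrightarrow> f y = 0"
  shows "(\<integral>x. indicator \<Omega> x * divergence (\<lambda>x. \<integral>y. k (x - y) *\<^sub>R f y \<partial>lborel) x \<partial>lborel)
    = - (\<integral>y. avg_grad \<Omega> y \<bullet> f y \<partial>lborel)"
proof -
  have "(\<integral>x. indicator \<Omega> x * divergence (\<lambda>x. \<integral>y. k (x - y) *\<^sub>R f y \<partial>lborel) x \<partial>lborel)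
    = (\<integral>x. (\<integral>y. indicator \<Omega> x * (\<kappa> (x - y) \<bullet> f y) \<partial>lborel) \<partial>lborel)"
    by (simp add: mollified_field(3)[OF assms])
  also have "\<dots> = (\<integral>y. (\<integral>x. indicator \<Omega> x * (\<kappa> (x - y) \<bullet> f y) \<partial>lborel) \<partial>lborel)"
  proof (rule lborel_pair.Fubini_integral[symmetric], unfold lborel_prod)
    show "integrable lborel (\<lambda>(x, y). indicator \<Omega> x * (\<kappa> (x - y) \<bullet> f y))"
    \<comment> \<open>If |y| <= R and |x - y| < d, then |x| < R + d, so the norm of the pair is at
      most 2 R + d.\<close>
    proof (rule integrable_bounded_support[where R = "2 * \<bar>R\<bar> + d" and M = "L * d"])
      show "(\<lambda>(x, y). indicator \<Omega> x * (\<kappa> (x - y) \<bullet> f y)) \<in> borel_measurable borel"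
        unfolding borel_prod[symmetric] by measurable
    next
      fix z :: "'a \<times> 'a" assume z: "2 * \<bar>R\<bar> + d < norm z"
      obtain x y where xy: "z = (x, y)" by force
      have "norm z \<le> norm x + norm y" unfolding xy by (rule norm_Pair_le)
      then have "norm y > R \<or> norm (x - y) \<ge> d"
        using z norm_triangle_sub[of x y] by linarith
      then show "(case z of (x, y) \<Rightarrow> indicator \<Omega> x * (\<kappa> (x - y) \<bullet> f y)) = 0"
        using f0 grad_supp by (auto simp: xy)
    next
      fix z :: "'a \<times> 'a"
      obtain x y where xy: "z = (x, y)" by force
      have "\<bar>\<kappa> (x - y) \<bullet> f y\<bar> \<le> norm (\<kappa> (x - y)) * norm (f y)" by (rule Cauchy_Schwarz_ineq2)
      also have "\<dots> \<le> (L * d) * 1" using grad_bounded f1 L_nonneg d_pos by (intro mult_mono) auto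
      finally show "norm (case z of (x, y) \<Rightarrow> indicator \<Omega> x * (\<kappa> (x - y) \<bullet> f y)) \<le> L * d"
        using L_nonneg d_pos by (auto simp: xy indicator_def)
    qed
  qed
  also have "\<dots> = (\<integral>y. - (avg_grad \<Omega> y \<bullet> f y) \<partial>lborel)"
  proof (rule Bochner_Integration.integral_cong[OF refl])
    fix y
    have "(\<integral>x. indicator \<Omega> x * (\<kappa> (x - y) \<bullet> f y) \<partial>lborel) = (\<integral>x. - ((indicator \<Omega> x *\<^sub>R \<kappa> (y - x)) \<bullet> f y) \<partial>lborel)"
      using grad_odd[of "y - x" for x] by (intro Bochner_Integration.integral_cong) auto
    also have "\<dots> = - (avg_grad \<Omega> y \<bullet> f y)"
      unfolding avg_grad_def using integrable_avg_grad[of y]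
      by (simp del: inner_scaleR_left)
    finally show "(\<integral>x. indicator \<Omega> x * (\<kappa> (x - y) \<bullet> f y) \<partial>lborel) = - (avg_grad \<Omega> y \<bullet> f y)" .
  qed
  finally show ?thesis by simp
qed

text \<open>The optimal field points against the gradient. Restricted to a ball and mollified it is
  admissible, and by the preceding identity it recovers the integral of the gradient norm over that
  ball.\<close>

lemma nn_integral_avg_grad_le_perimeter:
  "(\<integral>\<^sup>+x. ennreal (norm (avg_grad \<Omega> x)) \<partial>lborel) \<le> perimeter \<Omega>"
proof (cases "perimeter \<Omega> = \<infinity>")
  case False
  then obtain p where p: "perimeter \<Omega> = ennreal p" "0 \<le> p"
    by (metis ennreal_cases infinity_ennreal_def)
  show ?thesis
  proof (rule nn_integral_le_if_on_balls)
    fix n :: nat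
    define f where "f y = (if norm y \<le> real n then - sgn (avg_grad \<Omega> y) else 0)" for y
    have [measurable]: "f \<in> borel_measurable borel" unfolding f_def sgn_div_norm by measurable
    have f1: "norm (f y) \<le> 1" for y by (simp add: f_def norm_sgn)
    have f0: "f y = 0" if "norm y > real n" for y using that by (simp add: f_def)
    have dot: "- (avg_grad \<Omega> y \<bullet> f y) = norm (avg_grad \<Omega> y) * indicator (cball 0 (real n)) y" for y
      by (cases "avg_grad \<Omega> y = 0")
         (auto simp: f_def sgn_div_norm indicator_def power2_norm_eq_inner[symmetric] power2_eq_square)
    have c: "continuous_on UNIV (avg_grad \<Omega>)"
      using avg_grad_lipschitz L_nonneg
      by (intro lipschitz_on_continuous_on[of "L * measure lborel \<Omega>"]) (auto simp: lipschitz_on_def dist_norm)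
    have "compact ((\<lambda>y. norm (avg_grad \<Omega> y)) ` cball 0 (real n))"
      by (intro compact_continuous_image continuous_intros continuous_on_subset[OF c]) auto
    then obtain M where M: "\<And>y. norm y \<le> real n \<Longrightarrow> norm (avg_grad \<Omega> y) \<le> M"
      by (force simp: bounded_iff dest!: compact_imp_bounded)
    have int: "integrable lborel (\<lambda>y. norm (avg_grad \<Omega> y) * indicator (cball 0 (real n)) y)"
      by (rule integrable_bounded_support[where R="real n" and M="max M 0"])
         (use M in \<open>auto simp: indicator_def le_max_iff_disj\<close>)
    have "(\<integral>y. norm (avg_grad \<Omega> y) * indicator (cball 0 (real n)) y \<partial>lborel) = - (\<integral>y. avg_grad \<Omega> y \<bullet> f y \<partial>lborel)"
      unfolding dot[symmetric] by simp
    also have "\<dots> = (\<integral>x. indicator \<Omega> x * divergence (\<lambda>x. \<integral>y. k (x - y) *\<^sub>R f y \<partial>lborel) x \<partial>lborel)"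
      by (rule integral_divergence_mollified_field[symmetric]) (use f1 f0 in auto)
    also have "\<dots> \<le> p"
      by (rule perimeter_geD[OF \<Omega>]) (use p mollified_field[of f "real n"] f1 f0 in auto)
    finally have "(\<integral>\<^sup>+y. ennreal (norm (avg_grad \<Omega> y) * indicator (cball 0 (real n)) y) \<partial>lborel) \<le> ennreal p"
      by (subst nn_integral_eq_integral[OF int]) (auto intro: ennreal_leI)
    then show "(\<integral>\<^sup>+x. ennreal (norm (avg_grad \<Omega> x)) * indicator (cball 0 (real n)) x \<partial>lborel) \<le> perimeter \<Omega>"
      by (simp add: p ennreal_mult ennreal_indicator)
  qed measurable
qed simp

lemma integrable_nbhd_mass:
  "integrable lborel (\<lambda>y. indicator \<Omega> y * indicat_real (ball 0 (d + 1)) (x - y))"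
  by (rule Bochner_Integration.integrable_bound[OF integrable_indicator_\<Omega>])
     (auto simp: indicator_def)

lemma nbhd_mass_nonneg: "0 \<le> nbhd_mass \<Omega> x"
  by (simp add: nbhd_mass_def)

lemma ennreal_nbhd_mass:
  "ennreal (nbhd_mass \<Omega> x) = (\<integral>\<^sup>+y. indicator \<Omega> y * indicator (ball 0 (d + 1)) (x - y) \<partial>lborel)"
  unfolding nbhd_mass_def
  by (subst nn_integral_eq_integral[OF integrable_nbhd_mass, symmetric])
     (auto simp: ennreal_mult ennreal_indicator)

lemma nbhd_mass_borel [measurable]: "nbhd_mass \<Omega> \<in> borel_measurable borel"
proof -
  have "(\<lambda>x. \<integral>y. indicator \<Omega> y * indicat_real (ball 0 (d + 1)) (x - y) \<partial>lborel) \<in> borel_measurable lborel"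
    by measurable
  then show ?thesis unfolding nbhd_mass_def[abs_def] by simp
qed

lemma nn_integral_nbhd_mass:
  "(\<integral>\<^sup>+x. ennreal (nbhd_mass \<Omega> x) \<partial>lborel) = emeasure lborel \<Omega> * emeasure lborel (ball (0::'a) (d + 1))"
proof -
  have "(\<integral>\<^sup>+x. ennreal (nbhd_mass \<Omega> x) \<partial>lborel)
    = (\<integral>\<^sup>+x. \<integral>\<^sup>+y. indicator \<Omega> y * indicator (ball 0 (d + 1)) (x - y) \<partial>lborel \<partial>lborel)"
    by (simp add: ennreal_nbhd_mass)
  also have "\<dots> = (\<integral>\<^sup>+y. \<integral>\<^sup>+x. indicator \<Omega> y * indicator (ball 0 (d + 1)) (x - y) \<partial>lborel \<partial>lborel)"
    by (rule lborel_pair.Fubini') measurable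
  also have "\<dots> = (\<integral>\<^sup>+y. indicator \<Omega> y * emeasure lborel (ball (0::'a) (d + 1)) \<partial>lborel)"
  proof (rule nn_integral_cong)
    fix y :: 'a
    have "(\<integral>\<^sup>+x. indicator (ball 0 (d + 1)) (x - y) \<partial>lborel) = emeasure lborel (ball (0::'a) (d + 1))"
      using lborel_nn_integral_translate[OF borel_measurable_indicator[OF borel_open[OF open_ball]], of "0::'a" "d + 1" "- y"] by simp
    then show "(\<integral>\<^sup>+x. indicator \<Omega> y * indicator (ball 0 (d + 1)) (x - y) \<partial>lborel) = indicator \<Omega> y * emeasure lborel (ball (0::'a) (d + 1))"
      by (subst nn_integral_cmult) auto
  qed
  also have "\<dots> = emeasure lborel \<Omega> * emeasure lborel (ball (0::'a) (d + 1))"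
    by (subst nn_integral_multc) auto
  finally show ?thesis .
qed

lemma avg_taylor:
  assumes v: "norm v \<le> 1"
  shows "\<bar>avg \<Omega> (x + v) - avg \<Omega> x - avg_grad \<Omega> x \<bullet> v\<bar> \<le> L * (norm v)\<^sup>2 * nbhd_mass \<Omega> x"
proof -
  have i: "integrable lborel (\<lambda>y. (indicator \<Omega> y *\<^sub>R \<kappa> (x - y)) \<bullet> v)"
    by (rule integrable_inner_left) (rule integrable_avg_grad)
  have eq: "avg \<Omega> (x + v) - avg \<Omega> x - avg_grad \<Omega> x \<bullet> v
    = (\<integral>y. indicator \<Omega> y * k (x + v - y) - indicator \<Omega> y * k (x - y) - (indicator \<Omega> y *\<^sub>R \<kappa> (x - y)) \<bullet> v \<partial>lborel)"
    unfolding avg_def avg_grad_def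
    by (subst integral_inner_left[symmetric, OF integrable_avg_grad])
       (simp add: Bochner_Integration.integral_diff integrable_avg i del: inner_scaleR_left)
  have "\<bar>avg \<Omega> (x + v) - avg \<Omega> x - avg_grad \<Omega> x \<bullet> v\<bar>
    \<le> (\<integral>y. L * (norm v)\<^sup>2 * (indicator \<Omega> y * indicator (ball 0 (d + 1)) (x - y)) \<partial>lborel)"
    unfolding eq real_norm_def[symmetric]
  proof (rule bochner_integral_norm_le)
    show "integrable lborel (\<lambda>y. indicator \<Omega> y * k (x + v - y) - indicator \<Omega> y * k (x - y) - (indicator \<Omega> y *\<^sub>R \<kappa> (x - y)) \<bullet> v)"
      by (intro Bochner_Integration.integrable_diff integrable_avg i)
    show "integrable lborel (\<lambda>y. L * (norm v)\<^sup>2 * (indicator \<Omega> y * indicat_real (ball 0 (d + 1)) (x - y)))"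
      by (intro integrable_mult_right integrable_nbhd_mass)
    fix y
    show "norm (indicator \<Omega> y * k (x + v - y) - indicator \<Omega> y * k (x - y) - (indicator \<Omega> y *\<^sub>R \<kappa> (x - y)) \<bullet> v)
      \<le> L * (norm v)\<^sup>2 * (indicator \<Omega> y * indicator (ball 0 (d + 1)) (x - y))"
    proof (cases "norm (x - y) < d + 1")
      case True
      have eq: "x + v - y = x - y + v" by simp
      show ?thesis unfolding eq using taylor[of "x - y" v] True by (auto simp: indicator_def)
    next
      case False
      have "norm (x + v - y) \<ge> norm (x - y) - norm v"
        using norm_diff_ineq[of "x - y" v] by (simp add: algebra_simps)
      then have "norm (x + v - y) \<ge> d" "norm (x - y) \<ge> d" using False v by auto
      then show ?thesis using False k_supp grad_supp by (simp add: indicator_def)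
    qed
  qed
  then show ?thesis by (simp add: nbhd_mass_def)
qed

lemma avg_derivative: "(avg \<Omega> has_derivative (\<lambda>v. avg_grad \<Omega> x \<bullet> v)) (at x)"
  unfolding has_derivative_at_alt
proof (intro conjI allI impI)
  show "bounded_linear ((\<bullet>) (avg_grad \<Omega> x))" by (rule bounded_linear_inner_right)
  fix e :: real assume e: "0 < e"
  let ?c = "L * nbhd_mass \<Omega> x + 1"
  have c: "?c > 0" using L_nonneg nbhd_mass_nonneg[of x] by (simp add: add_nonneg_pos)
  show "\<exists>\<delta>>0. \<forall>y. norm (y - x) < \<delta> \<longrightarrow> norm (avg \<Omega> y - avg \<Omega> x - avg_grad \<Omega> x \<bullet> (y - x)) \<le> e * norm (y - x)"
  proof (intro exI[of _ "min 1 (e / ?c)"] conjI allI impI)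
    show "0 < min 1 (e / ?c)" using e c by simp
    fix y assume y: "norm (y - x) < min 1 (e / ?c)"
    have "L * nbhd_mass \<Omega> x * norm (y - x) \<le> ?c * norm (y - x)" by (intro mult_right_mono) auto
    also have "\<dots> \<le> e" using y c by (simp add: field_simps less_eq_real_def)
    finally have *: "L * nbhd_mass \<Omega> x * norm (y - x) \<le> e" .
    have "norm (avg \<Omega> y - avg \<Omega> x - avg_grad \<Omega> x \<bullet> (y - x)) \<le> L * (norm (y - x))\<^sup>2 * nbhd_mass \<Omega> x"
      using avg_taylor[of "y - x" x] y by simp
    also have "\<dots> = (L * nbhd_mass \<Omega> x * norm (y - x)) * norm (y - x)" by (simp add: power2_eq_square)
    also have "\<dots> \<le> e * norm (y - x)" using * by (rule mult_right_mono) simp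
    finally show "norm (avg \<Omega> y - avg \<Omega> x - avg_grad \<Omega> x \<bullet> (y - x)) \<le> e * norm (y - x)" .
  qed
qed

lemma continuous_on_avg: "continuous_on UNIV (avg \<Omega>)"
  by (intro continuous_at_imp_continuous_on ballI has_derivative_continuous[OF avg_derivative])

lemma avg_borel [measurable]: "avg \<Omega> \<in> borel_measurable borel"
  by (rule borel_measurable_continuous_onI[OF continuous_on_avg])

lemma avg_nonneg: "0 \<le> avg \<Omega> x"
  unfolding avg_def using k_nonneg by simp

lemma ennreal_avg: "ennreal (avg \<Omega> x) = (\<integral>\<^sup>+y. indicator \<Omega> y * ennreal (k (x - y)) \<partial>lborel)"
  unfolding avg_def
  by (subst nn_integral_eq_integral[OF integrable_avg, symmetric])
     (auto simp: ennreal_mult ennreal_indicator k_nonneg)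

lemma nn_integral_avg: "(\<integral>\<^sup>+x. ennreal (avg \<Omega> x) \<partial>lborel) = emeasure lborel \<Omega>"
proof -
  have "(\<integral>\<^sup>+x. ennreal (avg \<Omega> x) \<partial>lborel) = (\<integral>\<^sup>+x. \<integral>\<^sup>+y. indicator \<Omega> y * ennreal (k (x - y)) \<partial>lborel \<partial>lborel)"
    by (simp add: ennreal_avg)
  also have "\<dots> = (\<integral>\<^sup>+y. \<integral>\<^sup>+x. indicator \<Omega> y * ennreal (k (x - y)) \<partial>lborel \<partial>lborel)"
    by (rule lborel_pair.Fubini') measurable
  also have "\<dots> = (\<integral>\<^sup>+y. indicator \<Omega> y \<partial>lborel)"
  proof (rule nn_integral_cong)
    fix y
    have "(\<integral>\<^sup>+x. ennreal (k (x - y)) \<partial>lborel) = 1"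
      using lborel_nn_integral_translate[of "\<lambda>x. ennreal (k x)" "- y"] nn_integral_k by simp
    then show "(\<integral>\<^sup>+x. indicator \<Omega> y * ennreal (k (x - y)) \<partial>lborel) = indicator \<Omega> y"
      by (subst nn_integral_cmult) auto
  qed
  finally show ?thesis by simp
qed

text \<open>The linear Taylor term is paid for by the perimeter, the quadratic one by the total of
  \<open>nbhd_mass\<close>. The quadratic error disappears in
  \<open>nn_integral_avg_increment\<close>.\<close>

lemma nn_integral_avg_increment_small:
  assumes p: "perimeter \<Omega> \<le> ennreal p" "0 \<le> p" and v: "norm v \<le> 1"
  shows "(\<integral>\<^sup>+x. ennreal \<bar>avg \<Omega> (x + v) - avg \<Omega> x\<bar> \<partial>lborel)
    \<le> ennreal (norm v * p + L * (norm v)\<^sup>2 * (measure lborel \<Omega> * measure lborel (ball (0::'a) (d + 1))))"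
proof -
  have "(\<integral>\<^sup>+x. ennreal \<bar>avg \<Omega> (x + v) - avg \<Omega> x\<bar> \<partial>lborel)
    \<le> (\<integral>\<^sup>+x. ennreal (norm v) * ennreal (norm (avg_grad \<Omega> x)) + ennreal (L * (norm v)\<^sup>2) * ennreal (nbhd_mass \<Omega> x) \<partial>lborel)"
  proof (rule nn_integral_mono)
    fix x
    have "\<bar>avg \<Omega> (x + v) - avg \<Omega> x\<bar> \<le> \<bar>avg_grad \<Omega> x \<bullet> v\<bar> + L * (norm v)\<^sup>2 * nbhd_mass \<Omega> x"
      using avg_taylor[OF v, of x] by linarith
    also have "\<dots> \<le> norm v * norm (avg_grad \<Omega> x) + L * (norm v)\<^sup>2 * nbhd_mass \<Omega> x"
      using Cauchy_Schwarz_ineq2[of "avg_grad \<Omega> x" v] by (simp add: mult.commute)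
    finally show "ennreal \<bar>avg \<Omega> (x + v) - avg \<Omega> x\<bar> \<le> ennreal (norm v) * ennreal (norm (avg_grad \<Omega> x)) + ennreal (L * (norm v)\<^sup>2) * ennreal (nbhd_mass \<Omega> x)"
      using L_nonneg nbhd_mass_nonneg[of x]
      by (simp flip: ennreal_mult ennreal_plus)
  qed
  also have "\<dots> = ennreal (norm v) * (\<integral>\<^sup>+x. ennreal (norm (avg_grad \<Omega> x)) \<partial>lborel) + ennreal (L * (norm v)\<^sup>2) * (\<integral>\<^sup>+x. ennreal (nbhd_mass \<Omega> x) \<partial>lborel)"
    by (simp add: nn_integral_add nn_integral_cmult)
  also have "\<dots> \<le> ennreal (norm v) * ennreal p + ennreal (L * (norm v)\<^sup>2) * (\<integral>\<^sup>+x. ennreal (nbhd_mass \<Omega> x) \<partial>lborel)"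
    by (intro add_mono mult_left_mono order_trans[OF nn_integral_avg_grad_le_perimeter p(1)]) auto
  also have "(\<integral>\<^sup>+x. ennreal (nbhd_mass \<Omega> x) \<partial>lborel) = ennreal (measure lborel \<Omega> * measure lborel (ball (0::'a) (d + 1)))"
    unfolding nn_integral_nbhd_mass using fin emeasure_lborel_ball_finite[of "0::'a" "d + 1"]
    by (simp add: emeasure_eq_ennreal_measure ennreal_mult less_top)
  finally show ?thesis
    using p L_nonneg by (simp flip: ennreal_mult ennreal_plus)
qed

lemma nn_integral_avg_increment_subadd:
  "(\<integral>\<^sup>+x. ennreal \<bar>avg \<Omega> (x + (v + w)) - avg \<Omega> x\<bar> \<partial>lborel)
   \<le> (\<integral>\<^sup>+x. ennreal \<bar>avg \<Omega> (x + v) - avg \<Omega> x\<bar> \<partial>lborel) + (\<integral>\<^sup>+x. ennreal \<bar>avg \<Omega> (x + w) - avg \<Omega> x\<bar> \<partial>lborel)"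
proof -
  have "(\<integral>\<^sup>+x. ennreal \<bar>avg \<Omega> (x + (v + w)) - avg \<Omega> x\<bar> \<partial>lborel)
    \<le> (\<integral>\<^sup>+x. ennreal \<bar>avg \<Omega> ((x + w) + v) - avg \<Omega> (x + w)\<bar> + ennreal \<bar>avg \<Omega> (x + w) - avg \<Omega> x\<bar> \<partial>lborel)"
    by (rule nn_integral_mono) (auto simp flip: ennreal_plus intro!: ennreal_leI simp: algebra_simps)
  also have "\<dots> = (\<integral>\<^sup>+x. ennreal \<bar>avg \<Omega> ((x + w) + v) - avg \<Omega> (x + w)\<bar> \<partial>lborel) + (\<integral>\<^sup>+x. ennreal \<bar>avg \<Omega> (x + w) - avg \<Omega> x\<bar> \<partial>lborel)"
    by (rule nn_integral_add) measurable
  also have "(\<integral>\<^sup>+x. ennreal \<bar>avg \<Omega> ((x + w) + v) - avg \<Omega> (x + w)\<bar> \<partial>lborel) = (\<integral>\<^sup>+x. ennreal \<bar>avg \<Omega> (x + v) - avg \<Omega> x\<bar> \<partial>lborel)"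
    by (rule lborel_nn_integral_translate[of "\<lambda>x. ennreal \<bar>avg \<Omega> (x + v) - avg \<Omega> x\<bar>" w]) measurable
  finally show ?thesis .
qed

lemma nn_integral_avg_increment_mult:
  "(\<integral>\<^sup>+x. ennreal \<bar>avg \<Omega> (x + real n *\<^sub>R v) - avg \<Omega> x\<bar> \<partial>lborel)
   \<le> of_nat n * (\<integral>\<^sup>+x. ennreal \<bar>avg \<Omega> (x + v) - avg \<Omega> x\<bar> \<partial>lborel)"
proof (induction n)
  case (Suc n)
  have "real (Suc n) *\<^sub>R v = v + real n *\<^sub>R v" by (simp add: scaleR_add_left)
  then show ?case
    using order_trans[OF nn_integral_avg_increment_subadd[of v "real n *\<^sub>R v"] add_left_mono[OF Suc]]
    by (simp add: distrib_right)
qed simp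

text \<open>The shift is divided into n equal steps. Increments add up and are invariant under
  translation, so the n quadratic errors of order 1/n^2 total C/n, which tends to 0. This takes the
  place of integrating the gradient along the segment.\<close>

lemma nn_integral_avg_increment:
  assumes p: "perimeter \<Omega> \<le> ennreal p" "0 \<le> p"
  shows "(\<integral>\<^sup>+x. ennreal \<bar>avg \<Omega> (x + h) - avg \<Omega> x\<bar> \<partial>lborel) \<le> ennreal (norm h * p)"
proof -
  let ?I = "\<lambda>v. \<integral>\<^sup>+x. ennreal \<bar>avg \<Omega> (x + v) - avg \<Omega> x\<bar> \<partial>lborel"
  define C where "C = L * (norm h)\<^sup>2 * (measure lborel \<Omega> * measure lborel (ball (0::'a) (d + 1)))"
  obtain n0 :: nat where n0: "norm h \<le> real n0" using real_arch_simple by blast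
  have le: "?I h \<le> ennreal (norm h * p + C / real n)" if "n \<ge> Suc n0" for n
  proof -
    have n: "real n > 0" "norm h \<le> real n" using that n0 by auto
    define v where "v = h /\<^sub>R real n"
    have nv: "norm v = norm h / real n" using n by (simp add: v_def divide_inverse mult.commute)
    have "?I h = ?I (real n *\<^sub>R v)" using n by (simp add: v_def)
    also have "\<dots> \<le> of_nat n * ?I v" by (rule nn_integral_avg_increment_mult)
    also have "\<dots> \<le> of_nat n * ennreal (norm v * p + L * (norm v)\<^sup>2 * (measure lborel \<Omega> * measure lborel (ball (0::'a) (d + 1))))"
      by (intro mult_left_mono nn_integral_avg_increment_small[OF p]) (use n nv in auto)
    also have "\<dots> = ennreal (real n * (norm v * p + L * (norm v)\<^sup>2 * (measure lborel \<Omega> * measure lborel (ball (0::'a) (d + 1)))))"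
      using p L_nonneg by (subst ennreal_mult) (auto simp: ennreal_of_nat_eq_real_of_nat)
    also have "real n * (norm v * p + L * (norm v)\<^sup>2 * (measure lborel \<Omega> * measure lborel (ball (0::'a) (d + 1)))) = norm h * p + C / real n"
      using n by (simp add: nv C_def power2_eq_square field_simps)
    finally show ?thesis .
  qed
  have "(\<lambda>n. norm h * p + C / real n) \<longlonglongrightarrow> norm h * p + 0"
    by (intro tendsto_intros lim_const_over_n)
  then have "(\<lambda>n. ennreal (norm h * p + C / real n)) \<longlonglongrightarrow> ennreal (norm h * p)"
    by (intro tendsto_ennrealI) simp
  then show ?thesis
    by (rule LIMSEQ_le_const) (use le in auto)
qed

text \<open>The mollified indicator is an average of translates by vectors shorter than
  \<open>d\<close>, so its L1 distance to the indicator is at most that of the worst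
  translate.\<close>

lemma nn_integral_avg_diff_le:
  assumes S: "\<And>z. norm z < d \<Longrightarrow> (\<integral>\<^sup>+x. ennreal \<bar>indicat_real \<Omega> (x + z) - indicat_real \<Omega> x\<bar> \<partial>lborel) \<le> e"
  shows "(\<integral>\<^sup>+x. ennreal \<bar>avg \<Omega> x - indicator \<Omega> x\<bar> \<partial>lborel) \<le> e"
proof -
  have pt: "ennreal \<bar>avg \<Omega> x - indicator \<Omega> x\<bar> \<le> (\<integral>\<^sup>+z. ennreal (k z * \<bar>indicat_real \<Omega> (x - z) - indicat_real \<Omega> x\<bar>) \<partial>lborel)" for x
  proof -
    have i: "integrable lborel (\<lambda>z. indicat_real \<Omega> (x - z) * k z)"
      using lborel_integrable_affine[of "-1", OF _ integrable_avg[of x], of x] by simp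
    have "avg \<Omega> x = (\<integral>z. indicat_real \<Omega> (x - z) * k z \<partial>lborel)"
      unfolding avg_def by (subst lborel_integral_reflect[symmetric, of _ x]) auto
    moreover have "indicator \<Omega> x = (\<integral>z. indicat_real \<Omega> x * k z \<partial>lborel)"
      using k_integral by simp
    ultimately have "avg \<Omega> x - indicator \<Omega> x = (\<integral>z. indicat_real \<Omega> (x - z) * k z - indicat_real \<Omega> x * k z \<partial>lborel)"
      using i integrable_k by simp
    also have "ennreal (norm \<dots>) \<le> (\<integral>\<^sup>+z. ennreal (norm (indicat_real \<Omega> (x - z) * k z - indicat_real \<Omega> x * k z)) \<partial>lborel)"
      by (rule integral_norm_bound_ennreal) (use i integrable_k in auto)
    also have "\<dots> = (\<integral>\<^sup>+z. ennreal (k z * \<bar>indicat_real \<Omega> (x - z) - indicat_real \<Omega> x\<bar>) \<partial>lborel)"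
      using k_nonneg by (intro nn_integral_cong) (auto simp: indicator_def)
    finally show ?thesis by simp
  qed
  have "(\<integral>\<^sup>+x. ennreal \<bar>avg \<Omega> x - indicator \<Omega> x\<bar> \<partial>lborel)
    \<le> (\<integral>\<^sup>+x. \<integral>\<^sup>+z. ennreal (k z * \<bar>indicat_real \<Omega> (x - z) - indicat_real \<Omega> x\<bar>) \<partial>lborel \<partial>lborel)"
    by (rule nn_integral_mono) (rule pt)
  also have "\<dots> = (\<integral>\<^sup>+z. \<integral>\<^sup>+x. ennreal (k z * \<bar>indicat_real \<Omega> (x - z) - indicat_real \<Omega> x\<bar>) \<partial>lborel \<partial>lborel)"
    by (rule lborel_pair.Fubini') measurable
  also have "\<dots> \<le> (\<integral>\<^sup>+z. ennreal (k z) * e \<partial>lborel)"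
  proof (rule nn_integral_mono)
    fix z
    show "(\<integral>\<^sup>+x. ennreal (k z * \<bar>indicat_real \<Omega> (x - z) - indicat_real \<Omega> x\<bar>) \<partial>lborel) \<le> ennreal (k z) * e"
    proof (cases "norm z < d")
      case True
      have "(\<integral>\<^sup>+x. ennreal (k z * \<bar>indicat_real \<Omega> (x - z) - indicat_real \<Omega> x\<bar>) \<partial>lborel)
        = ennreal (k z) * (\<integral>\<^sup>+x. ennreal \<bar>indicat_real \<Omega> (x - z) - indicat_real \<Omega> x\<bar> \<partial>lborel)"
        by (subst nn_integral_cmult[symmetric]) (auto simp: ennreal_mult k_nonneg)
      also have "\<dots> \<le> ennreal (k z) * e"
        using S[of "- z"] True by (intro mult_left_mono) auto
      finally show ?thesis .
    qed (simp add: k_supp)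
  qed
  also have "\<dots> = e" using nn_integral_k by (simp add: nn_integral_multc)
  finally show ?thesis .
qed

lemma nn_integral_indicator_increment_aux:
  assumes p: "perimeter \<Omega> \<le> ennreal p" "0 \<le> p"
    and S: "\<And>z. norm z < d \<Longrightarrow> (\<integral>\<^sup>+x. ennreal \<bar>indicat_real \<Omega> (x + z) - indicat_real \<Omega> x\<bar> \<partial>lborel) \<le> e"
  shows "(\<integral>\<^sup>+x. ennreal \<bar>indicat_real \<Omega> (x + h) - indicat_real \<Omega> x\<bar> \<partial>lborel) \<le> ennreal (norm h * p) + 2 * e"
proof -
  let ?a = "avg \<Omega>" and ?w = "indicat_real \<Omega>"
  have "(\<integral>\<^sup>+x. ennreal \<bar>?w (x + h) - ?w x\<bar> \<partial>lborel)
    \<le> (\<integral>\<^sup>+x. ennreal \<bar>?a (x + h) - ?w (x + h)\<bar> + (ennreal \<bar>?a (x + h) - ?a x\<bar> + ennreal \<bar>?a x - ?w x\<bar>) \<partial>lborel)"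
    by (rule nn_integral_mono) (auto simp flip: ennreal_plus intro!: ennreal_leI)
  also have "\<dots> = (\<integral>\<^sup>+x. ennreal \<bar>?a (x + h) - ?w (x + h)\<bar> \<partial>lborel)
      + ((\<integral>\<^sup>+x. ennreal \<bar>?a (x + h) - ?a x\<bar> \<partial>lborel) + (\<integral>\<^sup>+x. ennreal \<bar>?a x - ?w x\<bar> \<partial>lborel))"
    by (subst nn_integral_add, measurable)+
  also have "(\<integral>\<^sup>+x. ennreal \<bar>?a (x + h) - ?w (x + h)\<bar> \<partial>lborel) = (\<integral>\<^sup>+x. ennreal \<bar>?a x - ?w x\<bar> \<partial>lborel)"
    by (rule lborel_nn_integral_translate[of "\<lambda>x. ennreal \<bar>?a x - ?w x\<bar>" h]) measurable
  also have "\<dots> + ((\<integral>\<^sup>+x. ennreal \<bar>?a (x + h) - ?a x\<bar> \<partial>lborel) + \<dots>) \<le> e + (ennreal (norm h * p) + e)"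
    by (intro add_mono nn_integral_avg_diff_le nn_integral_avg_increment p S)
  finally show ?thesis by (simp add: mult_2 add_ac)
qed

end

end

text \<open>Outer regularity replaces the set by an open \<open>U\<close>, up to volume e/4. A point
  of an open set stays inside under small shifts, so the volume that leaves \<open>U\<close> tends
  to 0 by dominated convergence.\<close>

lemma indicator_translate_continuous:
  fixes \<Omega> :: "'a::euclidean_space set"
  assumes [measurable]: "\<Omega> \<in> sets borel" and fin: "emeasure lborel \<Omega> < \<infinity>" and e: "0 < e"
  obtains \<delta> where "\<delta> > 0"
    "\<And>z. norm z < \<delta> \<Longrightarrow> (\<integral>\<^sup>+x. ennreal \<bar>indicat_real \<Omega> (x + z) - indicat_real \<Omega> x\<bar> \<partial>lborel) \<le> ennreal e"
proof -
  obtain U where U: "open U" "\<Omega> \<subseteq> U" "emeasure lborel (U - \<Omega>) < ennreal (e / 4)"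
    using outer_regular_lborel[of \<Omega> "e / 4"] e by auto
  have [measurable]: "U \<in> sets borel" using U by auto
  have finU: "emeasure lborel U < \<infinity>"
  proof -
    have "emeasure lborel U \<le> emeasure lborel \<Omega> + emeasure lborel (U - \<Omega>)"
      by (rule order_trans[OF emeasure_mono emeasure_subadditive]) auto
    also have "\<dots> < \<infinity>"
      using fin order.strict_trans[OF U(3) ennreal_less_top] by (simp add: less_top)
    finally show ?thesis .
  qed
  define f where "f z = emeasure lborel {x\<in>U. x + z \<notin> U}" for z
  have "\<exists>\<delta>>0. \<forall>z. norm z < \<delta> \<longrightarrow> f z \<le> ennreal (e / 4)"
  proof (rule ccontr)
    assume "\<not> ?thesis"
    then have "\<forall>n. \<exists>z. norm z < 1 / real (Suc n) \<and> \<not> f z \<le> ennreal (e / 4)"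
      by (metis divide_pos_pos zero_less_one of_nat_0_less_iff zero_less_Suc)
    then obtain z where z: "\<And>n. norm (z n) < 1 / real (Suc n)" "\<And>n. \<not> f (z n) \<le> ennreal (e / 4)"
      by metis
    have z0: "z \<longlonglongrightarrow> 0"
      by (rule LIMSEQ_norm_0[of z]) (use z in auto)
    have "(\<lambda>n. \<integral>\<^sup>+x. indicator {x\<in>U. x + z n \<notin> U} x \<partial>lborel) \<longlonglongrightarrow> (\<integral>\<^sup>+x. 0 \<partial>(lborel::'a measure))"
    proof (rule nn_integral_dominated_convergence[where w="indicator U"])
      show "AE x in lborel. (\<lambda>n. indicator {x \<in> U. x + z n \<notin> U} x) \<longlonglongrightarrow> (0::ennreal)"
      proof (rule AE_I2)
        fix x
        show "(\<lambda>n. indicator {x \<in> U. x + z n \<notin> U} x) \<longlonglongrightarrow> (0::ennreal)"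
        proof (cases "x \<in> U")
          case True
          have "(\<lambda>n. x + z n) \<longlonglongrightarrow> x + 0" by (intro tendsto_intros z0)
          then have "\<forall>\<^sub>F n in sequentially. x + z n \<in> U"
            using U(1) True by (simp add: topological_tendstoD)
          then have "\<forall>\<^sub>F n in sequentially. indicator {x \<in> U. x + z n \<notin> U} x = (0::ennreal)"
            by eventually_elim auto
          then show ?thesis by (rule tendsto_eventually)
        qed simp
      qed
      show "(\<integral>\<^sup>+x. indicator U x \<partial>lborel) < \<infinity>" using finU by simp
    qed (auto simp: indicator_def)
    then have "(\<lambda>n. f (z n)) \<longlonglongrightarrow> 0" by (simp add: f_def)
    then have "\<forall>\<^sub>F n in sequentially. f (z n) < ennreal (e / 4)"
      using e by (intro order_tendstoD(2)) auto
    then show False using z(2) by (meson eventually_sequentially less_imp_le order_refl)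
  qed
  then obtain \<delta> where \<delta>: "\<delta> > 0" "\<And>z. norm z < \<delta> \<Longrightarrow> f z \<le> ennreal (e / 4)" by blast
  \<comment> \<open>A point that leaves \<Omega> either leaves \<open>U\<close> or lands in the
    small set U - \<Omega>.\<close>
  have half: "emeasure lborel {x\<in>\<Omega>. x + z \<notin> \<Omega>} \<le> ennreal (e / 2)" if "norm z < \<delta>" for z
  proof -
    have "emeasure lborel {x\<in>\<Omega>. x + z \<notin> \<Omega>} \<le> emeasure lborel ({x\<in>U. x + z \<notin> U} \<union> {x. x + z \<in> U - \<Omega>})"
      using U(2) by (intro emeasure_mono) auto
    also have "\<dots> \<le> f z + emeasure lborel {x. x + z \<in> U - \<Omega>}"
      unfolding f_def by (rule emeasure_subadditive) measurable
    also have "emeasure lborel {x. x + z \<in> U - \<Omega>} = emeasure lborel (U - \<Omega>)"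
      by (rule emeasure_lborel_translate) measurable
    also have "f z + \<dots> \<le> ennreal (e / 4) + ennreal (e / 4)"
      using \<delta>(2)[OF that] U(3) by (intro add_mono) auto
    also have "\<dots> = ennreal (e / 2)" using e by (simp flip: ennreal_plus)
    finally show ?thesis .
  qed
  show ?thesis
  proof (rule that[OF \<delta>(1)])
    \<comment> \<open>The indicators differ at points that leave under the shift by \<open>z\<close>
      and at points that enter; after a translation the latter are the points that leave under the
      shift by -z.\<close>
    fix z :: 'a assume z: "norm z < \<delta>"
    have "(\<integral>\<^sup>+x. ennreal \<bar>indicat_real \<Omega> (x + z) - indicat_real \<Omega> x\<bar> \<partial>lborel)
      = (\<integral>\<^sup>+x. indicator {x\<in>\<Omega>. x + z \<notin> \<Omega>} x + indicator {y\<in>\<Omega>. y + (- z) \<notin> \<Omega>} (x + z) \<partial>lborel)"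
      by (rule nn_integral_cong) (auto simp: indicator_def)
    also have "\<dots> = emeasure lborel {x\<in>\<Omega>. x + z \<notin> \<Omega>} + (\<integral>\<^sup>+x. indicator {y\<in>\<Omega>. y + (- z) \<notin> \<Omega>} (x + z) \<partial>lborel)"
      by (subst nn_integral_add) auto
    also have "(\<integral>\<^sup>+x. indicator {y\<in>\<Omega>. y + (- z) \<notin> \<Omega>} (x + z) \<partial>lborel) = (\<integral>\<^sup>+x. indicator {y\<in>\<Omega>. y + (- z) \<notin> \<Omega>} x \<partial>lborel)"
      by (rule lborel_nn_integral_translate) measurable
    also have "\<dots> = emeasure lborel {y\<in>\<Omega>. y + (- z) \<notin> \<Omega>}" by (rule nn_integral_indicator) measurable
    also have "emeasure lborel {x\<in>\<Omega>. x + z \<notin> \<Omega>} + \<dots> \<le> ennreal (e / 2) + ennreal (e / 2)"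
      using z by (intro add_mono half) auto
    also have "\<dots> = ennreal e" using e by (simp flip: ennreal_plus)
    finally show "(\<integral>\<^sup>+x. ennreal \<bar>indicat_real \<Omega> (x + z) - indicat_real \<Omega> x\<bar> \<partial>lborel) \<le> ennreal e" .
  qed
qed

text \<open>For mollified indicators the bound does not depend on the kernel. The qualitative
  continuity of translation then removes the mollification, and the quantitative bound survives with
  constant 1.\<close>

theorem nn_integral_indicator_increment:
  fixes \<Omega> :: "'a::euclidean_space set"
  assumes \<Omega>: "\<Omega> \<in> sets borel" and fin: "emeasure lborel \<Omega> < \<infinity>"
    and p: "perimeter \<Omega> \<le> ennreal p" "0 \<le> p"
  shows "(\<integral>\<^sup>+x. ennreal \<bar>indicat_real \<Omega> (x + h) - indicat_real \<Omega> x\<bar> \<partial>lborel) \<le> ennreal (norm h * p)"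
proof (rule ennreal_le_epsilon)
  fix e :: real assume "0 < e"
  then obtain \<delta> where \<delta>: "\<delta> > 0" "\<And>z. norm z < \<delta> \<Longrightarrow>
      (\<integral>\<^sup>+x. ennreal \<bar>indicat_real \<Omega> (x + z) - indicat_real \<Omega> x\<bar> \<partial>lborel) \<le> ennreal (e / 2)"
    using indicator_translate_continuous[OF \<Omega> fin, of "e / 2"] by auto
  obtain k :: "'a \<Rightarrow> real" and \<kappa> L where "mollifier k \<kappa> \<delta> L" using mollifier_exists[OF \<delta>(1)] .
  then interpret mollifier k \<kappa> \<delta> L .
  have "(\<integral>\<^sup>+x. ennreal \<bar>indicat_real \<Omega> (x + h) - indicat_real \<Omega> x\<bar> \<partial>lborel) \<le> ennreal (norm h * p) + 2 * ennreal (e / 2)"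
    by (rule nn_integral_indicator_increment_aux[OF \<Omega> fin p \<delta>(2)])
  also have "2 * ennreal (e / 2) = ennreal e"
    using \<open>0 < e\<close> by (metis ennreal_numeral ennreal_mult' field_sum_of_halves mult_2 zero_le_numeral)
  finally show "(\<integral>\<^sup>+x. ennreal \<bar>indicat_real \<Omega> (x + h) - indicat_real \<Omega> x\<bar> \<partial>lborel) \<le> ennreal (norm h * p) + ennreal e" .
qed

section \<open>The isoperimetric inequality\<close>

text \<open>The first two terms of the binomial expansion. With \<open>a\<close> the root of a
  volume and \<open>b\<close> proportional to a radius, the second term is the first order growth of
  the volume when a ball is added.\<close>

lemma power_add_ge:
  fixes a b :: real
  assumes "0 \<le> a" "0 \<le> b"
  shows "a ^ Suc n + real (Suc n) * a ^ n * b \<le> (a + b) ^ Suc n"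
proof (induction n)
  case (Suc n)
  have "a ^ Suc (Suc n) + real (Suc (Suc n)) * a ^ Suc n * b
      \<le> (a ^ Suc n + real (Suc n) * a ^ n * b) * (a + b)"
    using assms by (simp add: algebra_simps)
  also have "\<dots> \<le> (a + b) ^ Suc n * (a + b)"
    using assms by (intro mult_right_mono Suc) auto
  finally show ?case by (simp add: mult.commute)
qed simp

lemma layer_cake:
  fixes g :: "'a::euclidean_space \<Rightarrow> real"
  assumes [measurable]: "g \<in> borel_measurable borel"
  shows "(\<integral>\<^sup>+x. ennreal (g x) \<partial>lborel) = (\<integral>\<^sup>+t. indicator {0<..} t * emeasure lborel {x. t < g x} \<partial>lborel)"
proof -
  have "(\<integral>\<^sup>+x. ennreal (g x) \<partial>lborel) = (\<integral>\<^sup>+x. \<integral>\<^sup>+t. indicator {0<..} t * indicator {x. t < g x} x \<partial>lborel \<partial>lborel)"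
  proof (rule nn_integral_cong)
    fix x
    have "(\<integral>\<^sup>+t. indicator {0<..} t * indicator {x. t < g x} x \<partial>lborel) = (\<integral>\<^sup>+t. indicator {0<..<g x} t \<partial>lborel)"
      by (rule nn_integral_cong) (auto simp: indicator_def)
    also have "\<dots> = ennreal (g x)"
      by (cases "0 \<le> g x") (auto simp: ennreal_neg)
    finally show "ennreal (g x) = (\<integral>\<^sup>+t. indicator {0<..} t * indicator {x. t < g x} x \<partial>lborel)" by simp
  qed
  also have "\<dots> = (\<integral>\<^sup>+t. \<integral>\<^sup>+x. indicator {0<..} t * indicator {x. t < g x} x \<partial>lborel \<partial>lborel)"
    by (rule lborel_pair.Fubini') (simp add: indicator_def, measurable)
  also have "\<dots> = (\<integral>\<^sup>+t. indicator {0<..} t * emeasure lborel {x. t < g x} \<partial>lborel)"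
    by (intro nn_integral_cong) (subst nn_integral_cmult, auto)
  finally show ?thesis .
qed

lemma measure_ball_scale:
  fixes c :: "'a::euclidean_space"
  assumes "0 \<le> r"
  shows "measure lborel (ball c r) = r ^ DIM('a) * measure lborel (ball (0::'a) 1)"
  using content_ball_conv_unit_ball[OF assms, of c] by simp

context mollifier
begin

context
  fixes \<Omega> :: "'a set"
  assumes \<Omega> [measurable]: "\<Omega> \<in> sets borel" and fin: "emeasure lborel \<Omega> < \<infinity>"
begin

lemmas [measurable] = avg_borel[OF \<Omega> fin] avg_grad_borel[OF \<Omega> fin] nbhd_mass_borel[OF \<Omega> fin]

text \<open>A point within \<epsilon> of the superlevel set exceeds the level once the largest
  possible Taylor increment is added. The right side is again a superlevel set at the same level, so
  volumes can be integrated over the levels.\<close>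

lemma superlevel_sum_ball_subset:
  assumes "0 < \<epsilon>" "\<epsilon> \<le> 1"
  shows "set_sum {x. t < avg \<Omega> x} (ball 0 \<epsilon>)
    \<subseteq> {x. t < avg \<Omega> x + (\<epsilon> * norm (avg_grad \<Omega> x) + L * \<epsilon>\<^sup>2 * nbhd_mass \<Omega> x)}"
proof
  fix x assume "x \<in> set_sum {x. t < avg \<Omega> x} (ball 0 \<epsilon>)"
  then obtain y z where x: "x = y + z" "t < avg \<Omega> y" "norm z < \<epsilon>" by (auto elim!: set_sumE)
  have "y = x + (- z)" using x by simp
  then have "avg \<Omega> y - avg \<Omega> x - avg_grad \<Omega> x \<bullet> (- z) \<le> L * (norm z)\<^sup>2 * nbhd_mass \<Omega> x"
    using avg_taylor[OF \<Omega> fin, of "- z" x] x assms by auto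
  moreover have "L * (norm z)\<^sup>2 * nbhd_mass \<Omega> x \<le> L * \<epsilon>\<^sup>2 * nbhd_mass \<Omega> x"
    using x L_nonneg nbhd_mass_nonneg[OF \<Omega> fin]
    by (intro mult_right_mono mult_left_mono power_mono) auto
  moreover have "avg_grad \<Omega> x \<bullet> (- z) \<le> norm (avg_grad \<Omega> x) * norm z"
    using norm_cauchy_schwarz[of "avg_grad \<Omega> x" "- z"] by simp
  moreover have "norm (avg_grad \<Omega> x) * norm z \<le> norm (avg_grad \<Omega> x) * \<epsilon>"
    using x by (intro mult_left_mono) auto
  ultimately show "x \<in> {x. t < avg \<Omega> x + (\<epsilon> * norm (avg_grad \<Omega> x) + L * \<epsilon>\<^sup>2 * nbhd_mass \<Omega> x)}"
    using x(2) by (simp add: mult.commute)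
qed

text \<open>For levels t below 1 - \<eta>, the points of \<Omega> with average at most t have volume
  at most \<Delta>/\<eta> by Chebyshev, so the superlevel set has more than V'. By Brunn-Minkowski
  it grows by at least \<epsilon> c when an \<epsilon>-ball is added. Integrated over the levels,
  the growth is at most \<epsilon> times the L1 norm of the gradient, up to order
  \<epsilon>^2.\<close>

lemma isoperimetric_mollified:
  assumes V: "emeasure lborel \<Omega> = ennreal V" "0 < V"
    and p: "perimeter \<Omega> \<le> ennreal p" "0 \<le> p"
    and \<Delta>: "(\<integral>\<^sup>+x. ennreal \<bar>avg \<Omega> x - indicator \<Omega> x\<bar> \<partial>lborel) \<le> ennreal \<Delta>" "0 \<le> \<Delta>"
    and \<eta>: "0 < \<eta>" "\<eta> < 1" and V': "0 \<le> V'" "V' < V - \<Delta> / \<eta>"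
  shows "(1 - \<eta>) * (real DIM('a) * root DIM('a) (measure lborel (ball (0::'a) 1)) * root DIM('a) V' ^ (DIM('a) - 1)) \<le> p"
proof -
  let ?N = "DIM('a)"
  define \<beta> where "\<beta> = measure lborel (ball (0::'a) 1)"
  define C where "C = L * (V * measure lborel (ball (0::'a) (d + 1)))"
  define c where "c = real ?N * root ?N \<beta> * root ?N V' ^ (?N - 1)"
  have \<beta>: "\<beta> > 0" by (simp add: \<beta>_def content_ball_pos)
  have c0: "0 \<le> c" using \<beta> V' by (simp add: c_def)
  have C0: "0 \<le> C" using L_nonneg V by (simp add: C_def)
  let ?A = "\<lambda>t. {x. t < avg \<Omega> x}"
  have Aopen: "open (?A t)" for t
    using continuous_on_avg[OF \<Omega> fin] by (intro open_Collect_less continuous_intros) auto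
  have main: "(1 - \<eta>) * c \<le> p + \<epsilon> * C" if \<epsilon>: "0 < \<epsilon>" "\<epsilon> \<le> 1" for \<epsilon>
  proof -
    define v where "v x = avg \<Omega> x + (\<epsilon> * norm (avg_grad \<Omega> x) + L * \<epsilon>\<^sup>2 * nbhd_mass \<Omega> x)" for x
    have [measurable]: "v \<in> borel_measurable borel" unfolding v_def by measurable
    have lower: "indicator {0<..} t * emeasure lborel (?A t) + indicator {0<..<1 - \<eta>} t * ennreal (\<epsilon> * c)
        \<le> indicator {0<..} t * emeasure lborel {x. t < v x}" for t :: real
    proof (cases "0 < t \<and> t < 1 - \<eta>")
      case False
      have "?A t \<subseteq> {x. t < v x}"
        using \<epsilon> L_nonneg nbhd_mass_nonneg[OF \<Omega> fin] by (auto simp: v_def intro: less_le_trans)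
      then have "emeasure lborel (?A t) \<le> emeasure lborel {x. t < v x}"
        by (intro emeasure_mono) auto
      then show ?thesis using False by (auto simp: indicator_def)
    next
      case True
      \<comment> \<open>Chebyshev again: t times the volume of the superlevel set is at most the
        integral of the average, which is \<open>V\<close>.\<close>
      have "ennreal t * emeasure lborel (?A t) = (\<integral>\<^sup>+x. ennreal t * indicator (?A t) x \<partial>lborel)"
        by (subst nn_integral_cmult) auto
      also have "\<dots> \<le> (\<integral>\<^sup>+x. ennreal (avg \<Omega> x) \<partial>lborel)"
        using True by (intro nn_integral_mono) (auto simp: indicator_def intro: ennreal_leI)
      also have "\<dots> = ennreal V" by (simp add: nn_integral_avg[OF \<Omega> fin] V)
      finally have "emeasure lborel (?A t) \<noteq> \<infinity>" using True by (auto simp: ennreal_mult_top top_unique)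
      then obtain \<mu> where \<mu>: "emeasure lborel (?A t) = ennreal \<mu>" "0 \<le> \<mu>"
        by (metis ennreal_cases infinity_ennreal_def)
      have "ennreal \<eta> * emeasure lborel (\<Omega> - ?A t) = (\<integral>\<^sup>+x. ennreal \<eta> * indicator (\<Omega> - ?A t) x \<partial>lborel)"
        by (subst nn_integral_cmult) auto
      also have "\<dots> \<le> (\<integral>\<^sup>+x. ennreal \<bar>avg \<Omega> x - indicator \<Omega> x\<bar> \<partial>lborel)"
        using True by (intro nn_integral_mono) (auto simp: indicator_def intro!: ennreal_leI)
      also have "\<dots> \<le> ennreal \<Delta>" by fact
      finally have le\<Delta>: "ennreal \<eta> * emeasure lborel (\<Omega> - ?A t) \<le> ennreal \<Delta>" .
      have "emeasure lborel (\<Omega> - ?A t) \<le> emeasure lborel \<Omega>" by (intro emeasure_mono) auto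
      then obtain q where q: "emeasure lborel (\<Omega> - ?A t) = ennreal q" "0 \<le> q"
        using fin by (metis ennreal_cases infinity_ennreal_def not_less top.extremum_unique)
      have "\<eta> * q \<le> \<Delta>"
        using le\<Delta> q \<eta> \<Delta>(2) by (simp add: ennreal_le_iff flip: ennreal_mult)
      then have "emeasure lborel (\<Omega> - ?A t) \<le> ennreal (\<Delta> / \<eta>)"
        unfolding q(1) using \<eta> by (intro ennreal_leI) (simp add: field_simps)
      then have "emeasure lborel (?A t) + emeasure lborel (\<Omega> - ?A t) \<le> ennreal (\<mu> + \<Delta> / \<eta>)"
        using \<mu> \<eta> \<Delta>(2) by (simp add: add_mono)
      moreover have "emeasure lborel \<Omega> \<le> emeasure lborel (?A t) + emeasure lborel (\<Omega> - ?A t)"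
        by (rule order_trans[OF emeasure_mono emeasure_subadditive]) auto
      ultimately have "ennreal V \<le> ennreal (\<mu> + \<Delta> / \<eta>)" unfolding V by (rule order_trans[rotated])
      then have "V \<le> \<mu> + \<Delta> / \<eta>" using \<mu> \<eta> \<Delta>(2) by (simp add: ennreal_le_iff del: ennreal_plus)
      then have V'\<mu>: "V' < \<mu>" using V' by simp
      then have \<mu>pos: "0 < \<mu>" using V' by simp
      have Npos: "0 < ?N" by simp
      have Bv: "emeasure lborel (ball (0::'a) \<epsilon>) = ennreal (\<epsilon> ^ ?N * \<beta>)"
        unfolding emeasure_bounded_eq[OF bounded_ball] \<beta>_def using \<epsilon> by (subst measure_ball_scale) auto
      have "\<mu> + \<epsilon> * c \<le> root ?N \<mu> ^ ?N + real ?N * root ?N \<mu> ^ (?N - 1) * (\<epsilon> * root ?N \<beta>)"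
      proof -
        have "root ?N V' ^ (?N - 1) \<le> root ?N \<mu> ^ (?N - 1)"
          using V'\<mu> V' by (intro power_mono) (auto intro: less_imp_le)
        then have "(real ?N * (\<epsilon> * root ?N \<beta>)) * root ?N V' ^ (?N - 1) \<le> (real ?N * (\<epsilon> * root ?N \<beta>)) * root ?N \<mu> ^ (?N - 1)"
          using \<epsilon> \<beta> by (intro mult_left_mono) auto
        then show ?thesis using \<mu>pos Npos by (simp add: c_def mult_ac)
      qed
      also have "\<dots> \<le> (root ?N \<mu> + \<epsilon> * root ?N \<beta>) ^ ?N"
        using power_add_ge[of "root ?N \<mu>" "\<epsilon> * root ?N \<beta>" "?N - 1"] \<mu>pos \<epsilon> \<beta> Npos by simp
      also have "\<epsilon> * root ?N \<beta> = root ?N (\<epsilon> ^ ?N * \<beta>)"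
        using \<epsilon> Npos by (simp add: real_root_mult real_root_power_cancel)
      finally have "ennreal (\<mu> + \<epsilon> * c) \<le> ennreal ((root ?N \<mu> + root ?N (\<epsilon> ^ ?N * \<beta>)) ^ ?N)"
        by (rule ennreal_leI)
      also have "\<dots> \<le> emeasure lborel (set_sum (?A t) (ball 0 \<epsilon>))"
        by (rule brunn_minkowski_open[OF Aopen \<mu>(1) \<mu>pos open_ball Bv]) (use \<epsilon> \<beta> in auto)
      also have "\<dots> \<le> emeasure lborel {x. t < v x}"
        unfolding v_def by (intro emeasure_mono superlevel_sum_ball_subset \<epsilon>) simp
      finally show ?thesis using True \<mu> \<epsilon> c0 by (simp add: indicator_def)
    qed
    have "ennreal V + ennreal ((1 - \<eta>) * (\<epsilon> * c))
      = (\<integral>\<^sup>+t. indicator {0<..} t * emeasure lborel (?A t) \<partial>lborel) + (\<integral>\<^sup>+t. indicator {0<..<1 - \<eta>} t * ennreal (\<epsilon> * c) \<partial>lborel)"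
      using \<eta> \<epsilon> c0 layer_cake[of "avg \<Omega>"] nn_integral_avg[OF \<Omega> fin] V
      by (subst nn_integral_multc) (auto simp: ennreal_mult)
    also have "\<dots> = (\<integral>\<^sup>+t. indicator {0<..} t * emeasure lborel (?A t) + indicator {0<..<1 - \<eta>} t * ennreal (\<epsilon> * c) \<partial>lborel)"
    proof (rule nn_integral_add[symmetric])
      have "(\<lambda>t. \<integral>\<^sup>+x. indicator {x. t < avg \<Omega> x} x \<partial>lborel) \<in> borel_measurable lborel"
        unfolding indicator_def by measurable
      then have [measurable]: "(\<lambda>t. emeasure lborel (?A t)) \<in> borel_measurable borel"
        by (subst (asm) nn_integral_indicator) auto
      show "(\<lambda>t. indicator {0<..} t * emeasure lborel (?A t)) \<in> borel_measurable lborel" by measurable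
    qed measurable
    also have "\<dots> \<le> (\<integral>\<^sup>+t. indicator {0<..} t * emeasure lborel {x. t < v x} \<partial>lborel)"
      by (intro nn_integral_mono lower)
    also have "\<dots> = (\<integral>\<^sup>+x. ennreal (v x) \<partial>lborel)" by (rule layer_cake[symmetric]) measurable
    also have "\<dots> = (\<integral>\<^sup>+x. ennreal (avg \<Omega> x) + (ennreal \<epsilon> * ennreal (norm (avg_grad \<Omega> x)) + ennreal (L * \<epsilon>\<^sup>2) * ennreal (nbhd_mass \<Omega> x)) \<partial>lborel)"
      using \<epsilon> L_nonneg nbhd_mass_nonneg[OF \<Omega> fin] avg_nonneg[OF \<Omega> fin]
      by (intro nn_integral_cong) (simp add: v_def flip: ennreal_mult ennreal_plus)
    also have "\<dots> = ennreal V + (ennreal \<epsilon> * (\<integral>\<^sup>+x. ennreal (norm (avg_grad \<Omega> x)) \<partial>lborel) + ennreal (L * \<epsilon>\<^sup>2) * (\<integral>\<^sup>+x. ennreal (nbhd_mass \<Omega> x) \<partial>lborel))"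
      by (simp add: nn_integral_add nn_integral_cmult nn_integral_avg[OF \<Omega> fin] V)
    also have "\<dots> \<le> ennreal V + (ennreal \<epsilon> * ennreal p + ennreal (L * \<epsilon>\<^sup>2) * (\<integral>\<^sup>+x. ennreal (nbhd_mass \<Omega> x) \<partial>lborel))"
      by (intro add_mono mult_left_mono order_trans[OF nn_integral_avg_grad_le_perimeter[OF \<Omega> fin] p(1)]) auto
    also have "\<dots> = ennreal (V + (\<epsilon> * p + \<epsilon> * (\<epsilon> * C)))"
      using V p \<epsilon> L_nonneg
      by (simp add: nn_integral_nbhd_mass[OF \<Omega> fin] emeasure_bounded_eq C_def power2_eq_square mult_ac flip: ennreal_mult ennreal_plus)
    finally have "ennreal (V + (1 - \<eta>) * (\<epsilon> * c)) \<le> ennreal (V + (\<epsilon> * p + \<epsilon> * (\<epsilon> * C)))"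
      using V \<eta> \<epsilon> c0 by simp
    then have "(1 - \<eta>) * (\<epsilon> * c) \<le> \<epsilon> * p + \<epsilon> * (\<epsilon> * C)"
      using V p \<epsilon> C0 by (subst (asm) ennreal_le_iff) auto
    \<comment> \<open>The volume \<open>V\<close> has cancelled; dividing by \<epsilon> leaves the
      first order growth, with an error \<epsilon> C that tends to 0 below.\<close>
    then have "\<epsilon> * ((1 - \<eta>) * c) \<le> \<epsilon> * (p + \<epsilon> * C)" by (simp add: algebra_simps)
    then show ?thesis using \<epsilon> by simp
  qed
  have "(\<lambda>n. p + inverse (real (Suc n)) * C) \<longlonglongrightarrow> p + 0 * C"
    by (intro tendsto_intros LIMSEQ_inverse_real_of_nat)
  then have "(1 - \<eta>) * c \<le> p + 0 * C"
    by (rule LIMSEQ_le_const) (use main in \<open>auto simp: inverse_le_1_iff\<close>)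
  then show ?thesis by (simp add: c_def \<beta>_def)
qed

end

end

lemma isoperimetric_root:
  fixes \<Omega> :: "'a::euclidean_space set"
  assumes \<Omega>: "\<Omega> \<in> sets borel"
    and V: "emeasure lborel \<Omega> = ennreal V" "0 < V"
    and p: "perimeter \<Omega> \<le> ennreal p" "0 \<le> p"
  shows "real DIM('a) * root DIM('a) (measure lborel (ball (0::'a) 1)) * root DIM('a) V ^ (DIM('a) - 1) \<le> p"
proof -
  let ?N = "DIM('a)"
  let ?c = "\<lambda>x. real ?N * root ?N (measure lborel (ball (0::'a) 1)) * root ?N x ^ (?N - 1)"
  have fin: "emeasure lborel \<Omega> < \<infinity>" using V by simp
  have lim0: "(\<lambda>n. inverse (real (Suc n))) \<longlonglongrightarrow> 0" by (rule LIMSEQ_inverse_real_of_nat)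
  have ev: "\<forall>\<^sub>F n in sequentially. (1 - inverse (real (Suc n))) * ?c (V - (p + 1) * inverse (real (Suc n))) \<le> p"
  proof -
    have "(\<lambda>n. V - (p + 1) * inverse (real (Suc n))) \<longlonglongrightarrow> V - (p + 1) * 0" by (intro tendsto_intros lim0)
    then have "\<forall>\<^sub>F n in sequentially. 0 < V - (p + 1) * inverse (real (Suc n))"
      using V by (intro order_tendstoD) auto
    moreover have "\<forall>\<^sub>F n in sequentially. inverse (real (Suc n)) < 1"
      using lim0 by (intro order_tendstoD) auto
    ultimately show ?thesis
    proof eventually_elim
      case (elim n)
      define \<eta> where "\<eta> = inverse (real (Suc n))"
      have \<eta>: "0 < \<eta>" "\<eta> < 1" using elim by (auto simp: \<eta>_def)
      \<comment> \<open>Mollifying at scale \<eta>^2 gives the L1 error \<Delta> = \<eta>^2 p, so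
        \<Delta>/\<eta> = \<eta> p tends to 0 with \<eta>. The choice V' = V - (p + 1) \<eta> lies
        strictly below V - \<eta> p even when p = 0.\<close>
      obtain k :: "'a \<Rightarrow> real" and \<kappa> L where "mollifier k \<kappa> (\<eta> * \<eta>) L" using mollifier_exists[of "\<eta> * \<eta>"] \<eta> by auto
      then interpret mollifier k \<kappa> "\<eta> * \<eta>" L .
      have "(\<integral>\<^sup>+x. ennreal \<bar>avg \<Omega> x - indicator \<Omega> x\<bar> \<partial>lborel) \<le> ennreal (\<eta> * \<eta> * p)"
        by (rule nn_integral_avg_diff_le[OF \<Omega> fin], rule order_trans[OF nn_integral_indicator_increment[OF \<Omega> fin p]])
           (use p in \<open>auto intro!: ennreal_leI mult_right_mono\<close>)
      moreover have "0 < V - (p + 1) * \<eta>" using elim(1) by (simp only: \<eta>_def)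
      moreover have "V - (p + 1) * \<eta> < V - \<eta> * \<eta> * p / \<eta>" using \<eta> by (simp add: field_simps)
      ultimately show ?case
        unfolding \<eta>_def[symmetric]
        using isoperimetric_mollified[OF \<Omega> fin V p, of "\<eta> * \<eta> * p" \<eta> "V - (p + 1) * \<eta>"] \<eta> p by auto
    qed
  qed
  have "(\<lambda>n. (1 - inverse (real (Suc n))) * ?c (V - (p + 1) * inverse (real (Suc n)))) \<longlonglongrightarrow> (1 - 0) * ?c (V - (p + 1) * 0)"
    by (intro tendsto_intros lim0)
  then have "(1 - 0) * ?c (V - (p + 1) * 0) \<le> p"
    by (rule tendsto_upperbound) (use ev in auto)
  then show ?thesis by simp
qed

section \<open>The perimeter of the unit ball\<close>

text \<open>Integration by parts through difference quotients: a translation of the variable moves a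
  forward quotient of \<open>F\<close> to a backward quotient of \<phi>. Both sides converge by
  dominated convergence, because \<open>F\<close> has bounded derivatives and \<phi> is Lipschitz;
  convergence almost everywhere is enough for \<phi>.\<close>

lemma integral_divergence_lipschitz:
  fixes F :: "'a::euclidean_space \<Rightarrow> 'a" and \<phi> :: "'a \<Rightarrow> real"
  assumes F: "C1_compact_support F"
    and [measurable]: "\<phi> \<in> borel_measurable borel"
    and \<phi>b: "\<And>x. \<bar>\<phi> x\<bar> \<le> 1" and lip: "\<And>x y. \<bar>\<phi> x - \<phi> y\<bar> \<le> C * norm (x - y)"
    and der: "AE x in lborel. (\<phi> has_derivative (\<lambda>v. g x \<bullet> v)) (at x)"
    and [measurable]: "g \<in> borel_measurable borel"
  shows "(\<integral>x. \<phi> x * divergence F x \<partial>lborel) = - (\<integral>x. g x \<bullet> F x \<partial>lborel)"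
proof -
  obtain F' R where F': "\<And>x. (F has_derivative F' x) (at x)"
    "\<And>v. continuous_on UNIV (\<lambda>x. F' x v)" "R > 0"
    "\<And>x. norm x > R \<Longrightarrow> F x = 0" "\<And>x v. norm x > R \<Longrightarrow> F' x v = 0"
    using C1_compact_supportE[OF F] by metis
  have contF: "continuous_on UNIV F"
    by (intro continuous_at_imp_continuous_on ballI has_derivative_continuous[OF F'(1)])
  then have [measurable]: "F \<in> borel_measurable borel" by (rule borel_measurable_continuous_onI)
  have C0: "0 \<le> C"
  proof -
    obtain b :: 'a where b: "b \<in> Basis" using nonempty_Basis by blast
    show ?thesis using order_trans[OF abs_ge_zero lip[of b 0]] norm_Basis[OF b] by simp
  qed
  have "compact ((\<lambda>x. norm (F x)) ` cball 0 R)"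
    by (intro compact_continuous_image continuous_intros continuous_on_subset[OF contF]) auto
  then obtain M0 where "\<And>x. norm x \<le> R \<Longrightarrow> norm (F x) \<le> M0"
    by (force simp: bounded_iff dest!: compact_imp_bounded)
  then have M0: "norm (F x) \<le> max M0 0" for x
    using F'(4)[of x] by (cases "norm x > R") (auto simp: le_max_iff_disj)
  have "\<exists>M. \<forall>x. \<bar>F' x b \<bullet> b\<bar> \<le> M" for b
  proof -
    have "compact ((\<lambda>x. F' x b \<bullet> b) ` cball 0 R)"
      by (intro compact_continuous_image continuous_intros continuous_on_subset[OF F'(2)]) auto
    then obtain M where "\<And>x. norm x \<le> R \<Longrightarrow> \<bar>F' x b \<bullet> b\<bar> \<le> M"
      by (force simp: bounded_iff dest!: compact_imp_bounded)
    then have "\<bar>F' x b \<bullet> b\<bar> \<le> max M 0" for x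
      using F'(5)[of x b] by (cases "norm x > R") (auto simp: le_max_iff_disj)
    then show ?thesis by blast
  qed
  then obtain M where M: "\<And>b x. \<bar>F' x b \<bullet> b\<bar> \<le> M b" by metis
  define h where "h n = inverse (real (Suc n))" for n
  have h: "0 < h n" "h n \<le> 1" for n by (auto simp: h_def inverse_le_1_iff)
  have h0: "h \<longlonglongrightarrow> 0" unfolding h_def by (rule LIMSEQ_inverse_real_of_nat)
  \<comment> \<open>The sign \<open>s\<close> is 1 for the forward quotients of \<open>F\<close> and
    -1 for the backward quotients of \<phi>.\<close>
  have quot: "(\<lambda>n. (f (x + (s * h n) *\<^sub>R b) - f x) / h n) \<longlonglongrightarrow> s * f' b"
    if "(f has_derivative f') (at x)" for f :: "'a \<Rightarrow> real" and f' x b s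
  proof -
    have lin: "linear f'" using that by (meson bounded_linear.linear has_derivative_bounded_linear)
    have "((\<lambda>t. f (x + (s * t) *\<^sub>R b)) has_derivative (\<lambda>u. f' ((s * u) *\<^sub>R b))) (at 0)"
      by (rule has_derivative_compose[where f="\<lambda>t. x + (s * t) *\<^sub>R b" and g=f]) (auto intro!: derivative_eq_intros that)
    then have "((\<lambda>t. f (x + (s * t) *\<^sub>R b)) has_real_derivative s * f' b) (at 0)"
      by (rule has_derivative_imp_has_field_derivative) (simp add: linear_scale[OF lin])
    then have "((\<lambda>t. (f (x + (s * (0 + t)) *\<^sub>R b) - f (x + (s * 0) *\<^sub>R b)) / t) \<longlongrightarrow> s * f' b) (at 0)"
      unfolding DERIV_def by simp
    then have "(\<lambda>n. (f (x + (s * (0 + h n)) *\<^sub>R b) - f (x + (s * 0) *\<^sub>R b)) / h n) \<longlonglongrightarrow> s * f' b"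
      by (rule filterlim_compose) (use h h0 in \<open>auto simp: filterlim_at less_imp_neq[symmetric]\<close>)
    then show ?thesis by simp
  qed
  define T where "T n x = (\<Sum>b\<in>Basis. \<phi> x * ((F (x + h n *\<^sub>R b) \<bullet> b - F x \<bullet> b) / h n))" for n x
  define S where "S n x = (\<Sum>b\<in>Basis. F x \<bullet> b * ((\<phi> (x - h n *\<^sub>R b) - \<phi> x) / h n))" for n x
  have limT: "(\<lambda>n. \<integral>x. T n x \<partial>lborel) \<longlonglongrightarrow> (\<integral>x. \<phi> x * divergence F x \<partial>lborel)"
  proof (rule integral_dominated_convergence)
    \<comment> \<open>The field is shifted by at most 1, so its quotients vanish outside radius R +
      1.\<close>
    show "integrable lborel (\<lambda>x. (\<Sum>b\<in>Basis. M b) * indicat_real (cball (0::'a) (R + 1)) x)"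
      using emeasure_lborel_cball_finite[of "0::'a" "R + 1"] by (intro integrable_mult_right integrable_real_indicator) auto
    show "AE x in lborel. (\<lambda>n. T n x) \<longlonglongrightarrow> \<phi> x * divergence F x"
    proof (rule AE_I2)
      fix x
      have "((\<lambda>x. F x \<bullet> b) has_derivative (\<lambda>v. F' x v \<bullet> b)) (at x)" for b
        by (rule has_derivative_inner_left[OF F'(1)])
      from quot[OF this, of 1] have "(\<lambda>n. (F (x + h n *\<^sub>R b) \<bullet> b - F x \<bullet> b) / h n) \<longlonglongrightarrow> F' x b \<bullet> b" for b by simp
      then have "(\<lambda>n. T n x) \<longlonglongrightarrow> (\<Sum>b\<in>Basis. \<phi> x * (F' x b \<bullet> b))"
        unfolding T_def by (intro tendsto_intros)
      then show "(\<lambda>n. T n x) \<longlonglongrightarrow> \<phi> x * divergence F x"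
        by (simp add: divergence_eq[OF F'(1)] sum_distrib_left)
    qed
    show "AE x in lborel. norm (T n x) \<le> (\<Sum>b\<in>Basis. M b) * indicator (cball 0 (R + 1)) x" for n
    proof (rule AE_I2)
      fix x
      have b1: "\<bar>(F (x + h n *\<^sub>R b) \<bullet> b - F x \<bullet> b) / h n\<bar> \<le> M b * indicator (cball 0 (R + 1)) x" if b: "b \<in> Basis" for b
      proof (cases "norm x \<le> R + 1")
        case True
        have "((\<lambda>t. F (x + t *\<^sub>R b) \<bullet> b) has_derivative (\<lambda>u. F' (x + t *\<^sub>R b) (u *\<^sub>R b) \<bullet> b)) (at t within {0..h n})" for t
        proof (rule has_derivative_inner_left)
          show "((\<lambda>t. F (x + t *\<^sub>R b)) has_derivative (\<lambda>u. F' (x + t *\<^sub>R b) (u *\<^sub>R b))) (at t within {0..h n})"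
            by (rule has_derivative_compose[where g=F, OF _ F'(1)]) (auto intro!: derivative_eq_intros)
        qed
        then obtain t where "F (x + h n *\<^sub>R b) \<bullet> b - F (x + 0 *\<^sub>R b) \<bullet> b = F' (x + t *\<^sub>R b) ((h n - 0) *\<^sub>R b) \<bullet> b"
          using mvt_simple[of 0 "h n" "\<lambda>t. F (x + t *\<^sub>R b) \<bullet> b" "\<lambda>t u. F' (x + t *\<^sub>R b) (u *\<^sub>R b) \<bullet> b"] h by auto
        also have "\<dots> = h n * (F' (x + t *\<^sub>R b) b \<bullet> b)"
          using linear_scale[OF bounded_linear.linear[OF has_derivative_bounded_linear[OF F'(1)]]] by simp
        finally have "(F (x + h n *\<^sub>R b) \<bullet> b - F x \<bullet> b) / h n = F' (x + t *\<^sub>R b) b \<bullet> b"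
          using h[of n] by simp
        then show ?thesis using M True by simp
      next
        case False
        have "norm (x + h n *\<^sub>R b) \<ge> norm x - norm (h n *\<^sub>R b)" by (rule norm_diff_ineq)
        then have "norm (x + h n *\<^sub>R b) > R" "norm x > R" using False h[of n] b by auto
        then show ?thesis using F'(4) False by simp
      qed
      have "norm (T n x) \<le> (\<Sum>b\<in>Basis. \<bar>\<phi> x * ((F (x + h n *\<^sub>R b) \<bullet> b - F x \<bullet> b) / h n)\<bar>)"
        unfolding T_def real_norm_def by (rule sum_abs)
      also have "\<dots> \<le> (\<Sum>b\<in>Basis. 1 * (M b * indicator (cball 0 (R + 1)) x))"
        unfolding abs_mult[of "\<phi> x"] by (intro sum_mono mult_mono \<phi>b b1) auto
      finally show "norm (T n x) \<le> (\<Sum>b\<in>Basis. M b) * indicator (cball 0 (R + 1)) x"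
        by (simp add: sum_distrib_right)
    qed
    show "(\<lambda>x. \<phi> x * divergence F x) \<in> borel_measurable lborel"
      using borel_measurable_divergence[OF F] by measurable
    show "T n \<in> borel_measurable lborel" for n unfolding T_def by measurable
  qed
  have limS: "(\<lambda>n. \<integral>x. S n x \<partial>lborel) \<longlonglongrightarrow> (\<integral>x. - (g x \<bullet> F x) \<partial>lborel)"
  proof (rule integral_dominated_convergence)
    show "integrable lborel (\<lambda>x. (real DIM('a) * (max M0 0 * C)) * indicat_real (cball (0::'a) R) x)"
      using emeasure_lborel_cball_finite[of "0::'a" R] by (intro integrable_mult_right integrable_real_indicator) auto
    show "AE x in lborel. (\<lambda>n. S n x) \<longlonglongrightarrow> - (g x \<bullet> F x)"
      using der
    proof eventually_elim
      case (elim x)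
      from quot[OF this, of "-1"] have "(\<lambda>n. (\<phi> (x - h n *\<^sub>R b) - \<phi> x) / h n) \<longlonglongrightarrow> - (g x \<bullet> b)" for b by simp
      then have "(\<lambda>n. S n x) \<longlonglongrightarrow> (\<Sum>b\<in>Basis. F x \<bullet> b * - (g x \<bullet> b))"
        unfolding S_def by (intro tendsto_intros)
      also have "(\<Sum>b\<in>Basis. F x \<bullet> b * - (g x \<bullet> b)) = - (g x \<bullet> F x)"
        by (subst (2) euclidean_inner) (simp add: sum_negf mult.commute)
      finally show ?case .
    qed
    show "AE x in lborel. norm (S n x) \<le> (real DIM('a) * (max M0 0 * C)) * indicator (cball 0 R) x" for n
    proof (rule AE_I2)
      fix x
      have b1: "\<bar>F x \<bullet> b * ((\<phi> (x - h n *\<^sub>R b) - \<phi> x) / h n)\<bar> \<le> max M0 0 * C * indicator (cball 0 R) x" if b: "b \<in> Basis" for b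
      proof (cases "norm x \<le> R")
        case True
        have "\<bar>\<phi> (x - h n *\<^sub>R b) - \<phi> x\<bar> \<le> C * h n" using lip[of "x - h n *\<^sub>R b" x] b h[of n] by simp
        then have "\<bar>(\<phi> (x - h n *\<^sub>R b) - \<phi> x) / h n\<bar> \<le> C" using h[of n] by (simp add: divide_le_eq)
        moreover have "\<bar>F x \<bullet> b\<bar> \<le> max M0 0" using Basis_le_norm[OF b, of "F x"] M0[of x] by linarith
        ultimately have "\<bar>F x \<bullet> b\<bar> * \<bar>(\<phi> (x - h n *\<^sub>R b) - \<phi> x) / h n\<bar> \<le> max M0 0 * C"
          by (intro mult_mono) auto
        then show ?thesis using True by (simp add: abs_mult)
      qed (simp add: F'(4))
      have "norm (S n x) \<le> (\<Sum>b\<in>Basis. \<bar>F x \<bullet> b * ((\<phi> (x - h n *\<^sub>R b) - \<phi> x) / h n)\<bar>)"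
        unfolding S_def real_norm_def by (rule sum_abs)
      also have "\<dots> \<le> (\<Sum>b\<in>(Basis::'a set). max M0 0 * C * indicator (cball 0 R) x)"
        by (intro sum_mono b1)
      finally show "norm (S n x) \<le> (real DIM('a) * (max M0 0 * C)) * indicator (cball 0 R) x" by simp
    qed
    show "S n \<in> borel_measurable lborel" for n unfolding S_def by measurable
  qed measurable
  have "(\<integral>x. T n x \<partial>lborel) = (\<integral>x. S n x \<partial>lborel)" for n
  proof -
    have i1: "integrable lborel (\<lambda>x. \<psi> x * (F x \<bullet> b))"
      if [measurable]: "\<psi> \<in> borel_measurable borel" and "\<And>x. \<bar>\<psi> x\<bar> \<le> 1" "b \<in> Basis" for \<psi> :: "'a \<Rightarrow> real" and b
    proof (rule integrable_bounded_support[where R=R and M="max M0 0"])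
      fix x
      have "\<bar>\<psi> x\<bar> * \<bar>F x \<bullet> b\<bar> \<le> 1 * max M0 0"
        using that(2)[of x] Basis_le_norm[OF that(3), of "F x"] M0[of x] by (intro mult_mono) linarith+
      then show "norm (\<psi> x * (F x \<bullet> b)) \<le> max M0 0" by (simp add: abs_mult)
    qed (auto simp: F'(4))
    have i2: "integrable lborel (\<lambda>x. \<phi> x * (F (x + h n *\<^sub>R b) \<bullet> b))" if "b \<in> Basis" for b
      using lborel_integrable_affine[of 1, OF _ i1[of "\<lambda>x. \<phi> (x - h n *\<^sub>R b)" b], of "h n *\<^sub>R b"] \<phi>b that
      by (simp add: add.commute)
    have i3: "integrable lborel (\<lambda>x. \<phi> (x - h n *\<^sub>R b) * (F x \<bullet> b))" if "b \<in> Basis" for b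
      by (rule i1) (use \<phi>b that in auto)
    have i4: "integrable lborel (\<lambda>x. F x \<bullet> b * \<phi> (x - h n *\<^sub>R b))" if "b \<in> Basis" for b
      using i3[OF that] by (simp add: mult.commute)
    have i5: "integrable lborel (\<lambda>x. F x \<bullet> b * \<phi> x)" if "b \<in> Basis" for b
      using i1[of \<phi> b] \<phi>b that by (simp add: mult.commute)
    \<comment> \<open>The discrete form of the integration by parts.\<close>
    have shift: "(\<integral>x. \<phi> x * (F (x + h n *\<^sub>R b) \<bullet> b) \<partial>lborel) = (\<integral>x. \<phi> (x - h n *\<^sub>R b) * (F x \<bullet> b) \<partial>lborel)" for b
      using lborel_integral_translate[of "\<lambda>x. \<phi> (x - h n *\<^sub>R b) * (F x \<bullet> b)" "h n *\<^sub>R b"] by simp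
    have "(\<integral>x. T n x \<partial>lborel) = (\<Sum>b\<in>Basis. \<integral>x. (\<phi> x * (F (x + h n *\<^sub>R b) \<bullet> b) - \<phi> x * (F x \<bullet> b)) / h n \<partial>lborel)"
      unfolding T_def
      by (subst Bochner_Integration.integral_sum[symmetric])
         (auto intro!: integrable_divide Bochner_Integration.integrable_diff i1 i2 \<phi>b Bochner_Integration.integral_cong sum.cong simp: algebra_simps diff_divide_distrib)
    also have "\<dots> = (\<Sum>b\<in>Basis. \<integral>x. (\<phi> (x - h n *\<^sub>R b) * (F x \<bullet> b) - \<phi> x * (F x \<bullet> b)) / h n \<partial>lborel)"
      by (intro sum.cong refl) (simp add: i1 i2 i3 \<phi>b shift)
    also have "\<dots> = (\<integral>x. S n x \<partial>lborel)"
      unfolding S_def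
      by (subst Bochner_Integration.integral_sum[symmetric])
         (auto intro!: integrable_divide Bochner_Integration.integrable_diff i4 i5 i1 \<phi>b Bochner_Integration.integral_cong sum.cong simp: algebra_simps diff_divide_distrib)
    finally show ?thesis .
  qed
  then have "(\<integral>x. \<phi> x * divergence F x \<partial>lborel) = (\<integral>x. - (g x \<bullet> F x) \<partial>lborel)"
    using LIMSEQ_unique[OF limT] limS by simp
  then show ?thesis by simp
qed

lemma negligible_sphere_lborel: "sphere (0::'a::euclidean_space) r \<in> null_sets lborel"
proof -
  have "sphere (0::'a) r \<in> null_sets lebesgue"
    using negligible_sphere[of "0::'a" r] by (simp add: negligible_iff_null_sets)
  then show ?thesis by (simp add: null_sets_completion_iff)
qed

text \<open>This side of the estimate shows that the ball is optimal in the isoperimetric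
  inequality: \<open>isoperimetric_ball\<close> uses it to replace N times the unit volume by the
  perimeter that occurs in \<open>m_star\<close>.\<close>

lemma perimeter_unit_ball_le:
  "perimeter (ball (0::'a::euclidean_space) 1) \<le> ennreal (real DIM('a) * measure lborel (ball (0::'a) 1))"
proof (rule perimeter_leI)
  let ?N = "DIM('a)"
  define \<beta> where "\<beta> = measure lborel (ball (0::'a) 1)"
  fix F :: "'a \<Rightarrow> 'a" assume F: "C1_compact_support F" and F1: "\<And>x. norm (F x) \<le> 1"
  note [measurable] = borel_measurable_divergence[OF F]
  \<comment> \<open>A radial cutoff, 1 on the unit ball and 0 beyond radius 1 + \<epsilon>, with
    slope 1/\<epsilon> in between. A field of norm at most 1 tests its gradient to at most the
    volume of the shell divided by \<epsilon>.\<close>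
  define \<phi> where "\<phi> \<epsilon> x = min 1 (max 0 ((1 + \<epsilon> - norm x) / \<epsilon>))" for \<epsilon> and x :: 'a
  have est: "(\<integral>x. \<phi> \<epsilon> x * divergence F x \<partial>lborel) \<le> \<beta> * (((1 + \<epsilon>) ^ ?N - 1) / \<epsilon>)" if \<epsilon>: "0 < \<epsilon>" for \<epsilon>
  proof -
    define g where "g x = (if 1 < norm x \<and> norm x < 1 + \<epsilon> then - (1 / \<epsilon>) *\<^sub>R sgn x else 0)" for x :: 'a
    have [measurable]: "\<phi> \<epsilon> \<in> borel_measurable borel" unfolding \<phi>_def by measurable
    have [measurable]: "g \<in> borel_measurable borel" unfolding g_def sgn_div_norm by measurable
    have lip: "\<bar>\<phi> \<epsilon> x - \<phi> \<epsilon> y\<bar> \<le> (1 / \<epsilon>) * norm (x - y)" for x y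
    proof -
      have "\<bar>min 1 (max 0 s) - min 1 (max 0 t)\<bar> \<le> \<bar>s - t\<bar>" for s t :: real by (auto simp: min_def max_def)
      then have "\<bar>\<phi> \<epsilon> x - \<phi> \<epsilon> y\<bar> \<le> \<bar>(1 + \<epsilon> - norm x) / \<epsilon> - (1 + \<epsilon> - norm y) / \<epsilon>\<bar>" unfolding \<phi>_def .
      also have "\<dots> = \<bar>norm y - norm x\<bar> / \<epsilon>" using \<epsilon> by (simp add: diff_divide_distrib[symmetric])
      also have "\<dots> \<le> norm (x - y) / \<epsilon>" using \<epsilon> norm_triangle_ineq3[of y x] by (intro divide_right_mono) (auto simp: norm_minus_commute)
      finally show ?thesis by simp
    qed
    have der: "(\<phi> \<epsilon> has_derivative (\<lambda>v. g x \<bullet> v)) (at x)" if x: "norm x \<noteq> 1" "norm x \<noteq> 1 + \<epsilon>" for x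
    proof -
      have cn: "continuous_on UNIV (norm :: 'a \<Rightarrow> real)" by (intro continuous_intros)
      consider "norm x < 1" | "1 < norm x" "norm x < 1 + \<epsilon>" | "1 + \<epsilon> < norm x" using x by linarith
      then show ?thesis
      proof cases
        case 1
        have "((\<lambda>_. 1) has_derivative (\<lambda>v. g x \<bullet> v)) (at x)" using 1 by (simp add: g_def)
        then show ?thesis
          by (rule has_derivative_transform_within_open[of _ _ _ _ "ball 0 1"]) (use 1 \<epsilon> in \<open>auto simp: \<phi>_def\<close>)
      next
        case 2
        have "x \<noteq> 0" using 2 by auto
        have "((\<lambda>x. (1 + \<epsilon> - norm x) / \<epsilon>) has_derivative (\<lambda>v. (0 - (v \<bullet> sgn x)) * inverse \<epsilon>)) (at x)"
          unfolding divide_inverse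
          by (intro has_derivative_mult_left has_derivative_diff has_derivative_const has_derivative_norm[OF \<open>x \<noteq> 0\<close>])
        also have "(\<lambda>v. (0 - (v \<bullet> sgn x)) * inverse \<epsilon>) = (\<lambda>v. g x \<bullet> v)"
          using 2 by (auto simp: g_def inner_commute divide_inverse mult.commute)
        finally show ?thesis
        proof (rule has_derivative_transform_within_open)
          show "open {x::'a. 1 < norm x \<and> norm x < 1 + \<epsilon>}"
            by (intro open_Collect_conj open_Collect_less continuous_intros)
        qed (use 2 \<epsilon> in \<open>auto simp: \<phi>_def\<close>)
      next
        case 3
        have "((\<lambda>_. 0) has_derivative (\<lambda>v. g x \<bullet> v)) (at x)" using 3 by (simp add: g_def)
        then show ?thesis
        proof (rule has_derivative_transform_within_open)
          show "open {x::'a. 1 + \<epsilon> < norm x}" by (intro open_Collect_less continuous_intros)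
        qed (use 3 \<epsilon> in \<open>auto simp: \<phi>_def max_def zero_le_divide_iff\<close>)
      qed
    qed
    \<comment> \<open>The cutoff has kinks only on the two bounding spheres.\<close>
    have ae: "AE x in lborel. (\<phi> \<epsilon> has_derivative (\<lambda>v. g x \<bullet> v)) (at x)"
      by (rule AE_I'[OF null_sets.Un[OF negligible_sphere_lborel[of 1] negligible_sphere_lborel[of "1 + \<epsilon>"]]])
         (rule subsetI, rule ccontr, use der in auto)
    have b1: "\<bar>\<phi> \<epsilon> x\<bar> \<le> 1" for x by (simp add: \<phi>_def)
    have "(\<integral>x. \<phi> \<epsilon> x * divergence F x \<partial>lborel) = - (\<integral>x. g x \<bullet> F x \<partial>lborel)"
      by (rule integral_divergence_lipschitz[OF F _ b1 lip ae]) measurable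
    also have "\<dots> = (\<integral>x. - (g x \<bullet> F x) \<partial>lborel)" by simp
    also have "\<dots> \<le> (\<integral>x. (1 / \<epsilon>) * indicator (ball (0::'a) (1 + \<epsilon>) - ball 0 1) x \<partial>lborel)"
    proof (rule integral_mono_AE')
      show "integrable lborel (\<lambda>x. (1 / \<epsilon>) * indicat_real (ball (0::'a) (1 + \<epsilon>) - ball 0 1) x)"
        using emeasure_bounded_finite[of "ball (0::'a) (1 + \<epsilon>) - ball 0 1"]
        by (intro integrable_mult_right integrable_real_indicator) (auto simp: bounded_diff)
      show "AE x in lborel. - (g x \<bullet> F x) \<le> (1 / \<epsilon>) * indicator (ball 0 (1 + \<epsilon>) - ball 0 1) x"
      proof (rule AE_I2)
        fix x
        have "\<bar>sgn x \<bullet> F x\<bar> \<le> norm (sgn x) * norm (F x)" by (rule Cauchy_Schwarz_ineq2)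
        also have "\<dots> \<le> 1 * 1" using F1[of x] by (intro mult_mono) (auto simp: norm_sgn)
        finally show "- (g x \<bullet> F x) \<le> (1 / \<epsilon>) * indicator (ball 0 (1 + \<epsilon>) - ball 0 1) x"
          using \<epsilon> by (auto simp: g_def indicator_def divide_right_mono)
      qed
      show "AE x in lborel. 0 \<le> (1 / \<epsilon>) * indicat_real (ball (0::'a) (1 + \<epsilon>) - ball 0 1) x" using \<epsilon> by auto
    qed
    also have "\<dots> = (1 / \<epsilon>) * measure lborel (ball (0::'a) (1 + \<epsilon>) - ball 0 1)" by simp
    also have "measure lborel (ball (0::'a) (1 + \<epsilon>) - ball 0 1) = (1 + \<epsilon>) ^ ?N * \<beta> - \<beta>"
    proof -
      have "measure lborel (ball (0::'a) (1 + \<epsilon>) - ball 0 1) = measure lborel (ball (0::'a) (1 + \<epsilon>)) - measure lborel (ball (0::'a) 1)"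
        using \<epsilon> emeasure_lborel_ball_finite[of "0::'a" "1 + \<epsilon>"]
        by (intro measure_Diff) auto
      then show ?thesis using \<epsilon> content_ball_conv_unit_ball[of "1 + \<epsilon>" "0::'a"] by (simp add: \<beta>_def)
    qed
    finally show ?thesis using \<epsilon> by (simp add: field_simps)
  qed
  define h where "h n = inverse (real (Suc n))" for n
  have h: "0 < h n" for n by (auto simp: h_def)
  have h0: "h \<longlonglongrightarrow> 0" unfolding h_def by (rule LIMSEQ_inverse_real_of_nat)
  have lim1: "(\<lambda>n. \<integral>x. \<phi> (h n) x * divergence F x \<partial>lborel) \<longlonglongrightarrow> (\<integral>x. indicator (ball 0 1) x * divergence F x \<partial>lborel)"
  proof (rule integral_dominated_convergence)
    show "integrable lborel (\<lambda>x. \<bar>divergence F x\<bar>)" by (intro integrable_abs integrable_divergence F)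
    show "AE x in lborel. (\<lambda>n. \<phi> (h n) x * divergence F x) \<longlonglongrightarrow> indicator (ball 0 1) x * divergence F x"
    proof (rule AE_I'[OF negligible_sphere_lborel[of 1]], safe)
      fix x :: 'a assume *: "\<not> (\<lambda>n. \<phi> (h n) x * divergence F x) \<longlonglongrightarrow> indicator (ball 0 1) x * divergence F x"
      show "x \<in> sphere 0 1"
      proof (rule ccontr)
        assume x: "x \<notin> sphere 0 1"
        have "\<forall>\<^sub>F n in sequentially. \<phi> (h n) x = indicator (ball 0 1) x"
        proof (cases "norm x < 1")
          case True
          have "1 \<le> (1 + h n - norm x) / h n" "0 \<le> (1 + h n - norm x) / h n" for n
            using h[of n] True by (simp_all add: le_divide_eq)
          then show ?thesis using True by (auto simp: \<phi>_def min_def max_def intro!: always_eventually)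
        next
          case False
          then have "0 < norm x - 1" using x by auto
          with h0 have "\<forall>\<^sub>F n in sequentially. h n < norm x - 1" by (rule order_tendstoD)
          then show ?thesis
          proof eventually_elim
            case (elim n)
            then have "(1 + h n - norm x) / h n \<le> 0" using h[of n] by (simp add: divide_le_0_iff)
            then show ?case using False by (simp add: \<phi>_def)
          qed
        qed
        then have "\<forall>\<^sub>F n in sequentially. \<phi> (h n) x * divergence F x = indicator (ball 0 1) x * divergence F x"
          by eventually_elim simp
        then have "(\<lambda>n. \<phi> (h n) x * divergence F x) \<longlonglongrightarrow> indicator (ball 0 1) x * divergence F x"
          by (rule tendsto_eventually)
        with * show False by contradiction
      qed
    qed
    show "AE x in lborel. norm (\<phi> (h n) x * divergence F x) \<le> \<bar>divergence F x\<bar>" for n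
      by (rule AE_I2) (auto simp: abs_mult \<phi>_def intro!: mult_left_le_one_le)
    show "(\<lambda>x. \<phi> (h n) x * divergence F x) \<in> borel_measurable lborel" for n unfolding \<phi>_def by measurable
    show "(\<lambda>x. indicator (ball 0 1) x * divergence F x) \<in> borel_measurable lborel"
      by (rule borel_measurable_integrable[OF integrable_indicator_divergence[OF F]]) simp
  qed
  \<comment> \<open>The volume of the shell over \<epsilon> is \<beta> times a difference quotient
    of (1 + t)^N at 0.\<close>
  have "((\<lambda>t. (1 + t) ^ ?N) has_real_derivative real ?N) (at 0)"
    by (auto intro!: derivative_eq_intros)
  then have "((\<lambda>t. ((1 + (0 + t)) ^ ?N - (1 + 0) ^ ?N) / t) \<longlongrightarrow> real ?N) (at 0)"
    unfolding DERIV_def .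
  then have "(\<lambda>n. ((1 + (0 + h n)) ^ ?N - (1 + 0) ^ ?N) / h n) \<longlonglongrightarrow> real ?N"
    by (rule filterlim_compose) (use h h0 in \<open>auto simp: filterlim_at less_imp_neq[symmetric]\<close>)
  then have lim2: "(\<lambda>n. \<beta> * (((1 + h n) ^ ?N - 1) / h n)) \<longlonglongrightarrow> \<beta> * real ?N"
    by (intro tendsto_intros) simp
  have "(\<integral>x. indicator (ball 0 1) x * divergence F x \<partial>lborel) \<le> \<beta> * real ?N"
    by (rule LIMSEQ_le[OF lim1 lim2]) (use est h in auto)
  then show "(\<integral>x. indicator (ball 0 1) x * divergence F x \<partial>lborel) \<le> real ?N * measure lborel (ball (0::'a) 1)"
    by (simp add: \<beta>_def mult.commute)
qed auto

section \<open>Cutting along spheres\<close>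

lemma C1_compact_support_zero: "C1_compact_support (\<lambda>_. 0)"
  by (rule C1_compact_supportI[where F'="\<lambda>_ _. 0" and R=0]) auto

lemma divergence_zero: "divergence (\<lambda>_. 0) x = 0"
  by (subst divergence_eq[where F'="\<lambda>_. 0"]) auto

text \<open>The two perimeters are suprema over independent fields, so a bound on every pair bounds
  the sum. One field is held fixed while the supremum over the other is taken.\<close>

lemma perimeter_sum_leI:
  fixes A B :: "'a::euclidean_space set"
  assumes A: "A \<in> sets borel" and B: "B \<in> sets borel"
    and le: "\<And>F G. C1_compact_support F \<Longrightarrow> (\<And>x. norm (F x) \<le> 1) \<Longrightarrow> C1_compact_support G \<Longrightarrow> (\<And>x. norm (G x) \<le> 1) \<Longrightarrow>
      (\<integral>x. indicator A x * divergence F x \<partial>lborel) + (\<integral>x. indicator B x * divergence G x \<partial>lborel) \<le> c"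
  shows "perimeter A + perimeter B \<le> ennreal c"
proof -
  have c0: "0 \<le> c" using le[OF C1_compact_support_zero _ C1_compact_support_zero] by (simp add: divergence_zero)
  have pA: "perimeter A \<le> ennreal c"
    by (rule perimeter_leI[OF A c0]) (use le[OF _ _ C1_compact_support_zero] in \<open>simp add: divergence_zero\<close>)
  then obtain a where a: "perimeter A = ennreal a" "0 \<le> a"
    by (metis ennreal_cases ennreal_neq_top neq_top_trans)
  then have ac: "a \<le> c" using pA c0 by (simp add: ennreal_le_iff)
  have "perimeter B \<le> ennreal (c - a)"
  proof (rule perimeter_leI[OF B])
    fix G :: "'a \<Rightarrow> 'a" assume G: "C1_compact_support G" "\<And>x. norm (G x) \<le> 1"
    let ?I = "\<integral>x. indicator B x * divergence G x \<partial>lborel"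
    \<comment> \<open>The integral may be negative; testing with \<open>G\<close> and with the zero
      field yields the two cases of the maximum.\<close>
    have "perimeter A \<le> ennreal (c - max 0 ?I)"
    proof (rule perimeter_leI[OF A])
      show "0 \<le> c - max 0 ?I" using c0 le[OF C1_compact_support_zero _ G] by (simp add: divergence_zero)
      fix F :: "'a \<Rightarrow> 'a" assume F: "C1_compact_support F" "\<And>x. norm (F x) \<le> 1"
      show "(\<integral>x. indicator A x * divergence F x \<partial>lborel) \<le> c - max 0 ?I"
        using le[OF F G] le[OF F C1_compact_support_zero] by (simp add: divergence_zero max_def)
    qed
    then have "ennreal a \<le> ennreal (c - max 0 ?I)" using a by simp
    moreover have "0 \<le> c - max 0 ?I" using c0 le[OF C1_compact_support_zero _ G] by (simp add: divergence_zero)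
    ultimately have "a \<le> c - max 0 ?I" by (simp add: ennreal_le_iff)
    then show "?I \<le> c - a" by simp
  qed (use ac in simp)
  then have "perimeter A + perimeter B \<le> ennreal a + ennreal (c - a)"
    unfolding a by (rule add_left_mono)
  then show ?thesis using a ac by (simp flip: ennreal_plus)
qed

text \<open>A C^1 step from 0 to 1 on [0, 1], quadratic between the knots 0, 1/2 and 1, so that
  \<open>max_square_deriv\<close> differentiates it. The slope is a tent of height 2.\<close>

definition spline_step :: "real \<Rightarrow> real" where
  "spline_step t = 2 * (max 0 t)\<^sup>2 - 4 * (max 0 (t - 1/2))\<^sup>2 + 2 * (max 0 (t - 1))\<^sup>2"

definition spline_step' :: "real \<Rightarrow> real" where
  "spline_step' t = 4 * max 0 t - 8 * max 0 (t - 1/2) + 4 * max 0 (t - 1)"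

lemma spline_step_deriv: "(spline_step has_real_derivative spline_step' t) (at t)"
proof -
  have d: "((\<lambda>t. (max 0 (t - a))\<^sup>2) has_real_derivative 2 * max 0 (t - a)) (at t)" for a :: real
  proof -
    have "((\<lambda>t. t - a) has_real_derivative 1) (at t)" by (auto intro!: derivative_eq_intros)
    from DERIV_chain2[OF max_square_deriv this] show ?thesis by simp
  qed
  show ?thesis
    using DERIV_add[OF DERIV_diff[OF DERIV_cmult[OF d[of 0], of 2] DERIV_cmult[OF d[of "1/2"], of 4]]
        DERIV_cmult[OF d[of 1], of 2]]
    unfolding spline_step_def[abs_def] spline_step'_def by simp
qed

lemma spline_step_values:
  "t \<le> 0 \<Longrightarrow> spline_step t = 0" "1 \<le> t \<Longrightarrow> spline_step t = 1"
  "t \<le> 0 \<Longrightarrow> spline_step' t = 0" "1 \<le> t \<Longrightarrow> spline_step' t = 0"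
  by (auto simp: spline_step_def spline_step'_def power2_eq_square algebra_simps max_def)

lemma spline_step'_bound: "\<bar>spline_step' t\<bar> \<le> 2"
  by (auto simp: spline_step'_def max_def)

lemma spline_step_range: "0 \<le> spline_step t" "spline_step t \<le> 1"
proof -
  have mono: "spline_step s \<le> spline_step t" if "s \<le> t" for s t
  proof (rule DERIV_nonneg_imp_nondecreasing[OF that])
    fix x show "\<exists>y. (spline_step has_real_derivative y) (at x) \<and> 0 \<le> y"
      by (rule exI[of _ "spline_step' x"], rule conjI[OF spline_step_deriv]) (auto simp: spline_step'_def max_def)
  qed
  show "0 \<le> spline_step t" using mono[of "min t 0" t] spline_step_values(1)[of "min t 0"] by simp
  show "spline_step t \<le> 1" using mono[of t "max t 1"] spline_step_values(2)[of "max t 1"] by simp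
qed

text \<open>The field is \<open>H\<close> = \<zeta> F + (1 - \<zeta>) G, a convex combination and
  hence of norm at most 1. Its divergence has the extra term \<open>e\<close>, the product of grad
  \<zeta> with F - G; the factors are at most 4/(b - a) and 2, whence the 8.\<close>

lemma cut_field:
  fixes F G :: "'a::euclidean_space \<Rightarrow> 'a"
  assumes F: "C1_compact_support F" "\<And>x. norm (F x) \<le> 1"
    and G: "C1_compact_support G" "\<And>x. norm (G x) \<le> 1"
    and ab: "0 < a" "a < b"
  obtains H \<zeta> e where "C1_compact_support H" "\<And>x. norm (H x) \<le> 1"
    "\<And>x. divergence H x = \<zeta> x * divergence F x + (1 - \<zeta> x) * divergence G x + e x"
    "\<zeta> \<in> borel_measurable borel" "e \<in> borel_measurable borel"
    "\<And>x. 0 \<le> \<zeta> x" "\<And>x. \<zeta> x \<le> 1"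
    "\<And>x. norm x \<le> a \<Longrightarrow> \<zeta> x = 1" "\<And>x. b \<le> norm x \<Longrightarrow> \<zeta> x = 0"
    "\<And>x. \<bar>e x\<bar> \<le> 8 / (b - a) * indicator (ball 0 b - ball 0 a) x"
proof -
  obtain F' R where F': "\<And>x. (F has_derivative F' x) (at x)" "\<And>v. continuous_on UNIV (\<lambda>x. F' x v)" "R > 0"
    "\<And>x. norm x > R \<Longrightarrow> F x = 0" "\<And>x v. norm x > R \<Longrightarrow> F' x v = 0"
    using C1_compact_supportE[OF F(1)] by metis
  obtain G' S where G': "\<And>x. (G has_derivative G' x) (at x)" "\<And>v. continuous_on UNIV (\<lambda>x. G' x v)" "S > 0"
    "\<And>x. norm x > S \<Longrightarrow> G x = 0" "\<And>x v. norm x > S \<Longrightarrow> G' x v = 0"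
    using C1_compact_supportE[OF G(1)] by metis
  have cF: "continuous_on UNIV F"
    by (intro continuous_at_imp_continuous_on ballI has_derivative_continuous[OF F'(1)])
  have cG: "continuous_on UNIV G"
    by (intro continuous_at_imp_continuous_on ballI has_derivative_continuous[OF G'(1)])
  define w where "w = b\<^sup>2 - a\<^sup>2"
  have w: "w = (b - a) * (b + a)" by (simp add: w_def power2_eq_square algebra_simps)
  have wpos: "0 < w" unfolding w using ab by simp
  \<comment> \<open>A function of the squared norm is smooth at the origin as well; it falls from 1
    at radius \<open>a\<close> to 0 at radius \<open>b\<close>.\<close>
  define \<tau> where "\<tau> x = (b\<^sup>2 - x \<bullet> x) / w" for x :: 'a
  define \<zeta> where "\<zeta> x = spline_step (\<tau> x)" for x :: 'a
  define g where "g x = (spline_step' (\<tau> x) * (- 2 / w)) *\<^sub>R x" for x :: 'a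
  have nin: "\<tau> x \<ge> 1" if "norm x \<le> a" for x
    using power_mono[OF that, of 2] wpos by (simp add: \<tau>_def le_divide_eq w_def power2_norm_eq_inner[symmetric])
  have nout: "\<tau> x \<le> 0" if "b \<le> norm x" for x
    using power_mono[OF that, of 2] wpos ab by (simp add: \<tau>_def divide_le_0_iff power2_norm_eq_inner[symmetric])
  have d\<tau>: "(\<tau> has_derivative (\<lambda>v. (- 2 / w) * (x \<bullet> v))) (at x)" for x
  proof -
    have "((\<lambda>x::'a. (b\<^sup>2 - x \<bullet> x) * inverse w) has_derivative (\<lambda>v. (0 - (x \<bullet> v + v \<bullet> x)) * inverse w)) (at x)"
      by (intro has_derivative_mult_left has_derivative_diff has_derivative_const has_derivative_inner has_derivative_ident)
    then show ?thesis by (simp add: \<tau>_def[abs_def] divide_inverse inner_commute algebra_simps)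
  qed
  have d\<zeta>: "(\<zeta> has_derivative (\<lambda>v. g x \<bullet> v)) (at x)" for x
  proof -
    have "((\<lambda>x. spline_step (\<tau> x)) has_derivative (\<lambda>v. spline_step' (\<tau> x) * ((- 2 / w) * (x \<bullet> v)))) (at x)"
      by (rule has_derivative_compose[OF d\<tau> spline_step_deriv[unfolded has_field_derivative_def]])
    then show ?thesis by (simp add: \<zeta>_def[abs_def] g_def mult.assoc)
  qed
  have c\<tau>: "continuous_on UNIV \<tau>" unfolding \<tau>_def[abs_def] using wpos by (intro continuous_intros) auto
  have c\<zeta>: "continuous_on UNIV \<zeta>"
    by (intro continuous_at_imp_continuous_on ballI has_derivative_continuous[OF d\<zeta>])
  have cg: "continuous_on UNIV g"
    unfolding g_def[abs_def] spline_step'_def by (intro continuous_intros c\<tau>)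
  define H where "H x = \<zeta> x *\<^sub>R F x + (1 - \<zeta> x) *\<^sub>R G x" for x
  define H' where "H' x v = (\<zeta> x *\<^sub>R F' x v + (g x \<bullet> v) *\<^sub>R F x) + ((1 - \<zeta> x) *\<^sub>R G' x v + (0 - g x \<bullet> v) *\<^sub>R G x)" for x v
  have dH: "(H has_derivative H' x) (at x)" for x
    unfolding H_def[abs_def] H'_def
    by (intro has_derivative_add has_derivative_scaleR has_derivative_diff has_derivative_const d\<zeta> F' G')
  define e where "e x = g x \<bullet> (F x - G x)" for x
  show ?thesis
  proof (rule that[of H \<zeta> e])
    show "C1_compact_support H"
    proof (rule C1_compact_supportI[OF dH])
      show "continuous_on UNIV (\<lambda>x. H' x v)" for v
        unfolding H'_def by (intro continuous_intros cF cG cg c\<zeta> F' G')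
      show "H x = 0" if "norm x > max R S" for x using that F'(4) G'(4) by (simp add: H_def)
    qed
    show "norm (H x) \<le> 1" for x
    proof -
      have "norm (H x) \<le> \<zeta> x * norm (F x) + (1 - \<zeta> x) * norm (G x)"
        unfolding H_def using spline_step_range by (intro order_trans[OF norm_triangle_ineq]) (simp add: \<zeta>_def)
      also have "\<dots> \<le> \<zeta> x * 1 + (1 - \<zeta> x) * 1"
        using spline_step_range F(2) G(2) by (intro add_mono mult_left_mono) (auto simp: \<zeta>_def)
      finally show ?thesis by simp
    qed
    show "divergence H x = \<zeta> x * divergence F x + (1 - \<zeta> x) * divergence G x + e x" for x
    proof -
      have "divergence H x = (\<Sum>b\<in>Basis. H' x b \<bullet> b)" by (rule divergence_eq[OF dH])
      also have "\<dots> = (\<Sum>b\<in>Basis. \<zeta> x * (F' x b \<bullet> b) + (1 - \<zeta> x) * (G' x b \<bullet> b) + (g x \<bullet> b) * ((F x - G x) \<bullet> b))"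
        by (intro sum.cong refl) (simp add: H'_def inner_add_left inner_diff_left algebra_simps)
      also have "\<dots> = \<zeta> x * divergence F x + (1 - \<zeta> x) * divergence G x + e x"
        by (simp add: e_def euclidean_inner[of "g x" "F x - G x"] divergence_eq[OF F'(1)] divergence_eq[OF G'(1)]
            sum.distrib sum_distrib_left)
      finally show ?thesis .
    qed
    show "\<zeta> \<in> borel_measurable borel" by (rule borel_measurable_continuous_onI[OF c\<zeta>])
    show "e \<in> borel_measurable borel"
      unfolding e_def[abs_def] by (intro borel_measurable_continuous_onI continuous_intros cg cF cG)
    show "0 \<le> \<zeta> x" "\<zeta> x \<le> 1" for x using spline_step_range by (auto simp: \<zeta>_def)
    show "\<zeta> x = 1" if "norm x \<le> a" for x using nin[OF that] by (simp add: \<zeta>_def spline_step_values)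
    show "\<zeta> x = 0" if "b \<le> norm x" for x using nout[OF that] by (simp add: \<zeta>_def spline_step_values)
    show "\<bar>e x\<bar> \<le> 8 / (b - a) * indicator (ball 0 b - ball 0 a) x" for x
    proof (cases "norm x < b \<and> a \<le> norm x")
      case True
      \<comment> \<open>The chain rule gives at most 2 times 2 |x| / w, and |x| / w <= b / ((b - a)
        (b + a)) <= 1 / (b - a).\<close>
      have "norm (g x) = \<bar>spline_step' (\<tau> x)\<bar> * (2 / w) * norm x" using wpos by (simp add: g_def abs_mult)
      also have "\<dots> \<le> 2 * (2 / w) * b" using spline_step'_bound[of "\<tau> x"] True wpos by (intro mult_mono) auto
      also have "2 * (2 / w) * b = (4 / (b - a)) * (b / (b + a))" unfolding w by simp
      also have "\<dots> \<le> (4 / (b - a)) * 1" using ab by (intro mult_left_mono) auto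
      also have "\<dots> = 4 / (b - a)" by simp
      finally have "norm (g x) \<le> 4 / (b - a)" .
      moreover have "norm (F x - G x) \<le> 2" using norm_triangle_ineq4[of "F x" "G x"] F(2)[of x] G(2)[of x] by linarith
      ultimately have "norm (g x) * norm (F x - G x) \<le> 4 / (b - a) * 2" using ab by (intro mult_mono) auto
      then have "\<bar>e x\<bar> \<le> 8 / (b - a)" using Cauchy_Schwarz_ineq2[of "g x" "F x - G x"] by (simp add: e_def)
      then show ?thesis using True by simp
    next
      case False
      then have "spline_step' (\<tau> x) = 0" using nin[of x] nout[of x] spline_step_values by (auto simp: not_less not_le)
      then show ?thesis using ab by (simp add: e_def g_def)
    qed
  qed
qed

text \<open>
  The increments of \<open>\<mu>\<close> are taken over intervals around \<open>r\<close>, since \<open>\<mu>\<close> need not be differentiable at \<open>r\<close>.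
\<close>

lemma good_radius:
  fixes \<mu> :: "real \<Rightarrow> real"
  assumes R: "0 < R" and \<mu>: "\<mu> (2 * R) - \<mu> R \<le> s * R"
  obtains r a b where "R \<le> r" "r \<le> 2 * R" "a \<longlonglongrightarrow> r" "b \<longlonglongrightarrow> r"
    "\<And>n. 0 < a n" "\<And>n. a n \<le> r" "\<And>n. r \<le> b n" "\<And>n. a n < b n"
    "\<And>n. \<mu> (b n) - \<mu> (a n) \<le> s * (b n - a n)"
proof -
  \<comment> \<open>Intervals on which \<mu> grows too fast. The property passes from two adjacent
    intervals to their union, so if it held near every point, bisection would give it on [R, 2 R],
    against the hypothesis. The case a = b keeps degenerate intervals from being
    counterexamples.\<close>
  define P where "P a b \<longleftrightarrow> a = b \<or> s * (b - a) < \<mu> b - \<mu> a" for a b :: real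
  have "\<exists>r. R \<le> r \<and> r \<le> 2 * R \<and> \<not> (\<exists>d>0. \<forall>a b. a \<le> r \<and> r \<le> b \<and> b - a < d \<longrightarrow> P a b)"
  proof (rule ccontr)
    assume neg: "\<not> ?thesis"
    have "P R (2 * R)"
    proof (rule Bolzano)
      show "R \<le> 2 * R" using R by simp
      show "P a c" if "P a b" "P b c" for a b c using that unfolding P_def by (auto simp: algebra_simps)
      show "\<exists>d>0. \<forall>a b. a \<le> x \<and> x \<le> b \<and> b - a < d \<longrightarrow> P a b" if "R \<le> x" "x \<le> 2 * R" for x
        using neg that by blast
    qed
    then show False using R \<mu> by (simp add: P_def algebra_simps)
  qed
  then obtain r where r: "R \<le> r" "r \<le> 2 * R" "\<And>d. 0 < d \<Longrightarrow> \<exists>a b. a \<le> r \<and> r \<le> b \<and> b - a < d \<and> \<not> P a b" by blast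
  \<comment> \<open>The bound by \<open>R\<close> keeps a n positive: a n > b n - R >= r - R >=
    0.\<close>
  define h where "h n = min R (inverse (real (Suc n)))" for n
  have h: "0 < h n" "h n \<le> R" "h n \<le> inverse (real (Suc n))" for n using R by (auto simp: h_def)
  have "\<forall>n. \<exists>a b. a \<le> r \<and> r \<le> b \<and> b - a < h n \<and> \<not> P a b" using r(3) h by blast
  then obtain a b where ab: "\<And>n. a n \<le> r" "\<And>n. r \<le> b n" "\<And>n. b n - a n < h n" "\<And>n. \<not> P (a n) (b n)"
    by metis
  have lim: "(\<lambda>n. inverse (real (Suc n))) \<longlonglongrightarrow> 0" by (rule LIMSEQ_inverse_real_of_nat)
  show ?thesis
  proof (rule that[OF r(1,2), of a b])
    have d: "\<bar>a n - r\<bar> \<le> inverse (real (Suc n))" "\<bar>b n - r\<bar> \<le> inverse (real (Suc n))" for n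
      using ab(1-3)[of n] h[of n] by auto
    show "a \<longlonglongrightarrow> r"
      by (rule LIM_zero_cancel, rule Lim_null_comparison[OF _ lim]) (use d in auto)
    show "b \<longlonglongrightarrow> r"
      by (rule LIM_zero_cancel, rule Lim_null_comparison[OF _ lim]) (use d in auto)
    fix n
    show "0 < a n" using ab(1-3)[of n] h[of n] r by linarith
    show "a n < b n" using ab(1,2,4)[of n] by (auto simp: P_def)
    show "\<mu> (b n) - \<mu> (a n) \<le> s * (b n - a n)" using ab(4)[of n] by (simp add: P_def)
  qed (use ab in auto)
qed

text \<open>Fields for the two parts are glued over shells shrinking to the sphere of radius
  \<open>r\<close>. By \<open>good_radius\<close> the shell contains volume at most (m / R) (b - a),
  and the gluing error is at most 8 / (b - a) there, so the cost is 8 m / R at every stage.\<close>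

lemma perimeter_cut:
  fixes \<Omega> :: "'a::euclidean_space set"
  assumes \<Omega> [measurable]: "\<Omega> \<in> sets borel" and m: "emeasure lborel \<Omega> \<le> ennreal m" "0 \<le> m"
    and p: "perimeter \<Omega> \<le> ennreal p" "0 \<le> p" and R: "0 < R"
  obtains r where "R \<le> r" "r \<le> 2 * R"
    "perimeter (\<Omega> \<inter> ball 0 r) + perimeter (\<Omega> - ball 0 r) \<le> ennreal (p + 8 * m / R)"
proof -
  define \<mu> where "\<mu> r = measure lborel (\<Omega> \<inter> ball 0 r)" for r
  have fin: "emeasure lborel A < \<infinity>" if "A \<subseteq> \<Omega>" for A
    using emeasure_mono[OF that, of lborel] m by (auto simp: less_top[symmetric] top_unique dest: order_trans)
  have fm: "A \<in> fmeasurable lborel" if "A \<subseteq> \<Omega>" "A \<in> sets borel" for A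
    using fin[OF that(1)] that(2) by (intro fmeasurableI) auto
  have "\<mu> (2 * R) \<le> m"
  proof -
    have "ennreal (\<mu> (2 * R)) = emeasure lborel (\<Omega> \<inter> ball 0 (2 * R))"
      unfolding \<mu>_def by (rule emeasure_eq_ennreal_measure[symmetric]) (use fin[of "\<Omega> \<inter> ball 0 (2 * R)"] in auto)
    also have "\<dots> \<le> emeasure lborel \<Omega>" by (intro emeasure_mono) auto
    also have "\<dots> \<le> ennreal m" by fact
    finally show ?thesis using m by (simp add: ennreal_le_iff)
  qed
  moreover have "0 \<le> \<mu> R" by (simp add: \<mu>_def)
  ultimately have "\<mu> (2 * R) - \<mu> R \<le> m" by linarith
  then have "\<mu> (2 * R) - \<mu> R \<le> (m / R) * R" using R by simp
  then obtain r a b where r: "R \<le> r" "r \<le> 2 * R" and lim: "a \<longlonglongrightarrow> r" "b \<longlonglongrightarrow> r"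
    and ab: "\<And>n. 0 < a n" "\<And>n. a n \<le> r" "\<And>n. r \<le> b n" "\<And>n. a n < b n"
    "\<And>n. \<mu> (b n) - \<mu> (a n) \<le> m / R * (b n - a n)"
    using good_radius[OF R] by metis
  have shell: "measure lborel (\<Omega> \<inter> (ball 0 (b n) - ball 0 (a n))) = \<mu> (b n) - \<mu> (a n)" for n
  proof -
    have "\<Omega> \<inter> (ball 0 (b n) - ball 0 (a n)) = (\<Omega> \<inter> ball 0 (b n)) - (\<Omega> \<inter> ball 0 (a n))" by auto
    then show ?thesis unfolding \<mu>_def
      using ab(4)[of n] fin[of "\<Omega> \<inter> ball 0 (b n)"] by (simp add: measure_Diff subset_iff)
  qed
  have [measurable]: "ball (0::'a) r \<in> sets borel" by simp
  have "perimeter (\<Omega> \<inter> ball 0 r) + perimeter (\<Omega> - ball 0 r) \<le> ennreal (p + 8 * m / R)"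
  proof (rule perimeter_sum_leI)
    fix F G :: "'a \<Rightarrow> 'a"
    assume F: "C1_compact_support F" "\<And>x. norm (F x) \<le> 1" and G: "C1_compact_support G" "\<And>x. norm (G x) \<le> 1"
    note [measurable] = borel_measurable_divergence[OF F(1)] borel_measurable_divergence[OF G(1)]
    note intF = integrable_divergence[OF F(1)] and intG = integrable_divergence[OF G(1)]
    have "\<forall>n. \<exists>\<zeta> :: 'a \<Rightarrow> real. \<zeta> \<in> borel_measurable borel \<and> (\<forall>x. 0 \<le> \<zeta> x) \<and> (\<forall>x. \<zeta> x \<le> 1)
      \<and> (\<forall>x. norm x \<le> a n \<longrightarrow> \<zeta> x = 1) \<and> (\<forall>x. b n \<le> norm x \<longrightarrow> \<zeta> x = 0) \<and>
      (\<integral>x. indicator \<Omega> x * (\<zeta> x * divergence F x + (1 - \<zeta> x) * divergence G x) \<partial>lborel) \<le> p + 8 * m / R"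
      (is "\<forall>n. \<exists>\<zeta>. ?P n \<zeta>")
    proof
      fix n
      obtain H \<zeta> e where H: "C1_compact_support H" "\<And>x. norm (H x) \<le> 1"
        "\<And>x. divergence H x = \<zeta> x * divergence F x + (1 - \<zeta> x) * divergence G x + e x"
        and [measurable]: "\<zeta> \<in> borel_measurable borel" "e \<in> borel_measurable borel"
        and \<zeta>: "\<And>x. 0 \<le> \<zeta> x" "\<And>x. \<zeta> x \<le> 1"
          "\<And>x. norm x \<le> a n \<Longrightarrow> \<zeta> x = 1" "\<And>x. b n \<le> norm x \<Longrightarrow> \<zeta> x = 0"
        and e: "\<And>x. \<bar>e x\<bar> \<le> 8 / (b n - a n) * indicator (ball 0 (b n) - ball 0 (a n)) x"
        using cut_field[OF F G ab(1) ab(4), of n] by metis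
      have ie: "integrable lborel (\<lambda>x. 8 / (b n - a n) * indicat_real (\<Omega> \<inter> (ball 0 (b n) - ball 0 (a n))) x)"
        by (intro integrable_mult_right integrable_real_indicator fin) auto
      have e': "\<bar>indicator \<Omega> x * e x\<bar> \<le> 8 / (b n - a n) * indicator (\<Omega> \<inter> (ball 0 (b n) - ball 0 (a n))) x" for x
        using e[of x] by (auto simp: indicator_def)
      have ie2: "integrable lborel (\<lambda>x. indicator \<Omega> x * e x)"
      proof (rule Bochner_Integration.integrable_bound[OF ie])
        show "AE x in lborel. norm (indicator \<Omega> x * e x) \<le> norm (8 / (b n - a n) * indicat_real (\<Omega> \<inter> (ball 0 (b n) - ball 0 (a n))) x)"
        proof (rule AE_I2)
          fix x
          show "norm (indicator \<Omega> x * e x) \<le> norm (8 / (b n - a n) * indicat_real (\<Omega> \<inter> (ball 0 (b n) - ball 0 (a n))) x)"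
            using e'[of x] unfolding real_norm_def by linarith
        qed
      qed measurable
      have iH: "integrable lborel (\<lambda>x. indicator \<Omega> x * divergence H x)"
        by (rule integrable_indicator_divergence[OF H(1) \<Omega>])
      have "(\<integral>x. indicator \<Omega> x * (\<zeta> x * divergence F x + (1 - \<zeta> x) * divergence G x) \<partial>lborel)
        = (\<integral>x. indicator \<Omega> x * divergence H x - indicator \<Omega> x * e x \<partial>lborel)"
        by (intro Bochner_Integration.integral_cong) (auto simp: H(3) algebra_simps)
      also have "\<dots> = (\<integral>x. indicator \<Omega> x * divergence H x \<partial>lborel) - (\<integral>x. indicator \<Omega> x * e x \<partial>lborel)"
        by (rule Bochner_Integration.integral_diff[OF iH ie2])
      \<comment> \<open>The thickness of the shell cancels, so the bound survives the limit of
        shrinking shells.\<close>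
      also have "\<dots> \<le> p + 8 / (b n - a n) * (m / R * (b n - a n))"
      proof -
        have "(\<integral>x. indicator \<Omega> x * divergence H x \<partial>lborel) \<le> p"
          by (rule perimeter_geD[OF \<Omega> p H(1,2)])
        moreover have "\<bar>\<integral>x. indicator \<Omega> x * e x \<partial>lborel\<bar> \<le> (\<integral>x. 8 / (b n - a n) * indicat_real (\<Omega> \<inter> (ball 0 (b n) - ball 0 (a n))) x \<partial>lborel)"
          using bochner_integral_norm_le[OF ie2 ie] e' by simp
        moreover have "(\<integral>x. 8 / (b n - a n) * indicat_real (\<Omega> \<inter> (ball 0 (b n) - ball 0 (a n))) x \<partial>lborel) \<le> 8 / (b n - a n) * (m / R * (b n - a n))"
        proof -
          have "(\<integral>x. 8 / (b n - a n) * indicat_real (\<Omega> \<inter> (ball 0 (b n) - ball 0 (a n))) x \<partial>lborel) = 8 / (b n - a n) * (\<mu> (b n) - \<mu> (a n))"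
            by (simp only: integral_mult_right_zero shell[symmetric]) simp
          also have "\<dots> \<le> 8 / (b n - a n) * (m / R * (b n - a n))"
            using ab(4)[of n] by (intro mult_left_mono ab(5)) auto
          finally show ?thesis .
        qed
        ultimately show ?thesis by linarith
      qed
      also have "\<dots> = p + 8 * m / R" using ab(4)[of n] R by (simp add: field_simps)
      finally show "\<exists>\<zeta> :: 'a \<Rightarrow> real. \<zeta> \<in> borel_measurable borel \<and> (\<forall>x. 0 \<le> \<zeta> x) \<and> (\<forall>x. \<zeta> x \<le> 1)
        \<and> (\<forall>x. norm x \<le> a n \<longrightarrow> \<zeta> x = 1) \<and> (\<forall>x. b n \<le> norm x \<longrightarrow> \<zeta> x = 0) \<and>
        (\<integral>x. indicator \<Omega> x * (\<zeta> x * divergence F x + (1 - \<zeta> x) * divergence G x) \<partial>lborel) \<le> p + 8 * m / R"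
        using \<zeta> by (intro exI[of _ \<zeta>]) auto
    qed
    from choice[OF this] obtain \<zeta> where P: "\<And>n. ?P n (\<zeta> n)" by blast
    then have [measurable]: "\<And>n. \<zeta> n \<in> borel_measurable borel"
      and \<zeta>: "\<And>n x. 0 \<le> \<zeta> n x" "\<And>n x. \<zeta> n x \<le> 1" "\<And>n x. norm x \<le> a n \<Longrightarrow> \<zeta> n x = 1"
        "\<And>n x. b n \<le> norm x \<Longrightarrow> \<zeta> n x = 0"
      and le: "\<And>n. (\<integral>x. indicator \<Omega> x * (\<zeta> n x * divergence F x + (1 - \<zeta> n x) * divergence G x) \<partial>lborel) \<le> p + 8 * m / R"
      by blast+
    have "(\<lambda>n. \<integral>x. indicator \<Omega> x * (\<zeta> n x * divergence F x + (1 - \<zeta> n x) * divergence G x) \<partial>lborel)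
      \<longlonglongrightarrow> (\<integral>x. indicator (\<Omega> \<inter> ball 0 r) x * divergence F x + indicator (\<Omega> - ball 0 r) x * divergence G x \<partial>lborel)"
    proof (rule integral_dominated_convergence)
      show "integrable lborel (\<lambda>x. \<bar>divergence F x\<bar> + \<bar>divergence G x\<bar>)"
        by (intro Bochner_Integration.integrable_add integrable_abs intF intG)
      show "AE x in lborel. norm (indicator \<Omega> x * (\<zeta> n x * divergence F x + (1 - \<zeta> n x) * divergence G x)) \<le> \<bar>divergence F x\<bar> + \<bar>divergence G x\<bar>" for n
      proof (rule AE_I2)
        fix x
        have "\<bar>\<zeta> n x * divergence F x\<bar> \<le> \<bar>divergence F x\<bar>" "\<bar>(1 - \<zeta> n x) * divergence G x\<bar> \<le> \<bar>divergence G x\<bar>"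
          using \<zeta>(1,2)[of n x] by (auto simp: abs_mult intro!: mult_left_le_one_le)
        then show "norm (indicator \<Omega> x * (\<zeta> n x * divergence F x + (1 - \<zeta> n x) * divergence G x)) \<le> \<bar>divergence F x\<bar> + \<bar>divergence G x\<bar>"
          by (auto simp: indicator_def)
      qed
      show "AE x in lborel. (\<lambda>n. indicator \<Omega> x * (\<zeta> n x * divergence F x + (1 - \<zeta> n x) * divergence G x))
        \<longlonglongrightarrow> indicator (\<Omega> \<inter> ball 0 r) x * divergence F x + indicator (\<Omega> - ball 0 r) x * divergence G x"
      proof (rule AE_I'[of "sphere 0 r"])
        show "sphere (0::'a) r \<in> null_sets lborel" by (rule negligible_sphere_lborel)
        have "(\<lambda>n. indicator \<Omega> x * (\<zeta> n x * divergence F x + (1 - \<zeta> n x) * divergence G x))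
          \<longlonglongrightarrow> indicator (\<Omega> \<inter> ball 0 r) x * divergence F x + indicator (\<Omega> - ball 0 r) x * divergence G x" if x: "norm x \<noteq> r" for x
        proof -
          \<comment> \<open>Off the sphere, every point is eventually inside all the inner radii or
            outside all the outer radii.\<close>
          have "\<forall>\<^sub>F n in sequentially. \<zeta> n x = indicator (ball 0 r) x"
          proof (cases "norm x < r")
            case True
            with order_tendstoD(1)[OF lim(1)] have "\<forall>\<^sub>F n in sequentially. norm x < a n" by blast
            then show ?thesis by eventually_elim (use \<zeta> True in auto)
          next
            case False
            with x order_tendstoD(2)[OF lim(2)] have "\<forall>\<^sub>F n in sequentially. b n < norm x" by (metis not_less_iff_gr_or_eq)
            then show ?thesis by eventually_elim (use \<zeta> False in auto)
          qed
          then have "\<forall>\<^sub>F n in sequentially. indicator \<Omega> x * (\<zeta> n x * divergence F x + (1 - \<zeta> n x) * divergence G x)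
            = indicator (\<Omega> \<inter> ball 0 r) x * divergence F x + indicator (\<Omega> - ball 0 r) x * divergence G x"
            by eventually_elim (auto simp: indicator_def)
          then show ?thesis by (rule tendsto_eventually)
        qed
        then show "{x \<in> space lborel. \<not> (\<lambda>n. indicator \<Omega> x * (\<zeta> n x * divergence F x + (1 - \<zeta> n x) * divergence G x))
          \<longlonglongrightarrow> indicator (\<Omega> \<inter> ball 0 r) x * divergence F x + indicator (\<Omega> - ball 0 r) x * divergence G x} \<subseteq> sphere 0 r"
          by (intro subsetI) (auto simp: sphere_def)
      qed
    qed measurable
    then have "(\<integral>x. indicator (\<Omega> \<inter> ball 0 r) x * divergence F x + indicator (\<Omega> - ball 0 r) x * divergence G x \<partial>lborel) \<le> p + 8 * m / R"
      by (rule LIMSEQ_le_const2) (use le in auto)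
    then show "(\<integral>x. indicator (\<Omega> \<inter> ball 0 r) x * divergence F x \<partial>lborel) + (\<integral>x. indicator (\<Omega> - ball 0 r) x * divergence G x \<partial>lborel) \<le> p + 8 * m / R"
      by (subst (asm) Bochner_Integration.integral_add) (auto intro!: integrable_indicator_divergence F G)
  qed measurable
  then show ?thesis using that r by blast
qed

section \<open>Lower semicontinuity and scaling\<close>

definition riesz_potential :: "real \<Rightarrow> 'a::euclidean_space set \<Rightarrow> 'a \<Rightarrow> ennreal" where
  "riesz_potential \<alpha> A x = (\<integral>\<^sup>+y. ennreal (1 / norm (x - y) powr \<alpha>) * indicator A y \<partial>lborel)"

lemma riesz_potential_borel [measurable]:
  assumes [measurable]: "A \<in> sets borel"
  shows "riesz_potential \<alpha> A \<in> borel_measurable borel"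
proof -
  have "(\<lambda>x. \<integral>\<^sup>+y. ennreal (1 / norm (x - y) powr \<alpha>) * indicator A y \<partial>lborel) \<in> borel_measurable lborel" by measurable
  then show ?thesis by (simp add: riesz_potential_def[abs_def])
qed

lemma riesz_energy_lborel:
  "riesz_energy \<alpha> A = (\<integral>\<^sup>+x. riesz_potential \<alpha> A x * indicator A x \<partial>lborel) / 2"
  by (simp add: riesz_energy_def riesz_potential_def nn_integral_completion)

text \<open>For a fixed test field the integral converges along the sequence, dominated by the
  absolute divergence; a supremum of such functionals is lower semicontinuous.\<close>

lemma perimeter_le_liminf:
  fixes \<Omega> :: "'a::euclidean_space set"
  assumes [measurable]: "\<And>n. A n \<in> sets borel" "\<Omega> \<in> sets borel"
    and lim: "AE x in lborel. (\<lambda>n. indicat_real (A n) x) \<longlonglongrightarrow> indicator \<Omega> x"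
  shows "perimeter \<Omega> \<le> liminf (\<lambda>n. perimeter (A n))"
  unfolding perimeter_def[of \<Omega>]
proof (rule SUP_least)
  fix F :: "'a \<Rightarrow> 'a" assume "F \<in> {F. C1_compact_support F \<and> (\<forall>x. norm (F x) \<le> 1)}"
  then have F: "C1_compact_support F" "\<And>x. norm (F x) \<le> 1" by auto
  note [measurable] = borel_measurable_divergence[OF F(1)]
  have "(\<lambda>n. \<integral>x. indicator (A n) x * divergence F x \<partial>lborel) \<longlonglongrightarrow> (\<integral>x. indicator \<Omega> x * divergence F x \<partial>lborel)"
  proof (rule integral_dominated_convergence)
    show "integrable lborel (\<lambda>x. \<bar>divergence F x\<bar>)" by (intro integrable_abs integrable_divergence F)
    show "AE x in lborel. (\<lambda>n. indicator (A n) x * divergence F x) \<longlonglongrightarrow> indicator \<Omega> x * divergence F x"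
      using lim by eventually_elim (intro tendsto_intros)
  qed (auto simp: indicator_def)
  then have "(\<lambda>n. ennreal (LINT x:A n|lebesgue. divergence F x)) \<longlonglongrightarrow> ennreal (LINT x:\<Omega>|lebesgue. divergence F x)"
    by (intro tendsto_ennrealI) (simp add: set_integral_lebesgue_eq[OF F(1)])
  then have "ennreal (LINT x:\<Omega>|lebesgue. divergence F x) = liminf (\<lambda>n. ennreal (LINT x:A n|lebesgue. divergence F x))"
    by (simp add: lim_imp_Liminf)
  also have "\<dots> \<le> liminf (\<lambda>n. perimeter (A n))"
    unfolding perimeter_def by (intro Liminf_mono always_eventually allI SUP_upper) (use F in auto)
  finally show "ennreal (LINT x:\<Omega>|lebesgue. divergence F x) \<le> liminf (\<lambda>n. perimeter (A n))" .
qed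

text \<open>Fatou is applied twice, to the inner integral for each \<open>x\<close> and then to the
  outer one.\<close>

lemma riesz_energy_le_liminf:
  fixes \<Omega> :: "'a::euclidean_space set"
  assumes [measurable]: "\<And>n. A n \<in> sets borel" "\<Omega> \<in> sets borel"
    and lim: "AE x in lborel. (\<lambda>n. indicat_real (A n) x) \<longlonglongrightarrow> indicator \<Omega> x"
  shows "riesz_energy \<alpha> \<Omega> \<le> liminf (\<lambda>n. riesz_energy \<alpha> (A n))"
proof -
  have ev: "\<forall>\<^sub>F n in sequentially. x \<in> A n" if "(\<lambda>n. indicat_real (A n) x) \<longlonglongrightarrow> indicator \<Omega> x" "x \<in> \<Omega>" for x
  proof -
    have "\<forall>\<^sub>F n in sequentially. 1 / 2 < indicat_real (A n) x"
      using that by (intro order_tendstoD(1)) auto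
    then show ?thesis by eventually_elim (rule ccontr, simp)
  qed
  \<comment> \<open>A point of \<Omega> where the indicators converge lies in \<open>A n\<close>
    from some index on; elsewhere the left side is 0.\<close>
  have lsc: "f * indicator \<Omega> x \<le> liminf (\<lambda>n. h n * indicator (A n) x)"
    if "(\<lambda>n. indicat_real (A n) x) \<longlonglongrightarrow> indicator \<Omega> x" "f \<le> liminf h" for f :: ennreal and h x
  proof (cases "x \<in> \<Omega>")
    case True
    have "f \<le> liminf h" by fact
    also have "\<dots> \<le> liminf (\<lambda>n. h n * indicator (A n) x)"
      using ev[OF that(1) True] by (intro Liminf_mono) (elim eventually_mono, simp)
    finally show ?thesis using True by simp
  qed simp
  have g: "riesz_potential \<alpha> \<Omega> x \<le> liminf (\<lambda>n. riesz_potential \<alpha> (A n) x)" for x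
  proof -
    have "riesz_potential \<alpha> \<Omega> x \<le> (\<integral>\<^sup>+y. liminf (\<lambda>n. ennreal (1 / norm (x - y) powr \<alpha>) * indicator (A n) y) \<partial>lborel)"
      unfolding riesz_potential_def using lim
      by (intro nn_integral_mono_AE, eventually_elim) (rule lsc, auto simp: Liminf_const)
    also have "\<dots> \<le> liminf (\<lambda>n. riesz_potential \<alpha> (A n) x)"
      unfolding riesz_potential_def by (rule nn_integral_liminf) measurable
    finally show ?thesis .
  qed
  have "(\<integral>\<^sup>+x. riesz_potential \<alpha> \<Omega> x * indicator \<Omega> x \<partial>lborel) \<le> (\<integral>\<^sup>+x. liminf (\<lambda>n. riesz_potential \<alpha> (A n) x * indicator (A n) x) \<partial>lborel)"
    using lim by (intro nn_integral_mono_AE, eventually_elim) (rule lsc[OF _ g])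
  also have "\<dots> \<le> liminf (\<lambda>n. \<integral>\<^sup>+x. riesz_potential \<alpha> (A n) x * indicator (A n) x \<partial>lborel)"
    by (rule nn_integral_liminf) measurable
  finally have "(\<integral>\<^sup>+x. riesz_potential \<alpha> \<Omega> x * indicator \<Omega> x \<partial>lborel) / 2 \<le> liminf (\<lambda>n. \<integral>\<^sup>+x. riesz_potential \<alpha> (A n) x * indicator (A n) x \<partial>lborel) / 2"
    by (rule divide_right_mono_ennreal)
  also have "\<dots> \<le> liminf (\<lambda>n. (\<integral>\<^sup>+x. riesz_potential \<alpha> (A n) x * indicator (A n) x \<partial>lborel) / 2)"
    unfolding liminf_SUP_INF divide_ennreal_def SUP_mult_right_ennreal
    by (intro SUP_mono) (auto intro!: INF_greatest mult_right_mono INF_lower)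
  finally show ?thesis by (simp add: riesz_energy_lborel)
qed

lemma energy_le_liminf:
  fixes \<Omega> :: "'a::euclidean_space set"
  assumes "\<And>n. A n \<in> sets borel" "\<Omega> \<in> sets borel"
    and "AE x in lborel. (\<lambda>n. indicat_real (A n) x) \<longlonglongrightarrow> indicator \<Omega> x"
  shows "energy \<alpha> \<Omega> \<le> liminf (\<lambda>n. energy \<alpha> (A n))"
proof -
  have *: "liminf f + liminf g \<le> liminf (\<lambda>n. f n + g n)" for f g :: "nat \<Rightarrow> ennreal"
  proof -
    have "liminf f + liminf g = (SUP n. (INF m\<in>{n..}. f m) + (INF m\<in>{n..}. g m))"
      unfolding liminf_SUP_INF
      by (rule ennreal_SUP_add[symmetric]) (auto simp: incseq_def intro!: INF_superset_mono)
    also have "\<dots> \<le> (SUP n. INF m\<in>{n..}. f m + g m)"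
      by (intro SUP_mono) (auto intro!: INF_greatest add_mono INF_lower)
    finally show ?thesis by (simp add: liminf_SUP_INF)
  qed
  show ?thesis
    unfolding energy_def
    by (rule order_trans[OF add_mono[OF perimeter_le_liminf[OF assms] riesz_energy_le_liminf[OF assms]] *])
qed

text \<open>The interaction between \<open>A\<close> and \<open>B\<close> is nonnegative and is
  dropped. The direction of the inequality suits the splitting, where the energies of the parts have
  to be bounded by that of the whole.\<close>

lemma riesz_energy_superadditive:
  fixes A B :: "'a::euclidean_space set"
  assumes [measurable]: "A \<in> sets borel" "B \<in> sets borel" and disj: "A \<inter> B = {}"
  shows "riesz_energy \<alpha> A + riesz_energy \<alpha> B \<le> riesz_energy \<alpha> (A \<union> B)"
proof -
  have mono: "riesz_potential \<alpha> S x \<le> riesz_potential \<alpha> T x" if "S \<subseteq> T" for S T and x :: 'a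
    unfolding riesz_potential_def using that by (intro nn_integral_mono mult_left_mono) (auto simp: indicator_def)
  have "(\<integral>\<^sup>+x. riesz_potential \<alpha> A x * indicator A x \<partial>lborel) + (\<integral>\<^sup>+x. riesz_potential \<alpha> B x * indicator B x \<partial>lborel)
    = (\<integral>\<^sup>+x. riesz_potential \<alpha> A x * indicator A x + riesz_potential \<alpha> B x * indicator B x \<partial>lborel)"
    by (rule nn_integral_add[symmetric]) measurable
  also have "\<dots> \<le> (\<integral>\<^sup>+x. riesz_potential \<alpha> (A \<union> B) x * indicator (A \<union> B) x \<partial>lborel)"
    using disj mono[of A "A \<union> B"] mono[of B "A \<union> B"]
    by (intro nn_integral_mono) (auto simp: indicator_def)
  finally show ?thesis
    unfolding riesz_energy_lborel add_divide_distrib_ennreal[symmetric]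
    by (rule divide_right_mono_ennreal)
qed

text \<open>For \<open>t\<close> different from 0 this is the image v + t A; written as a preimage,
  its measurability is immediate.\<close>

definition affine_set :: "'a::euclidean_space \<Rightarrow> real \<Rightarrow> 'a set \<Rightarrow> 'a set" where
  "affine_set v t A = {y. (1 / t) *\<^sub>R (y - v) \<in> A}"

lemma affine_set_borel [measurable]:
  assumes "A \<in> sets borel" shows "affine_set v t A \<in> sets borel"
proof -
  have "(\<lambda>y. (1 / t) *\<^sub>R (y - v)) -` A \<inter> space borel \<in> sets borel"
    by (rule measurable_sets[OF _ assms]) measurable
  then show ?thesis by (simp add: affine_set_def vimage_def)
qed

lemma indicator_affine_set:
  assumes "t \<noteq> 0" shows "indicator (affine_set v t A) (v + t *\<^sub>R x) = indicator A x"
  using assms by (simp add: affine_set_def indicator_def)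

lemma emeasure_affine_set:
  fixes A :: "'a::euclidean_space set"
  assumes [measurable]: "A \<in> sets borel" and t: "0 < t"
  shows "emeasure lborel (affine_set v t A) = ennreal (t ^ DIM('a)) * emeasure lborel A"
proof -
  have "emeasure lborel (affine_set v t A) = (\<integral>\<^sup>+x. indicator (affine_set v t A) x \<partial>lborel)" by simp
  also have "\<dots> = ennreal (\<bar>t\<bar> ^ DIM('a)) * (\<integral>\<^sup>+x. indicator (affine_set v t A) (v + t *\<^sub>R x) \<partial>lborel)"
    by (rule lborel_nn_integral_affine) (use t in auto)
  finally show ?thesis using t by (simp add: indicator_affine_set)
qed

text \<open>A test field for the image pulls back to one for \<open>A\<close> with the same bound,
  and the chain rule multiplies its divergence by \<open>t\<close>. One of the N factors from the
  change of volume is spent on this.\<close>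

lemma perimeter_affine_set_le:
  fixes A :: "'a::euclidean_space set"
  assumes A [measurable]: "A \<in> sets borel" and t: "0 < t" and p: "perimeter A \<le> ennreal p" "0 \<le> p"
  shows "perimeter (affine_set v t A) \<le> ennreal (t ^ (DIM('a) - 1) * p)"
proof (rule perimeter_leI)
  fix F :: "'a \<Rightarrow> 'a" assume F: "C1_compact_support F" "\<And>x. norm (F x) \<le> 1"
  note [measurable] = borel_measurable_divergence[OF F(1)]
  obtain F' R where F': "\<And>x. (F has_derivative F' x) (at x)" "\<And>v. continuous_on UNIV (\<lambda>x. F' x v)" "R > 0"
    "\<And>x. norm x > R \<Longrightarrow> F x = 0"
    using C1_compact_supportE[OF F(1)] by metis
  define G where "G x = F (v + t *\<^sub>R x)" for x
  have dG: "(G has_derivative (\<lambda>u. F' (v + t *\<^sub>R x) (t *\<^sub>R u))) (at x)" for x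
    unfolding G_def[abs_def]
    by (rule has_derivative_compose[OF _ F'(1)]) (auto intro!: derivative_eq_intros)
  have G: "C1_compact_support G"
  proof (rule C1_compact_supportI[OF dG])
    show "continuous_on UNIV (\<lambda>x. F' (v + t *\<^sub>R x) (t *\<^sub>R u))" for u
      by (rule continuous_on_compose2[OF F'(2)]) (auto intro!: continuous_intros)
    fix x :: 'a assume x: "norm x > (R + norm v) / t"
    have "norm (v + t *\<^sub>R x) \<ge> norm (t *\<^sub>R x) - norm v" using norm_diff_ineq[of "t *\<^sub>R x" v] by (simp add: add.commute)
    moreover have "norm (t *\<^sub>R x) > R + norm v" using x t by (simp add: divide_less_eq mult.commute)
    ultimately have "norm (v + t *\<^sub>R x) > R" by linarith
    then show "G x = 0" by (simp add: G_def F'(4))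
  qed
  have divG: "divergence G x = t * divergence F (v + t *\<^sub>R x)" for x
    using linear_scale[OF bounded_linear.linear[OF has_derivative_bounded_linear[OF F'(1)]]]
    by (simp add: divergence_eq[OF dG] divergence_eq[OF F'(1)] sum_distrib_left)
  have "(\<integral>x. indicator (affine_set v t A) x * divergence F x \<partial>lborel)
    = \<bar>t\<bar> ^ DIM('a) * (\<integral>x. indicator (affine_set v t A) (v + t *\<^sub>R x) * divergence F (v + t *\<^sub>R x) \<partial>lborel)"
    by (rule lborel_integral_affine) (use t in auto)
  also have "\<dots> = t ^ DIM('a) * (\<integral>x. (1 / t) * (indicator A x * divergence G x) \<partial>lborel)"
    using t by (simp add: indicator_affine_set divG)
  also have "\<dots> = t ^ (DIM('a) - 1) * (\<integral>x. indicator A x * divergence G x \<partial>lborel)"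
    using t by (simp add: power_eq_if[of t "DIM('a)"])
  also have "\<dots> \<le> t ^ (DIM('a) - 1) * p"
    using t perimeter_geD[OF A p G] F(2) by (intro mult_left_mono) (auto simp: G_def)
  finally show "(\<integral>x. indicator (affine_set v t A) x * divergence F x \<partial>lborel) \<le> t ^ (DIM('a) - 1) * p" .
qed (use t p in auto)

text \<open>Each of the two integrations contributes t^N and the kernel t^(-\<alpha>).\<close>

lemma riesz_energy_affine_set:
  fixes A :: "'a::euclidean_space set"
  assumes [measurable]: "A \<in> sets borel" and t: "0 < t"
  shows "riesz_energy \<alpha> (affine_set v t A) = ennreal (t powr (2 * real DIM('a) - \<alpha>)) * riesz_energy \<alpha> A"
proof -
  let ?N = "DIM('a)"
  have gs: "riesz_potential \<alpha> (affine_set v t A) (v + t *\<^sub>R x) = ennreal (t powr (real ?N - \<alpha>)) * riesz_potential \<alpha> A x" for x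
  proof -
    have "riesz_potential \<alpha> (affine_set v t A) (v + t *\<^sub>R x)
      = ennreal (\<bar>t\<bar> ^ ?N) * (\<integral>\<^sup>+y. ennreal (1 / norm ((v + t *\<^sub>R x) - (v + t *\<^sub>R y)) powr \<alpha>) * indicator (affine_set v t A) (v + t *\<^sub>R y) \<partial>lborel)"
      unfolding riesz_potential_def by (rule lborel_nn_integral_affine) (use t in auto)
    also have "\<dots> = ennreal (t ^ ?N) * (\<integral>\<^sup>+y. ennreal (t powr - \<alpha>) * (ennreal (1 / norm (x - y) powr \<alpha>) * indicator A y) \<partial>lborel)"
    proof -
      have "ennreal (1 / norm ((v + t *\<^sub>R x) - (v + t *\<^sub>R y)) powr \<alpha>) = ennreal (t powr - \<alpha>) * ennreal (1 / norm (x - y) powr \<alpha>)" for y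
      proof -
        have "norm ((v + t *\<^sub>R x) - (v + t *\<^sub>R y)) = t * norm (x - y)"
          using t by (simp add: scaleR_diff_right[symmetric])
        then have "1 / norm ((v + t *\<^sub>R x) - (v + t *\<^sub>R y)) powr \<alpha> = t powr - \<alpha> * (1 / norm (x - y) powr \<alpha>)"
          using t by (simp add: powr_mult powr_minus divide_inverse)
        then show ?thesis by (simp only:) (rule ennreal_mult, auto)
      qed
      then show ?thesis using t by (simp add: indicator_affine_set mult.assoc)
    qed
    also have "\<dots> = ennreal (t ^ ?N) * (ennreal (t powr - \<alpha>) * riesz_potential \<alpha> A x)"
      unfolding riesz_potential_def by (subst nn_integral_cmult) auto
    also have "\<dots> = ennreal (t powr (real ?N - \<alpha>)) * riesz_potential \<alpha> A x"
      using t by (simp add: mult.assoc[symmetric] ennreal_mult[symmetric] powr_realpow[symmetric] powr_add[symmetric])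
    finally show ?thesis .
  qed
  have "(\<integral>\<^sup>+x. riesz_potential \<alpha> (affine_set v t A) x * indicator (affine_set v t A) x \<partial>lborel)
    = ennreal (\<bar>t\<bar> ^ ?N) * (\<integral>\<^sup>+x. riesz_potential \<alpha> (affine_set v t A) (v + t *\<^sub>R x) * indicator (affine_set v t A) (v + t *\<^sub>R x) \<partial>lborel)"
    by (rule lborel_nn_integral_affine) (use t in auto)
  also have "\<dots> = ennreal (t ^ ?N) * (ennreal (t powr (real ?N - \<alpha>)) * (\<integral>\<^sup>+x. riesz_potential \<alpha> A x * indicator A x \<partial>lborel))"
    using t by (simp add: gs indicator_affine_set mult.assoc nn_integral_cmult)
  also have "\<dots> = ennreal (t powr (2 * real ?N - \<alpha>)) * (\<integral>\<^sup>+x. riesz_potential \<alpha> A x * indicator A x \<partial>lborel)"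
    using t by (simp add: mult.assoc[symmetric] ennreal_mult[symmetric] powr_realpow[symmetric] powr_add[symmetric])
  finally show ?thesis
    unfolding riesz_energy_lborel by (simp add: ennreal_times_divide)
qed

section \<open>Finite energies and Borel representatives\<close>

lemma energy_finiteE:
  assumes "energy \<alpha> A \<le> ennreal c"
  obtains p d where "perimeter A = ennreal p" "0 \<le> p" "riesz_energy \<alpha> A = ennreal d" "0 \<le> d"
proof -
  have "energy \<alpha> A < \<infinity>" using assms by (auto simp: less_top[symmetric] top_unique)
  then have "perimeter A < \<infinity>" "riesz_energy \<alpha> A < \<infinity>" unfolding energy_def by (auto simp: less_top[symmetric])
  then show ?thesis using that by (metis ennreal_cases infinity_ennreal_def less_irrefl)
qed

text \<open>Competitors are Lebesgue sets, while the estimates are proved for Borel sets; perimeter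
  and Riesz energy are unchanged by null sets.\<close>

lemma borel_representative:
  fixes A :: "'a::euclidean_space set"
  assumes "A \<in> sets lebesgue"
  obtains S :: "'a set" where "S \<in> sets borel" "emeasure lborel S = emeasure lebesgue A" "energy \<alpha> S = energy \<alpha> A"
proof -
  obtain S N N' where S: "A = S \<union> N" "N \<subseteq> N'" "N' \<in> null_sets lborel" "S \<in> sets lborel"
    using sets_completionE[OF assms] by metis
  have Sb: "S \<in> sets borel" using S by simp
  have Sl: "S \<in> sets lebesgue" using S(4) by (rule sets_completionI_sets)
  have ae: "AE x in lborel. x \<in> A \<longleftrightarrow> x \<in> S"
    using AE_not_in[OF S(3)] S(1,2) by (auto elim!: eventually_mono)
  then have ael: "AE x in lebesgue. x \<in> A \<longleftrightarrow> x \<in> S" by (rule AE_completion)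
  have aei: "AE x in lborel. (indicator A x :: ennreal) = indicator S x"
    using ae by eventually_elim (simp add: indicator_def)
  have "emeasure lebesgue A = emeasure lebesgue S"
    by (rule emeasure_eq_AE[OF ael assms Sl])
  then have em: "emeasure lborel S = emeasure lebesgue A" using S(4) by simp
  have "riesz_energy \<alpha> S = riesz_energy \<alpha> A"
  proof -
    have "riesz_potential \<alpha> S = riesz_potential \<alpha> A"
      unfolding riesz_potential_def using aei by (intro ext nn_integral_cong_AE) (auto elim!: eventually_mono)
    then have "(\<integral>\<^sup>+x. riesz_potential \<alpha> S x * indicator S x \<partial>lborel) = (\<integral>\<^sup>+x. riesz_potential \<alpha> A x * indicator A x \<partial>lborel)"
      using aei by (intro nn_integral_cong_AE) (auto elim!: eventually_mono)
    then show ?thesis unfolding riesz_energy_lborel by simp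
  qed
  moreover have "perimeter S = perimeter A"
  proof -
    have "(LINT x:S|lebesgue. divergence F x) = (LINT x:A|lebesgue. divergence F x)" if "C1_compact_support F" for F
    proof -
      have [measurable]: "divergence F \<in> borel_measurable lebesgue"
        using borel_measurable_divergence[OF that] by (simp add: measurable_completion)
      have [measurable]: "S \<in> sets lebesgue" "A \<in> sets lebesgue" by fact+
      show ?thesis
        unfolding set_lebesgue_integral_def
        by (rule integral_cong_AE) (use ael in \<open>auto elim!: eventually_mono simp: indicator_def\<close>)
    qed
    then show ?thesis unfolding perimeter_def by (intro SUP_cong) auto
  qed
  ultimately show ?thesis using that[OF Sb em] by (simp add: energy_def)
qed

section \<open>Compactness\<close>

text \<open>The translation estimate, integrated over all shifts shorter than \<rho>. Both the
  exclusion of vanishing and the compactness rest on it.\<close>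

lemma nn_integral_ball_average_diff:
  fixes A :: "'a::euclidean_space set"
  assumes A [measurable]: "A \<in> sets borel" and fin: "emeasure lborel A < \<infinity>"
    and p: "perimeter A \<le> ennreal p" "0 \<le> p" and \<rho>: "0 < \<rho>"
  shows "(\<integral>\<^sup>+x. ennreal \<bar>indicator A x * measure lborel (ball (0::'a) \<rho>) - measure lborel (A \<inter> ball x \<rho>)\<bar> \<partial>lborel)
    \<le> ennreal (measure lborel (ball (0::'a) \<rho>) * (\<rho> * p))"
proof -
  let ?w = "indicat_real A"
  define b where "b = measure lborel (ball (0::'a) \<rho>)"
  have ib: "integrable lborel (indicat_real (ball (0::'a) \<rho>))"
    using emeasure_lborel_ball_finite[of "0::'a" \<rho>] by (intro integrable_real_indicator) auto
  have pt: "ennreal \<bar>?w x * b - measure lborel (A \<inter> ball x \<rho>)\<bar>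
    \<le> (\<integral>\<^sup>+z. indicator (ball 0 \<rho>) z * ennreal \<bar>?w (x + z) - ?w x\<bar> \<partial>lborel)" for x
  proof -
    have i: "integrable lborel (\<lambda>z. indicator (ball 0 \<rho>) z * ?w (x + z))"
      by (rule Bochner_Integration.integrable_bound[OF ib]) (auto simp: indicator_def)
    have "measure lborel (A \<inter> ball x \<rho>) = (\<integral>y. indicat_real (A \<inter> ball x \<rho>) y \<partial>lborel)" by simp
    also have "\<dots> = (\<integral>z. indicat_real (A \<inter> ball x \<rho>) (z + x) \<partial>lborel)"
      by (rule lborel_integral_translate[symmetric]) (auto intro!: borel_measurable_indicator)
    also have "\<dots> = (\<integral>z. indicator (ball 0 \<rho>) z * ?w (x + z) \<partial>lborel)"
      by (intro Bochner_Integration.integral_cong) (auto simp: indicator_def dist_norm add.commute)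
    finally have "measure lborel (A \<inter> ball x \<rho>) - ?w x * b = (\<integral>z. indicator (ball 0 \<rho>) z * ?w (x + z) - ?w x * indicator (ball 0 \<rho>) z \<partial>lborel)"
      using i ib by (simp add: b_def)
    then have "ennreal \<bar>?w x * b - measure lborel (A \<inter> ball x \<rho>)\<bar> = ennreal (norm (\<integral>z. indicator (ball 0 \<rho>) z * ?w (x + z) - ?w x * indicator (ball 0 \<rho>) z \<partial>lborel))"
      by (simp add: abs_minus_commute)
    also have "\<dots> \<le> (\<integral>\<^sup>+z. ennreal (norm (indicator (ball 0 \<rho>) z * ?w (x + z) - ?w x * indicator (ball 0 \<rho>) z)) \<partial>lborel)"
      by (rule integral_norm_bound_ennreal) (intro Bochner_Integration.integrable_diff i integrable_mult_right ib)
    also have "\<dots> = (\<integral>\<^sup>+z. indicator (ball 0 \<rho>) z * ennreal \<bar>?w (x + z) - ?w x\<bar> \<partial>lborel)"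
      by (intro nn_integral_cong) (auto simp: indicator_def)
    finally show ?thesis .
  qed
  have [measurable]: "ball (0::'a) \<rho> \<in> sets borel" by simp
  have "(\<integral>\<^sup>+x. ennreal \<bar>?w x * b - measure lborel (A \<inter> ball x \<rho>)\<bar> \<partial>lborel)
    \<le> (\<integral>\<^sup>+x. \<integral>\<^sup>+z. indicator (ball 0 \<rho>) z * ennreal \<bar>?w (x + z) - ?w x\<bar> \<partial>lborel \<partial>lborel)"
    by (intro nn_integral_mono pt)
  also have "\<dots> = (\<integral>\<^sup>+z. \<integral>\<^sup>+x. indicator (ball 0 \<rho>) z * ennreal \<bar>?w (x + z) - ?w x\<bar> \<partial>lborel \<partial>lborel)"
    by (rule lborel_pair.Fubini') measurable
  also have "\<dots> \<le> (\<integral>\<^sup>+z. indicator (ball (0::'a) \<rho>) z * ennreal (\<rho> * p) \<partial>lborel)"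
  proof (rule nn_integral_mono)
    fix z :: 'a
    have "(\<integral>\<^sup>+x. indicator (ball 0 \<rho>) z * ennreal \<bar>?w (x + z) - ?w x\<bar> \<partial>lborel)
      = indicator (ball 0 \<rho>) z * (\<integral>\<^sup>+x. ennreal \<bar>?w (x + z) - ?w x\<bar> \<partial>lborel)"
      by (subst nn_integral_cmult) auto
    also have "\<dots> \<le> indicator (ball 0 \<rho>) z * ennreal (\<rho> * p)"
    proof (cases "norm z < \<rho>")
      case True
      have "(\<integral>\<^sup>+x. ennreal \<bar>?w (x + z) - ?w x\<bar> \<partial>lborel) \<le> ennreal (norm z * p)"
        by (rule nn_integral_indicator_increment[OF A fin p])
      also have "\<dots> \<le> ennreal (\<rho> * p)" using True p by (intro ennreal_leI mult_right_mono) auto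
      finally show ?thesis by (rule mult_left_mono) simp
    qed simp
    finally show "(\<integral>\<^sup>+x. indicator (ball 0 \<rho>) z * ennreal \<bar>?w (x + z) - ?w x\<bar> \<partial>lborel) \<le> indicator (ball 0 \<rho>) z * ennreal (\<rho> * p)" .
  qed
  also have "\<dots> = emeasure lborel (ball (0::'a) \<rho>) * ennreal (\<rho> * p)"
    by (subst nn_integral_multc) auto
  also have "\<dots> = ennreal (b * (\<rho> * p))"
    using emeasure_lborel_ball_finite[of "0::'a" \<rho>] p \<rho> by (simp add: b_def emeasure_eq_ennreal_measure ennreal_mult less_top)
  finally show ?thesis by (simp add: b_def)
qed

lemma measurable_ball_mass [measurable]:
  fixes A :: "'a::euclidean_space set"
  assumes [measurable]: "A \<in> sets borel"
  shows "(\<lambda>x. measure lborel (A \<inter> ball x \<rho>)) \<in> borel_measurable borel"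
proof -
  have "(\<lambda>x. \<integral>y. indicat_real A y * indicat_real {z. norm z < \<rho>} (x - y) \<partial>lborel) \<in> borel_measurable lborel"
    by measurable
  moreover have "(\<integral>y. indicat_real A y * indicat_real {z. norm z < \<rho>} (x - y) \<partial>lborel) = measure lborel (A \<inter> ball x \<rho>)" for x
  proof -
    have "(\<integral>y. indicat_real A y * indicat_real {z. norm z < \<rho>} (x - y) \<partial>lborel) = (\<integral>y. indicat_real (A \<inter> ball x \<rho>) y \<partial>lborel)"
      by (intro Bochner_Integration.integral_cong) (auto simp: indicator_def dist_norm)
    then show ?thesis by simp
  qed
  ultimately show ?thesis by simp
qed

text \<open>If every ball of radius \<rho> were less than half filled, the difference in the
  preceding estimate would be at least b/2 on all of \<open>A\<close>, with b the volume of the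
  ball. This gives b V / 2 <= b \<rho> p <= b V / 4, a contradiction.\<close>

lemma nonvanishing:
  fixes A :: "'a::euclidean_space set"
  assumes A [measurable]: "A \<in> sets borel" and V: "emeasure lborel A = ennreal V" "0 < V"
    and p: "perimeter A \<le> ennreal p" "0 \<le> p" and \<rho>: "0 < \<rho>" "\<rho> * p \<le> V / 4"
  obtains x where "measure lborel (ball (0::'a) \<rho>) / 2 \<le> measure lborel (A \<inter> ball x \<rho>)"
proof (rule ccontr)
  let ?b = "measure lborel (ball (0::'a) \<rho>)"
  have b: "0 < ?b" using \<rho> by (simp add: content_ball_pos)
  assume "\<not> thesis"
  then have less: "measure lborel (A \<inter> ball x \<rho>) < ?b / 2" for x using that by (meson not_le)
  have "ennreal (?b / 2) * ennreal V = (\<integral>\<^sup>+x. ennreal (?b / 2) * indicator A x \<partial>lborel)"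
    by (subst nn_integral_cmult) (auto simp: V)
  also have "\<dots> \<le> (\<integral>\<^sup>+x. ennreal \<bar>indicator A x * ?b - measure lborel (A \<inter> ball x \<rho>)\<bar> \<partial>lborel)"
  proof (rule nn_integral_mono)
    fix x
    show "ennreal (?b / 2) * indicator A x \<le> ennreal \<bar>indicator A x * ?b - measure lborel (A \<inter> ball x \<rho>)\<bar>"
    proof (cases "x \<in> A")
      case True
      have "?b / 2 \<le> \<bar>?b - measure lborel (A \<inter> ball x \<rho>)\<bar>" using less[of x] by linarith
      then show ?thesis using True by (simp add: ennreal_leI)
    qed simp
  qed
  also have "\<dots> \<le> ennreal (?b * (\<rho> * p))"
    by (rule nn_integral_ball_average_diff[OF A _ p \<rho>(1)]) (simp add: V)
  also have "\<dots> \<le> ennreal (?b * (V / 4))"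
    using \<rho> b by (intro ennreal_leI mult_left_mono) auto
  finally have "?b / 2 * V \<le> ?b * (V / 4)"
    using b V by (simp add: ennreal_le_iff flip: ennreal_mult)
  then show False using b V by simp
qed

text \<open>The points in one ball but not in the other lie in a shell of thickness |x - q|. The
  bound is the same for all sets \<open>A\<close>.\<close>

lemma ball_mass_equicontinuous:
  fixes A :: "'a::euclidean_space set"
  assumes [measurable]: "A \<in> sets borel" and \<rho>: "0 < \<rho>"
  shows "\<bar>measure lborel (A \<inter> ball x \<rho>) - measure lborel (A \<inter> ball q \<rho>)\<bar>
    \<le> measure lborel (ball (0::'a) 1) * ((\<rho> + norm (x - q)) ^ DIM('a) - \<rho> ^ DIM('a))"
proof -
  have fm: "S \<in> fmeasurable lborel" if "S \<in> sets borel" "bounded S" for S :: "'a set"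
    using that by (intro fmeasurableI emeasure_bounded_finite) auto
  have "measure lborel (A \<inter> ball x \<rho>) \<le> measure lborel (A \<inter> ball q \<rho>)
      + measure lborel (ball (0::'a) 1) * ((\<rho> + norm (x - q)) ^ DIM('a) - \<rho> ^ DIM('a))" for x q
  proof -
    have "A \<inter> ball x \<rho> \<subseteq> (A \<inter> ball q \<rho>) \<union> (ball q (\<rho> + norm (x - q)) - ball q \<rho>)"
    proof
      fix y assume y: "y \<in> A \<inter> ball x \<rho>"
      have "dist q y \<le> dist q x + dist x y" by (rule dist_triangle)
      then show "y \<in> (A \<inter> ball q \<rho>) \<union> (ball q (\<rho> + norm (x - q)) - ball q \<rho>)"
        using y by (auto simp: dist_norm norm_minus_commute)
    qed
    then have "measure lborel (A \<inter> ball x \<rho>) \<le> measure lborel ((A \<inter> ball q \<rho>) \<union> (ball q (\<rho> + norm (x - q)) - ball q \<rho>))"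
      by (intro measure_mono_fmeasurable fm) (auto intro: bounded_subset[OF bounded_ball])
    also have "\<dots> \<le> measure lborel (A \<inter> ball q \<rho>) + measure lborel (ball q (\<rho> + norm (x - q)) - ball q \<rho>)"
      by (intro measure_Un_le) auto
    also have "measure lborel (ball q (\<rho> + norm (x - q)) - ball q \<rho>) = measure lborel (ball q (\<rho> + norm (x - q))) - measure lborel (ball q \<rho>)"
      using emeasure_lborel_ball_finite[of q "\<rho> + norm (x - q)"] subset_ball[of \<rho> "\<rho> + norm (x - q)" q]
      by (intro measure_Diff) auto
    also have "\<dots> = measure lborel (ball (0::'a) 1) * ((\<rho> + norm (x - q)) ^ DIM('a) - \<rho> ^ DIM('a))"
      using content_ball_conv_unit_ball[of "\<rho> + norm (x - q)" q] content_ball_conv_unit_ball[of \<rho> q] \<rho>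
      by (simp add: algebra_simps)
    finally show ?thesis by simp
  qed
  from this[of x q] this[of q x] show ?thesis by (simp add: norm_minus_commute abs_le_iff)
qed

text \<open>Equicontinuity carries convergence from the dense set \<open>Q\<close> to all centres by
  an e/3 argument.\<close>

lemma ball_mass_convergent_everywhere:
  fixes B :: "nat \<Rightarrow> 'a::euclidean_space set"
  assumes B: "\<And>n. B n \<in> sets borel" and \<rho>: "0 < \<rho>"
    and dense: "\<And>x e. 0 < e \<Longrightarrow> \<exists>q\<in>Q. norm (x - q) < e"
    and conv: "\<And>q. q \<in> Q \<Longrightarrow> convergent (\<lambda>n. measure lborel (B n \<inter> ball q \<rho>))"
  shows "convergent (\<lambda>n. measure lborel (B n \<inter> ball x \<rho>))"
proof (rule Cauchy_convergent, rule metric_CauchyI)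
  fix e :: real assume e: "0 < e"
  define \<omega> where "\<omega> t = measure lborel (ball (0::'a) 1) * ((\<rho> + t) ^ DIM('a) - \<rho> ^ DIM('a))" for t
  have "isCont \<omega> 0" unfolding \<omega>_def by (intro continuous_intros)
  then have "\<exists>s>0. \<forall>t. dist t 0 < s \<longrightarrow> dist (\<omega> t) (\<omega> 0) < e / 3"
    using e unfolding continuous_at_eps_delta by (metis divide_pos_pos zero_less_numeral)
  then obtain s where s: "0 < s" "\<And>t. \<bar>t\<bar> < s \<Longrightarrow> \<bar>\<omega> t\<bar> < e / 3"
    by (auto simp: dist_real_def \<omega>_def)
  obtain q where q: "q \<in> Q" "norm (x - q) < s" using dense[OF s(1)] by blast
  have close: "\<bar>measure lborel (B n \<inter> ball x \<rho>) - measure lborel (B n \<inter> ball q \<rho>)\<bar> < e / 3" for n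
    using ball_mass_equicontinuous[OF B \<rho>, of n x q] s(2)[of "norm (x - q)"] q(2) by (simp add: \<omega>_def)
  have "Cauchy (\<lambda>n. measure lborel (B n \<inter> ball q \<rho>))" using conv[OF q(1)] by (rule convergent_Cauchy)
  then obtain M where M: "\<And>m n. m \<ge> M \<Longrightarrow> n \<ge> M \<Longrightarrow> dist (measure lborel (B m \<inter> ball q \<rho>)) (measure lborel (B n \<inter> ball q \<rho>)) < e / 3"
    using e by (meson metric_CauchyD divide_pos_pos zero_less_numeral)
  show "\<exists>M. \<forall>m\<ge>M. \<forall>n\<ge>M. dist (measure lborel (B m \<inter> ball x \<rho>)) (measure lborel (B n \<inter> ball x \<rho>)) < e"
  proof (intro exI[of _ M] allI impI)
    fix m n assume "M \<le> m" "M \<le> n"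
    then show "dist (measure lborel (B m \<inter> ball x \<rho>)) (measure lborel (B n \<inter> ball x \<rho>)) < e"
      using M[of m n] close[of m] close[of n] unfolding dist_real_def by linarith
  qed
qed

text \<open>The perimeter bound keeps the indicators close in L1 to their averages at one small
  scale, uniformly along the sequence. The averages converge pointwise, hence in L1 on the ball.
  Four errors of b e / 4 then bound \<open>b\<close> times the volume of the symmetric
  difference.\<close>

lemma indicator_Cauchy_on_ball:
  fixes B :: "nat \<Rightarrow> 'a::euclidean_space set"
  assumes B [measurable]: "\<And>n. B n \<in> sets borel" and m: "\<And>n. emeasure lborel (B n) < \<infinity>"
    and p: "\<And>n. perimeter (B n) \<le> ennreal p" "0 \<le> p"
    and conv: "\<And>x j. convergent (\<lambda>n. measure lborel (B n \<inter> ball x (inverse (real (Suc j)))))"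
    and e: "0 < e"
  shows "\<exists>M. \<forall>n\<ge>M. \<forall>l\<ge>M. emeasure lborel ({x \<in> B n. x \<notin> B l} \<inter> cball 0 R \<union> {x \<in> B l. x \<notin> B n} \<inter> cball 0 R) \<le> ennreal e"
proof -
  \<comment> \<open>The averaging radius is below e / (4 (p + 1)), so that \<rho> p is at most e/4;
    p + 1 avoids a division by zero.\<close>
  obtain j :: nat where j: "inverse (real (Suc j)) < e / 4 / (p + 1)"
    using reals_Archimedean[of "e / 4 / (p + 1)"] e p by auto
  define \<rho> where "\<rho> = inverse (real (Suc j))"
  have \<rho>: "0 < \<rho>" by (simp add: \<rho>_def)
  define b where "b = measure lborel (ball (0::'a) \<rho>)"
  have b: "0 < b" using \<rho> by (simp add: b_def content_ball_pos)
  define u where "u n x = measure lborel (B n \<inter> ball x \<rho>)" for n x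
  have [measurable]: "u n \<in> borel_measurable borel" for n unfolding u_def by measurable
  have ub: "0 \<le> u n x" "u n x \<le> b" for n x
  proof -
    have "u n x \<le> measure lborel (ball x \<rho>)"
      unfolding u_def by (intro measure_mono_fmeasurable fmeasurableI emeasure_bounded_finite) auto
    also have "\<dots> = b" using content_ball_conv_unit_ball[of \<rho> x] content_ball_conv_unit_ball[of \<rho> "0::'a"] \<rho> by (simp add: b_def)
    finally show "u n x \<le> b" .
  qed (simp add: u_def)
  define U where "U x = lim (\<lambda>n. u n x)" for x
  have U: "(\<lambda>n. u n x) \<longlonglongrightarrow> U x" for x
    using conv[of x j] unfolding U_def u_def \<rho>_def by (simp add: convergent_LIMSEQ_iff)
  have [measurable]: "U \<in> borel_measurable borel"
    by (rule borel_measurable_LIMSEQ_real[OF U]) measurable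
  have [measurable]: "cball (0::'a) R \<in> sets borel" by simp
  have lim: "(\<lambda>n. \<integral>\<^sup>+x. ennreal \<bar>u n x - U x\<bar> * indicator (cball 0 R) x \<partial>lborel) \<longlonglongrightarrow> (\<integral>\<^sup>+x. 0 \<partial>(lborel :: 'a measure))"
  proof (rule nn_integral_dominated_convergence)
    show "(\<integral>\<^sup>+x. ennreal (2 * b) * indicator (cball (0::'a) R) x \<partial>lborel) < \<infinity>"
      using emeasure_lborel_cball_finite[of "0::'a" R]
      by (subst nn_integral_cmult) (auto simp: ennreal_mult_less_top intro!: borel_measurable_indicator)
    show "AE x in lborel. (\<lambda>n. ennreal \<bar>u n x - U x\<bar> * indicator (cball 0 R) x) \<longlonglongrightarrow> 0"
    proof (rule AE_I2)
      fix x
      have "(\<lambda>n. \<bar>u n x - U x\<bar>) \<longlonglongrightarrow> \<bar>U x - U x\<bar>" by (intro tendsto_intros U)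
      then have *: "(\<lambda>n. ennreal \<bar>u n x - U x\<bar>) \<longlonglongrightarrow> 0" using tendsto_ennrealI by fastforce
      then show "(\<lambda>n. ennreal \<bar>u n x - U x\<bar> * indicator (cball 0 R) x) \<longlonglongrightarrow> 0"
        by (cases "x \<in> cball 0 R") auto
    qed
    show "AE x in lborel. ennreal \<bar>u n x - U x\<bar> * indicator (cball 0 R) x \<le> ennreal (2 * b) * indicator (cball 0 R) x" for n
    proof (intro AE_I2 mult_right_mono ennreal_leI)
      fix x
      have "0 \<le> U x" by (rule LIMSEQ_le_const[OF U]) (use ub in auto)
      moreover have "U x \<le> b" by (rule LIMSEQ_le_const2[OF U]) (use ub in auto)
      ultimately show "\<bar>u n x - U x\<bar> \<le> 2 * b" using ub[of n x] b by linarith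
    qed simp
  qed measurable
  define e' where "e' = b * e / 4"
  have e': "0 < e'" using b e by (simp add: e'_def)
  have "\<forall>\<^sub>F n in sequentially. (\<integral>\<^sup>+x. ennreal \<bar>u n x - U x\<bar> * indicator (cball 0 R) x \<partial>lborel) < ennreal e'"
    using lim e' by (intro order_tendstoD(2)[OF lim]) auto
  then obtain M where M: "\<And>n. n \<ge> M \<Longrightarrow> (\<integral>\<^sup>+x. ennreal \<bar>u n x - U x\<bar> * indicator (cball 0 R) x \<partial>lborel) \<le> ennreal e'"
    unfolding eventually_sequentially using less_imp_le by blast
  have \<rho>p: "b * (\<rho> * p) \<le> e'"
  proof -
    have "\<rho> * p \<le> e / 4 / (p + 1) * (p + 1)" using j p e by (intro mult_mono) (auto simp: \<rho>_def)
    also have "\<dots> = e / 4"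
    proof -
      have "p + 1 \<noteq> 0" using p(2) by linarith
      then show ?thesis by (metis nonzero_eq_divide_eq)
    qed
    finally show ?thesis using b by (simp add: e'_def mult_left_mono)
  qed
  have one: "(\<integral>\<^sup>+x. ennreal \<bar>indicator (B n) x * b - u n x\<bar> \<partial>lborel) \<le> ennreal e'" for n
    using nn_integral_ball_average_diff[OF B m p(1) p(2) \<rho>, of n] \<rho>p
    by (auto simp: b_def[symmetric] u_def[symmetric] intro: order_trans ennreal_leI)
  show ?thesis
  proof (intro exI[of _ M] allI impI)
    fix n l assume nl: "M \<le> n" "M \<le> l"
    define D where "D = {x \<in> B n. x \<notin> B l} \<inter> cball 0 R \<union> {x \<in> B l. x \<notin> B n} \<inter> cball 0 R"
    have [measurable]: "D \<in> sets borel" unfolding D_def by measurable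
    have "ennreal b * emeasure lborel D = (\<integral>\<^sup>+x. ennreal b * indicator D x \<partial>lborel)"
      by (subst nn_integral_cmult) auto
    also have "\<dots> \<le> (\<integral>\<^sup>+x. (ennreal \<bar>indicator (B n) x * b - u n x\<bar> + ennreal \<bar>indicator (B l) x * b - u l x\<bar>)
      + (ennreal \<bar>u n x - U x\<bar> * indicator (cball 0 R) x + ennreal \<bar>u l x - U x\<bar> * indicator (cball 0 R) x) \<partial>lborel)"
    proof (rule nn_integral_mono)
      fix x
      show "ennreal b * indicator D x \<le> (ennreal \<bar>indicator (B n) x * b - u n x\<bar> + ennreal \<bar>indicator (B l) x * b - u l x\<bar>)
        + (ennreal \<bar>u n x - U x\<bar> * indicator (cball 0 R) x + ennreal \<bar>u l x - U x\<bar> * indicator (cball 0 R) x)"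
      proof (cases "x \<in> D")
        case True
        then have R: "x \<in> cball 0 R" and ind: "(x \<in> B n \<and> x \<notin> B l) \<or> (x \<in> B l \<and> x \<notin> B n)" by (auto simp: D_def)
        \<comment> \<open>On the symmetric difference the two indicators differ by 1, and the path
          between them runs through u n, the limit \<open>U\<close> and u l.\<close>
        have "b \<le> (\<bar>indicator (B n) x * b - u n x\<bar> + \<bar>indicator (B l) x * b - u l x\<bar>) + (\<bar>u n x - U x\<bar> + \<bar>u l x - U x\<bar>)"
          using ind by (auto simp: indicator_def)
        then have "ennreal b \<le> ennreal ((\<bar>indicator (B n) x * b - u n x\<bar> + \<bar>indicator (B l) x * b - u l x\<bar>) + (\<bar>u n x - U x\<bar> + \<bar>u l x - U x\<bar>))"
          by (rule ennreal_leI)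
        then show ?thesis using True R by simp
      qed simp
    qed
    also have "\<dots> = ((\<integral>\<^sup>+x. ennreal \<bar>indicator (B n) x * b - u n x\<bar> \<partial>lborel) + (\<integral>\<^sup>+x. ennreal \<bar>indicator (B l) x * b - u l x\<bar> \<partial>lborel))
      + ((\<integral>\<^sup>+x. ennreal \<bar>u n x - U x\<bar> * indicator (cball 0 R) x \<partial>lborel) + (\<integral>\<^sup>+x. ennreal \<bar>u l x - U x\<bar> * indicator (cball 0 R) x \<partial>lborel))"
      by (subst nn_integral_add, measurable)+
    also have "\<dots> \<le> (ennreal e' + ennreal e') + (ennreal e' + ennreal e')"
      by (intro add_mono one M nl)
    also have "\<dots> = ennreal (b * e)" using e' by (simp add: e'_def flip: ennreal_plus)
    finally have le: "ennreal b * emeasure lborel D \<le> ennreal (b * e)" .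
    have "emeasure lborel D < \<infinity>"
      by (rule emeasure_bounded_finite) (auto simp: D_def intro: bounded_subset[OF bounded_cball[of 0 R]])
    then obtain q where q: "emeasure lborel D = ennreal q" "0 \<le> q"
      by (metis ennreal_cases infinity_ennreal_def less_irrefl)
    have "b * q \<le> b * e" using le q b e by (simp add: ennreal_le_iff flip: ennreal_mult)
    then show "emeasure lborel ({x \<in> B n. x \<notin> B l} \<inter> cball 0 R \<union> {x \<in> B l. x \<notin> B n} \<inter> cball 0 R) \<le> ennreal e"
      using b q unfolding D_def[symmetric] by (simp add: ennreal_leI)
  qed
qed

text \<open>Volumes in countably many balls are made to converge first. The indicators are then
  locally Cauchy in L1, and a second subsequence with summable differences converges almost
  everywhere by Borel-Cantelli.\<close>

theorem finite_perimeter_compactness: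
  fixes A :: "nat \<Rightarrow> 'a::euclidean_space set"
  assumes A: "\<And>n. A n \<in> sets borel" and m: "\<And>n. emeasure lborel (A n) \<le> ennreal m"
    and p: "\<And>n. perimeter (A n) \<le> ennreal p" "0 \<le> p"
  obtains r \<Omega> where "strict_mono (r :: nat \<Rightarrow> nat)" "\<Omega> \<in> sets borel"
    "AE x in lborel. (\<lambda>n. indicat_real (A (r n)) x) \<longlonglongrightarrow> indicator \<Omega> x"
proof -
  have fin: "emeasure lborel (A n) < \<infinity>" for n using m[of n] by (auto simp: less_top[symmetric] top_unique)
  obtain Q :: "'a set" where Q: "countable Q" "\<And>X. open X \<Longrightarrow> X \<noteq> {} \<Longrightarrow> \<exists>d\<in>Q. d \<in> X"
    using countable_dense_setE by blast
  have dense: "\<exists>q\<in>Q. norm (x - q) < e" if "0 < e" for x e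
    using Q(2)[of "ball x e"] that by (auto simp: dist_norm)
  have nb: "norm (measure lborel (A n \<inter> ball (fst z) (inverse (real (Suc (snd z)))))) \<le> max m 0" for n and z :: "'a \<times> nat"
  proof -
    have "emeasure lborel (A n \<inter> ball (fst z) (inverse (real (Suc (snd z))))) \<le> emeasure lborel (A n)"
      using A by (intro emeasure_mono) auto
    also have "\<dots> \<le> ennreal (max m 0)" using m[of n] by (rule order_trans) (simp add: ennreal_leI)
    finally show ?thesis by (simp add: measure_def enn2real_leI)
  qed
  have "\<exists>k :: nat \<Rightarrow> nat. strict_mono k \<and> (\<forall>z\<in>Q \<times> UNIV. \<exists>l. (\<lambda>n. measure lborel (A (k n) \<inter> ball (fst z) (inverse (real (Suc (snd z)))))) \<longlonglongrightarrow> l)"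
  \<comment> \<open>The diagonal argument over countably many pairs of a centre and a radius
    index.\<close>
  proof (rule function_convergent_subsequence[of "Q \<times> (UNIV :: nat set)" "\<lambda>n z. measure lborel (A n \<inter> ball (fst z) (inverse (real (Suc (snd z)))))" "max m 0"])
    show "countable (Q \<times> (UNIV :: nat set))" using Q(1) by auto
  qed (use nb in blast)+
  then obtain k where k: "strict_mono (k :: nat \<Rightarrow> nat)"
    "\<And>z. z \<in> Q \<times> UNIV \<Longrightarrow> \<exists>l. (\<lambda>n. measure lborel (A (k n) \<inter> ball (fst z) (inverse (real (Suc (snd z)))))) \<longlonglongrightarrow> l"
    by blast
  define B where "B n = A (k n)" for n
  have B [measurable]: "B n \<in> sets borel" for n using A by (simp add: B_def)
  have conv: "convergent (\<lambda>n. measure lborel (B n \<inter> ball x (inverse (real (Suc j)))))" for x j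
  proof (rule ball_mass_convergent_everywhere[OF B _ dense])
    fix q assume "q \<in> Q"
    then show "convergent (\<lambda>n. measure lborel (B n \<inter> ball q (inverse (real (Suc j)))))"
      using k(2)[of "(q, j)"] by (auto simp: convergent_def B_def)
  qed auto
  define D where "D R n l = {x \<in> B n. x \<notin> B l} \<inter> cball 0 R \<union> {x \<in> B l. x \<notin> B n} \<inter> cball 0 R" for R n l
  have [measurable]: "D R n l \<in> sets borel" for R n l unfolding D_def by measurable
  have "\<exists>M. \<forall>n\<ge>M. \<forall>l\<ge>M. emeasure lborel (D (real j) n l) \<le> ennreal ((1/2) ^ j)" for j
    unfolding D_def by (rule indicator_Cauchy_on_ball[OF B _ _ p(2) conv]) (use fin p in \<open>auto simp: B_def\<close>)
  then obtain M where M: "\<And>j n l. M j \<le> n \<Longrightarrow> M j \<le> l \<Longrightarrow> emeasure lborel (D (real j) n l) \<le> ennreal ((1/2) ^ j)" by metis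
  \<comment> \<open>The sum dominates each threshold \<open>M j\<close>, and the added
    \<open>j\<close> makes the indices strictly increasing.\<close>
  define s where "s j = (\<Sum>i\<le>j. M i) + j" for j
  have sM: "M j \<le> s j" for j unfolding s_def using member_le_sum[of j "{..j}" M] by auto
  have sm: "strict_mono s" unfolding strict_mono_Suc_iff by (simp add: s_def)
  define E where "E j = D (real j) (s j) (s (Suc j))" for j
  have [measurable]: "E j \<in> sets borel" for j by (simp add: E_def)
  have Ele: "emeasure lborel (E j) \<le> ennreal ((1/2) ^ j)" for j
    unfolding E_def using sM[of j] strict_monoD[OF sm, of j "Suc j"] by (intro M) auto
  have Efin: "emeasure lborel (E j) < \<infinity>" for j
    using Ele[of j] by (auto simp: less_top[symmetric] top_unique)
  have "summable (\<lambda>j. measure lborel (E j))"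
  proof (rule summable_comparison_test')
    show "summable (\<lambda>j. (1/2::real) ^ j)" by (rule summable_geometric) simp
    show "norm (measure lborel (E j)) \<le> (1/2) ^ j" for j using Ele[of j] by (simp add: measure_def enn2real_leI)
  qed
  then have "AE x in lborel. \<forall>\<^sub>F j in sequentially. x \<in> space lborel - E j"
    by (intro borel_cantelli_AE1 Efin) auto
  \<comment> \<open>The set-theoretic lower limit; almost everywhere it agrees with the upper one,
    because membership is eventually constant.\<close>
  define \<Omega> where "\<Omega> = {x. \<exists>J. \<forall>j\<ge>J. x \<in> B (s j)}"
  have \<Omega>: "\<Omega> \<in> sets borel" unfolding \<Omega>_def by measurable
  have "AE x in lborel. (\<lambda>n. indicat_real (A (k (s n))) x) \<longlonglongrightarrow> indicator \<Omega> x"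
    using \<open>AE x in lborel. \<forall>\<^sub>F j in sequentially. x \<in> space lborel - E j\<close>
  proof eventually_elim
    case (elim x)
    obtain J0 where J0: "norm x \<le> real J0" using real_arch_simple by blast
    obtain J1 where J1: "\<And>j. j \<ge> J1 \<Longrightarrow> x \<notin> E j" using elim by (auto simp: eventually_sequentially)
    define J where "J = max J0 J1"
    \<comment> \<open>Once the radius exceeds |x|, avoiding \<open>E j\<close> means that membership
      does not change between consecutive terms.\<close>
    have step: "x \<in> B (s j) \<longleftrightarrow> x \<in> B (s (Suc j))" if "j \<ge> J" for j
      using J1[of j] J0 that by (auto simp: E_def D_def J_def)
    have const: "x \<in> B (s (J + i)) \<longleftrightarrow> x \<in> B (s J)" for i
    proof (induction i)
      case (Suc i)
      then show ?case using step[of "J + i"] by simp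
    qed simp
    have const': "x \<in> B (s j) \<longleftrightarrow> x \<in> B (s J)" if "j \<ge> J" for j
      using const[of "j - J"] that by simp
    have "x \<in> \<Omega> \<longleftrightarrow> x \<in> B (s J)"
    proof
      assume "x \<in> \<Omega>"
      then obtain J' where "\<And>j. j \<ge> J' \<Longrightarrow> x \<in> B (s j)" unfolding \<Omega>_def by blast
      from this[OF max.cobounded2] have "x \<in> B (s (max J J'))" .
      then show "x \<in> B (s J)" using const'[OF max.cobounded1] by blast
    next
      assume "x \<in> B (s J)"
      then show "x \<in> \<Omega>" unfolding \<Omega>_def using const' by blast
    qed
    have "\<forall>\<^sub>F n in sequentially. indicat_real (A (k (s n))) x = indicator \<Omega> x"
      unfolding eventually_sequentially
    proof (intro exI[of _ J] allI impI)
      fix n assume "J \<le> n"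
      with \<open>x \<in> \<Omega> \<longleftrightarrow> x \<in> B (s J)\<close> const'[of n] have "x \<in> A (k (s n)) \<longleftrightarrow> x \<in> \<Omega>" by (simp add: B_def)
      then show "indicat_real (A (k (s n))) x = indicator \<Omega> x" by (simp add: indicator_def)
    qed
    then show ?case by (rule tendsto_eventually)
  qed
  moreover have "strict_mono (k \<circ> s)" using k(1) sm by (rule strict_mono_o)
  ultimately show ?thesis using that[of "k \<circ> s" \<Omega>] \<Omega> by simp
qed

section \<open>Existence of minimizers\<close>

lemma powr_power_eq:
  fixes x :: real
  assumes "0 < x"
  shows "(x powr r) ^ n = x powr (r * real n)"
  using assms by (subst powr_realpow[symmetric]) (auto simp: powr_powr)

text \<open>The left side is the perimeter of a ball of volume \<open>V\<close>, expressed by the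
  same constant as in \<open>m_star\<close>. Since that perimeter of the unit ball is at most N
  \<beta>, it is bounded by N \<beta>^(1/N) V^a.\<close>

lemma isoperimetric_ball:
  fixes \<Omega> :: "'a::euclidean_space set"
  assumes \<Omega>: "\<Omega> \<in> sets borel" and V: "emeasure lborel \<Omega> = ennreal V" "0 < V"
    and p: "perimeter \<Omega> \<le> ennreal p" "0 \<le> p"
  defines "\<beta> \<equiv> measure lborel (ball (0::'a) 1)" and "a \<equiv> (real DIM('a) - 1) / real DIM('a)"
  shows "enn2real (perimeter (ball (0::'a) 1)) * (V / \<beta>) powr a \<le> p"
proof -
  let ?N = "DIM('a)"
  have Npos: "0 < ?N" by simp
  have \<beta>: "0 < \<beta>" by (simp add: \<beta>_def content_ball_pos)
  have "enn2real (perimeter (ball (0::'a) 1)) \<le> real ?N * \<beta>"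
    using perimeter_unit_ball_le[where 'a='a] \<beta> by (simp add: enn2real_leI \<beta>_def)
  then have "enn2real (perimeter (ball (0::'a) 1)) * (V / \<beta>) powr a \<le> (real ?N * \<beta>) * (V / \<beta>) powr a"
    by (intro mult_right_mono) auto
  also have "(real ?N * \<beta>) * (V / \<beta>) powr a = real ?N * root ?N \<beta> * root ?N V ^ (?N - 1)"
  proof -
    have "root ?N V ^ (?N - 1) = V powr a"
    proof -
      have "real (?N - 1) = real ?N - 1" using Npos by (simp add: of_nat_diff Suc_le_eq)
      then show ?thesis
        using V Npos by (simp add: root_powr_inverse powr_power_eq a_def)
    qed
    moreover have "root ?N \<beta> = \<beta> / \<beta> powr a"
    proof -
      have "1 / real ?N = 1 - a" using Npos by (simp add: a_def field_simps)
      then show ?thesis using \<beta> Npos by (simp add: root_powr_inverse powr_diff)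
    qed
    ultimately show ?thesis using V \<beta> by (simp add: powr_divide)
  qed
  also have "\<dots> \<le> p" unfolding \<beta>_def by (rule isoperimetric_root[OF \<Omega> V p])
  finally show ?thesis .
qed

lemma energy_affine_set_le:
  fixes A :: "'a::euclidean_space set"
  assumes A: "A \<in> sets borel" and t: "0 < t"
    and p: "perimeter A \<le> ennreal p" "0 \<le> p" and d: "riesz_energy \<alpha> A \<le> ennreal d" "0 \<le> d"
  shows "energy \<alpha> (affine_set v t A) \<le> ennreal (t ^ (DIM('a) - 1) * p + t powr (2 * real DIM('a) - \<alpha>) * d)"
proof -
  have "riesz_energy \<alpha> (affine_set v t A) \<le> ennreal (t powr (2 * real DIM('a) - \<alpha>)) * ennreal d"
    unfolding riesz_energy_affine_set[OF A t] by (intro mult_left_mono d) simp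
  then have "energy \<alpha> (affine_set v t A) \<le> ennreal (t ^ (DIM('a) - 1) * p) + ennreal (t powr (2 * real DIM('a) - \<alpha>) * d)"
    unfolding energy_def using perimeter_affine_set_le[OF A t p, of v] d
    by (intro add_mono) (auto simp: ennreal_mult)
  then show ?thesis using t p d by simp
qed

lemma min_energy_le:
  fixes A :: "'a::euclidean_space set"
  assumes "A \<in> sets borel" "emeasure lborel A = ennreal m"
  shows "min_energy TYPE('a) \<alpha> m \<le> energy \<alpha> A"
  unfolding min_energy_def using assms by (intro INF_lower) auto

text \<open>A piece of volume x m becomes a competitor after the dilation by x^(-1/N), which
  produces the exponents -a for the perimeter and -b for the Riesz energy.\<close>

lemma min_energy_scaled_le:
  fixes A :: "'a::euclidean_space set"
  assumes A: "A \<in> sets borel" and m: "0 < m" and V: "emeasure lborel A = ennreal (x * m)" "0 < x"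
    and p: "perimeter A \<le> ennreal p" "0 \<le> p" and d: "riesz_energy \<alpha> A \<le> ennreal d" "0 \<le> d"
    and E: "min_energy TYPE('a) \<alpha> m = ennreal E" "0 \<le> E"
  shows "E \<le> x powr - ((real DIM('a) - 1) / real DIM('a)) * p + x powr - ((2 * real DIM('a) - \<alpha>) / real DIM('a)) * d"
proof -
  let ?N = "DIM('a)"
  define t where "t = x powr - (1 / real ?N)"
  have t: "0 < t" using V by (simp add: t_def)
  have Npos: "0 < real ?N" by simp
  have tN: "t ^ ?N = 1 / x"
    unfolding t_def powr_power_eq[OF V(2)] using V Npos by (simp add: powr_minus_divide)
  have "real (?N - 1) = real ?N - 1" using Npos by (simp add: of_nat_diff Suc_le_eq)
  then have tN1: "t ^ (?N - 1) = x powr - ((real ?N - 1) / real ?N)"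
    using V by (simp add: t_def powr_power_eq)
  have tb: "t powr (2 * real ?N - \<alpha>) = x powr - ((2 * real ?N - \<alpha>) / real ?N)"
    by (simp add: t_def powr_powr)
  have "emeasure lborel (affine_set 0 t A) = ennreal m"
    unfolding emeasure_affine_set[OF A t] tN V(1) using V m by (simp add: ennreal_mult[symmetric])
  then have "ennreal E \<le> energy \<alpha> (affine_set 0 t A)"
    unfolding E(1)[symmetric] by (intro min_energy_le affine_set_borel A)
  also have "\<dots> \<le> ennreal (t ^ (?N - 1) * p + t powr (2 * real ?N - \<alpha>) * d)"
    by (rule energy_affine_set_le[OF A t p d])
  finally show ?thesis
    using t p d unfolding tN1 tb by (subst (asm) ennreal_le_iff) auto
qed

text \<open>Here \<open>q\<close> is the perimeter of the ball of volume \<open>m\<close>, the P of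
  the overview. The inequality is the sum of one estimate for each piece.\<close>

lemma splitting_energy_bound:
  fixes A B :: "'a::euclidean_space set"
  assumes A: "A \<in> sets borel" and B: "B \<in> sets borel" and m: "0 < m"
    and VA: "emeasure lborel A = ennreal (x * m)" and VB: "emeasure lborel B = ennreal ((1 - x) * m)"
    and x: "0 < x" "x < 1" and E: "min_energy TYPE('a) \<alpha> m = ennreal E" "0 \<le> E"
    and sum: "energy \<alpha> A + energy \<alpha> B \<le> ennreal (E + \<eta>)" "0 \<le> \<eta>" and \<alpha>: "\<alpha> < real DIM('a)"
  defines "a \<equiv> (real DIM('a) - 1) / real DIM('a)" and "b \<equiv> (2 * real DIM('a) - \<alpha>) / real DIM('a)"
    and "q \<equiv> enn2real (perimeter (ball (0::'a) 1)) * (m / measure lborel (ball (0::'a) 1)) powr ((real DIM('a) - 1) / real DIM('a))"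
  shows "q * (x powr a + (1 - x) powr a - x powr b - (1 - x) powr b) \<le> E * (1 - x powr b - (1 - x) powr b) + \<eta>"
proof -
  let ?N = "DIM('a)"
  have Npos: "0 < real ?N" by simp
  have ab: "a \<le> b" using \<alpha> Npos by (simp add: a_def b_def divide_le_cancel)
  have "energy \<alpha> A \<le> ennreal (E + \<eta>)" by (rule order_trans[OF add_increasing2[OF _ order_refl] sum(1)]) simp
  then obtain pA dA where p: "perimeter A = ennreal pA" "0 \<le> pA" and d: "riesz_energy \<alpha> A = ennreal dA" "0 \<le> dA"
    by (rule energy_finiteE)
  have "energy \<alpha> B \<le> ennreal (E + \<eta>)" by (rule order_trans[OF add_increasing[OF _ order_refl] sum(1)]) simp
  then obtain pB dB where p': "perimeter B = ennreal pB" "0 \<le> pB" and d': "riesz_energy \<alpha> B = ennreal dB" "0 \<le> dB"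
    by (rule energy_finiteE)
  have tot: "pA + dA + (pB + dB) \<le> E + \<eta>"
    using sum p d p' d' E unfolding energy_def by (simp add: ennreal_le_iff flip: ennreal_plus)
  \<comment> \<open>Rescaling, multiplied by y^b, gives y^b E <= y^(b-a) pp + dd. To this is added
    the isoperimetric bound q y^a <= pp with the nonnegative weight 1 - y^(b-a).\<close>
  have part: "q * (y powr a - y powr b) + y powr b * E \<le> pp + dd"
    if y: "0 < y" "y < 1" and C: "C \<in> sets borel" "emeasure lborel C = ennreal (y * m)"
      and pd: "perimeter C = ennreal pp" "0 \<le> pp" "riesz_energy \<alpha> C = ennreal dd" "0 \<le> dd"
    for y pp dd and C :: "'a set"
  proof -
    have "E \<le> y powr - a * pp + y powr - b * dd"
      unfolding a_def b_def by (rule min_energy_scaled_le[OF C(1) m C(2) y(1) _ pd(2) _ pd(4) E]) (use pd in auto)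
    then have "y powr b * E \<le> y powr b * (y powr - a * pp + y powr - b * dd)"
      by (intro mult_left_mono) auto
    also have "\<dots> = y powr (b - a) * pp + dd"
      using y by (simp add: algebra_simps powr_diff powr_minus divide_inverse)
    finally have 1: "y powr b * E \<le> y powr (b - a) * pp + dd" .
    have "enn2real (perimeter (ball (0::'a) 1)) * (y * m / measure lborel (ball (0::'a) 1)) powr a \<le> pp"
      unfolding a_def by (rule isoperimetric_ball[OF C(1) C(2)]) (use y m pd in auto)
    also have "(y * m / measure lborel (ball (0::'a) 1)) powr a = y powr a * (m / measure lborel (ball (0::'a) 1)) powr a"
      using y m by (simp add: powr_mult[symmetric])
    finally have "q * y powr a \<le> pp" by (simp add: q_def a_def mult_ac)
    moreover have "y powr (b - a) \<le> 1" using y ab by (simp add: powr_le1)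
    ultimately have "(q * y powr a) * (1 - y powr (b - a)) \<le> pp * (1 - y powr (b - a))"
      by (intro mult_right_mono) auto
    moreover have "y powr a * y powr (b - a) = y powr b" by (simp add: powr_add[symmetric])
    ultimately have "q * (y powr a - y powr b) \<le> pp - y powr (b - a) * pp"
      by (simp add: algebra_simps)
    with 1 show ?thesis by linarith
  qed
  have "q * (x powr a - x powr b) + x powr b * E \<le> pA + dA"
    by (rule part[OF x A VA p d])
  moreover have "q * ((1 - x) powr a - (1 - x) powr b) + (1 - x) powr b * E \<le> pB + dB"
    by (rule part[OF _ _ B VB p' d']) (use x in auto)
  ultimately show ?thesis using tot by (simp add: algebra_simps)
qed

text \<open>With w = 1 - x^b - (1 - x)^b, which is positive, the hypothesis reads q (x^a + (1 - x)^a
  - 1) <= (E - q) w, and \<open>powr_split_inequality\<close> bounds the left side below by q c w.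
  The result q + q c is the upper bound for the ball in \<open>ball_competitor\<close>.\<close>

lemma splitting_bound_imp:
  fixes a b c q E x :: real
  assumes a: "0 < a" "a < 1" and b: "1 < b" "b < 2" and x: "0 < x" "x < 1"
    and c: "c * (1 - 2 powr (1 - b)) = 2 powr (1 - a) - 1" and q: "0 \<le> q"
    and le: "q * (x powr a + (1 - x) powr a - x powr b - (1 - x) powr b) \<le> E * (1 - x powr b - (1 - x) powr b)"
  shows "q + q * c \<le> E"
proof -
  define w where "w = 1 - x powr b - (1 - x) powr b"
  have lt: "y powr b < y" if "0 < y" "y < 1" for y
    using powr_less_mono'[of y 1 b] that b by simp
  have w: "0 < w" using lt[OF x] lt[of "1 - x"] x by (simp add: w_def)
  have "c * w \<le> x powr a + (1 - x) powr a - 1"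
    unfolding w_def by (rule powr_split_inequality[OF a b c]) (use x in auto)
  then have "q * (c * w) \<le> q * (x powr a + (1 - x) powr a - 1)" using q by (rule mult_left_mono)
  also have "\<dots> = q * (x powr a + (1 - x) powr a - x powr b - (1 - x) powr b) - q * w"
    by (simp add: w_def algebra_simps)
  also have "\<dots> \<le> E * w - q * w" using le by (simp add: w_def)
  finally have "(q + q * c) * w \<le> E * w" by (simp add: algebra_simps)
  then show ?thesis using w by simp
qed

text \<open>For a ball of volume \<beta> s the perimeter scales like s^a and the Riesz energy like
  s^b. The hypothesis m <= m_star is s^(b-a) <= c P / D, that is, the Riesz energy of the ball of
  volume \<open>m\<close> is at most \<open>c\<close> times its perimeter \<open>q\<close>.\<close>

lemma ball_competitor:
  fixes m \<alpha> :: real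
  assumes m: "0 < m" "m \<le> m_star TYPE('a::euclidean_space) \<alpha>" and \<alpha>: "0 < \<alpha>" "\<alpha> < real DIM('a)"
    and N: "DIM('a) \<ge> 2"
  defines "a \<equiv> (real DIM('a) - 1) / real DIM('a)" and "b \<equiv> (2 * real DIM('a) - \<alpha>) / real DIM('a)"
    and "q \<equiv> enn2real (perimeter (ball (0::'a) 1)) * (m / measure lborel (ball (0::'a) 1)) powr ((real DIM('a) - 1) / real DIM('a))"
  obtains B :: "'a::euclidean_space set" and c where "B \<in> sets borel" "emeasure lborel B = ennreal m"
    "energy \<alpha> B \<le> ennreal (q + q * c)" "c * (1 - 2 powr (1 - b)) = 2 powr (1 - a) - 1" "0 \<le> c" "0 \<le> q"
proof -
  let ?N = "DIM('a)" and ?B = "ball (0::'a) 1"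
  define \<beta> where "\<beta> = measure lborel ?B"
  define P where "P = enn2real (perimeter ?B)"
  define D where "D = enn2real (riesz_energy \<alpha> ?B)"
  have Npos: "0 < real ?N" by simp
  have \<beta>: "0 < \<beta>" by (simp add: \<beta>_def content_ball_pos)
  have P0: "0 \<le> P" and D0: "0 \<le> D" by (auto simp: P_def D_def)
  define c where "c = (2 powr (1 / real ?N) - 1) / (1 - 2 powr ((\<alpha> - real ?N) / real ?N))"
  have e1: "1 - a = 1 / real ?N" using Npos by (simp add: a_def field_simps)
  have e2: "1 - b = (\<alpha> - real ?N) / real ?N" using Npos by (simp add: b_def field_simps)
  have e3: "b - a = (real ?N + 1 - \<alpha>) / real ?N" by (simp add: a_def b_def diff_divide_distrib[symmetric])
  have ba: "0 < b - a" unfolding e3 using \<alpha> Npos by simp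
  have n1: "0 < 2 powr (1 / real ?N) - (1::real)"
    using powr_less_mono[of 0 "1 / real ?N" 2] Npos by simp
  have n2: "0 < 1 - 2 powr ((\<alpha> - real ?N) / real ?N)"
  proof -
    have "(\<alpha> - real ?N) / real ?N < 0" using \<alpha> Npos by (simp add: divide_neg_pos)
    then show ?thesis using powr_less_mono[of "(\<alpha> - real ?N) / real ?N" 0 2] by simp
  qed
  have c0: "0 < c" using n1 n2 by (simp add: c_def)
  have c: "c * (1 - 2 powr (1 - b)) = 2 powr (1 - a) - 1"
    unfolding e1 e2 using n2 c_def by (metis less_irrefl nonzero_eq_divide_eq)
  \<comment> \<open>The exponent N / (N + 1 - \<alpha>) is 1 / (b - a).\<close>
  have star: "m_star TYPE('a) \<alpha> = (c * (P / D)) powr (1 / (b - a)) * \<beta>"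
    unfolding m_star_def Let_def e3 c_def P_def D_def \<beta>_def by (simp add: measure_completion)
  \<comment> \<open>As \<open>enn2real\<close> of an infinite value and division by \<open>0\<close> give \<open>0\<close>, already \<open>0 < m_star\<close> makes \<open>P\<close> and \<open>D\<close> finite and positive.\<close>
  have PD: "c * (P / D) \<noteq> 0" using m unfolding star by auto
  then have P: "0 < P" and D: "0 < D" using P0 D0 by (auto simp: less_le)
  have perB: "perimeter ?B = ennreal P"
    using P by (simp add: P_def enn2real_positive_iff ennreal_enn2real)
  have rieB: "riesz_energy \<alpha> ?B = ennreal D"
    using D by (simp add: D_def enn2real_positive_iff ennreal_enn2real)
  define s where "s = m / \<beta>"
  have s: "0 < s" using m \<beta> by (simp add: s_def)
  have "s \<le> (c * (P / D)) powr (1 / (b - a))" using m \<beta> unfolding star s_def by (simp add: divide_le_eq)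
  then have "s powr (b - a) \<le> ((c * (P / D)) powr (1 / (b - a))) powr (b - a)"
    using s ba by (intro powr_mono2) auto
  also have "\<dots> = c * (P / D)" using ba P D c0 by (simp add: powr_powr)
  finally have "D * s powr (b - a) \<le> c * P" using D by (simp add: field_simps)
  then have "D * s powr (b - a) * s powr a \<le> c * P * s powr a" by (rule mult_right_mono) simp
  then have key: "D * s powr b \<le> c * (P * s powr a)" by (simp add: powr_add[symmetric] mult.assoc)
  have q: "q = P * s powr a" by (simp add: q_def P_def s_def a_def \<beta>_def)
  \<comment> \<open>The dilation factor that takes the unit ball to volume \<open>m\<close>.\<close>
  define t where "t = s powr (1 / real ?N)"
  have t: "0 < t" using s by (simp add: t_def)
  have Bb: "?B \<in> sets borel" by simp
  have tN: "t ^ ?N = s" using s by (simp add: t_def powr_power_eq)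
  have "real (?N - 1) = real ?N - 1" using Npos by (simp add: of_nat_diff Suc_le_eq)
  then have tN1: "t ^ (?N - 1) = s powr a"
    using s by (simp add: t_def powr_power_eq a_def)
  have tb: "t powr (2 * real ?N - \<alpha>) = s powr b" by (simp add: t_def powr_powr b_def)
  show ?thesis
  proof (rule that)
    show "affine_set (0::'a) t ?B \<in> sets borel" by (rule affine_set_borel[OF Bb])
    show "emeasure lborel (affine_set (0::'a) t ?B) = ennreal m"
      unfolding emeasure_affine_set[OF Bb t] tN emeasure_bounded_eq[OF bounded_ball] \<beta>_def[symmetric]
      using s \<beta> by (simp add: ennreal_mult[symmetric] s_def)
    have "energy \<alpha> (affine_set (0::'a) t ?B) \<le> ennreal (t ^ (?N - 1) * P + t powr (2 * real ?N - \<alpha>) * D)"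
      by (rule energy_affine_set_le[OF Bb t]) (use perB rieB P D in auto)
    also have "\<dots> \<le> ennreal (q + q * c)"
      unfolding tN1 tb q using key by (intro ennreal_leI) (simp add: mult_ac)
    finally show "energy \<alpha> (affine_set (0::'a) t ?B) \<le> ennreal (q + q * c)" .
  qed (use c c0 P in \<open>auto simp: q\<close>)
qed

text \<open>The energy is invariant under translation, so each near-minimizer can be moved to place
  a definite volume in a fixed ball about the origin. The limit then keeps positive volume.\<close>

lemma centered_minimizing_sequence:
  fixes m \<alpha> E :: real
  assumes m: "0 < m" and E: "min_energy TYPE('a::euclidean_space) \<alpha> m = ennreal E" "0 \<le> E"
  obtains A :: "nat \<Rightarrow> 'a::euclidean_space set" and \<rho> where "\<And>n. A n \<in> sets borel" "\<And>n. emeasure lborel (A n) = ennreal m"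
    "\<And>n. energy \<alpha> (A n) \<le> ennreal (E + inverse (real (Suc n)))" "0 < \<rho>"
    "\<And>n. measure lborel (ball (0::'a) \<rho>) / 2 \<le> measure lborel (A n \<inter> ball 0 \<rho>)"
proof -
  \<comment> \<open>Near-minimizers have perimeter at most E + 1, so this radius meets the condition
    of \<open>nonvanishing\<close> for all \<open>n\<close> at once.\<close>
  define \<rho> where "\<rho> = m / 4 / (E + 1)"
  have \<rho>: "0 < \<rho>" using m E by (simp add: \<rho>_def)
  have "E + 1 \<noteq> 0" using E by linarith
  then have "\<rho> * (E + 1) = m / 4" by (metis \<rho>_def nonzero_eq_divide_eq)
  then have \<rho>p: "\<rho> * (E + 1) \<le> m / 4" by simp
  have "\<exists>A :: 'a set. A \<in> sets borel \<and> emeasure lborel A = ennreal m \<and> energy \<alpha> A \<le> ennreal (E + inverse (real (Suc n)))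
    \<and> measure lborel (ball (0::'a) \<rho>) / 2 \<le> measure lborel (A \<inter> ball 0 \<rho>)" for n
  proof -
    define e where "e = inverse (real (Suc n))"
    have e: "0 < e" "e \<le> 1" by (auto simp: e_def inverse_le_1_iff)
    have "min_energy TYPE('a) \<alpha> m < ennreal (E + e)" using E e by (simp add: ennreal_less_iff del: ennreal_plus)
    then obtain S0 :: "'a set" where S0: "S0 \<in> sets lebesgue" "emeasure lebesgue S0 = ennreal m" "energy \<alpha> S0 < ennreal (E + e)"
      unfolding min_energy_def INF_less_iff by auto
    obtain S :: "'a set" where S: "S \<in> sets borel" "emeasure lborel S = ennreal m" "energy \<alpha> S \<le> ennreal (E + e)"
      using borel_representative[OF S0(1), of \<alpha>] S0 by (metis less_imp_le)
    have "perimeter S \<le> energy \<alpha> S" by (simp add: energy_def)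
    also have "\<dots> \<le> ennreal (E + 1)" using S(3) e by (intro order_trans[OF S(3)] ennreal_leI) auto
    finally have "perimeter S \<le> ennreal (E + 1)" .
    then obtain x where x: "measure lborel (ball (0::'a) \<rho>) / 2 \<le> measure lborel (S \<inter> ball x \<rho>)"
      using nonvanishing[OF S(1,2) m _ _ \<rho> \<rho>p] E by auto
    obtain p d where pd: "perimeter S = ennreal p" "0 \<le> p" "riesz_energy \<alpha> S = ennreal d" "0 \<le> d"
      using energy_finiteE[OF S(3)] .
    define T where "T = affine_set (- x) 1 S"
    have T: "T \<in> sets borel" unfolding T_def by (rule affine_set_borel[OF S(1)])
    have "energy \<alpha> T \<le> ennreal (1 ^ (DIM('a) - 1) * p + 1 powr (2 * real DIM('a) - \<alpha>) * d)"
      unfolding T_def by (rule energy_affine_set_le[OF S(1)]) (use pd in auto)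
    also have "\<dots> = energy \<alpha> S" using pd by (simp add: energy_def)
    finally have eT: "energy \<alpha> T \<le> ennreal (E + e)" using S(3) by (rule order_trans)
    have mT: "emeasure lborel T = ennreal m"
      unfolding T_def using emeasure_affine_set[OF S(1), of 1 "- x"] S(2) by simp
    have "emeasure lborel (T \<inter> ball 0 \<rho>) = emeasure lborel {y. y + x \<in> S \<inter> ball x \<rho>}"
      by (intro arg_cong[where f="emeasure lborel"]) (auto simp: T_def affine_set_def dist_norm)
    also have "\<dots> = emeasure lborel (S \<inter> ball x \<rho>)"
      by (rule emeasure_lborel_translate) (use S in auto)
    finally have "measure lborel (T \<inter> ball 0 \<rho>) = measure lborel (S \<inter> ball x \<rho>)" by (simp add: measure_def)
    then show ?thesis using T mT eT x by (intro exI[of _ T]) (auto simp: e_def)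
  qed
  then obtain A :: "nat \<Rightarrow> 'a set" where "\<And>n. A n \<in> sets borel \<and> emeasure lborel (A n) = ennreal m \<and> energy \<alpha> (A n) \<le> ennreal (E + inverse (real (Suc n)))
    \<and> measure lborel (ball (0::'a) \<rho>) / 2 \<le> measure lborel (A n \<inter> ball 0 \<rho>)"
    by metis
  then show ?thesis using that[of A \<rho>] \<rho> by blast
qed

text \<open>Convergence almost everywhere controls volumes in fixed balls only; outside them mass
  may escape.\<close>

lemma measure_Int_ball_tendsto:
  fixes \<Omega> :: "'a::euclidean_space set"
  assumes [measurable]: "\<And>n. A n \<in> sets borel" "\<Omega> \<in> sets borel"
    and lim: "AE x in lborel. (\<lambda>n. indicat_real (A n) x) \<longlonglongrightarrow> indicator \<Omega> x"
  shows "(\<lambda>n. measure lborel (A n \<inter> ball 0 r)) \<longlonglongrightarrow> measure lborel (\<Omega> \<inter> ball 0 r)"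
proof -
  have [measurable]: "ball (0::'a) r \<in> sets borel" by simp
  have "(\<lambda>n. \<integral>x. indicat_real (A n \<inter> ball 0 r) x \<partial>lborel) \<longlonglongrightarrow> (\<integral>x. indicat_real (\<Omega> \<inter> ball 0 r) x \<partial>lborel)"
  proof (rule integral_dominated_convergence)
    show "integrable lborel (indicat_real (ball (0::'a) r))"
      using emeasure_lborel_ball_finite[of "0::'a" r] by (intro integrable_real_indicator) auto
    show "AE x in lborel. (\<lambda>n. indicat_real (A n \<inter> ball 0 r) x) \<longlonglongrightarrow> indicat_real (\<Omega> \<inter> ball 0 r) x"
      using lim by eventually_elim (simp add: indicator_inter_arith tendsto_mult_right)
    show "AE x in lborel. norm (indicat_real (A n \<inter> ball 0 r) x) \<le> indicat_real (ball 0 r) x" for n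
      by (rule AE_I2) (auto simp: indicator_def)
    show "indicat_real (\<Omega> \<inter> ball 0 r) \<in> borel_measurable lborel" by measurable
    show "indicat_real (A n \<inter> ball 0 r) \<in> borel_measurable lborel" for n by measurable
  qed
  then show ?thesis by simp
qed

text \<open>The order of choices matters: first \<open>R\<close>, large enough that the ball holds
  almost all of \<Omega> and that cutting is cheap; then \<open>n\<close>, such that
  \<open>A n\<close> has volume close to \<open>m1\<close> in both balls of radius R and 2 R;
  finally the cutting radius between them, which depends on \<open>n\<close>.\<close>

lemma split_minimizing_sequence:
  fixes A :: "nat \<Rightarrow> 'a::euclidean_space set"
  assumes A: "\<And>n. A n \<in> sets borel" and mA: "\<And>n. emeasure lborel (A n) = ennreal m" and m: "0 < m"
    and en: "\<And>n. energy \<alpha> (A n) \<le> ennreal (E + \<delta> n)" and \<delta>: "\<delta> \<longlonglongrightarrow> 0" "\<And>n. 0 \<le> \<delta> n" and E: "0 \<le> E"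
    and \<Omega>: "\<Omega> \<in> sets borel" "emeasure lborel \<Omega> = ennreal m1" "0 \<le> m1"
    and lim: "AE x in lborel. (\<lambda>n. indicat_real (A n) x) \<longlonglongrightarrow> indicator \<Omega> x"
    and e: "0 < e"
  obtains B C :: "'a set" and v where "B \<in> sets borel" "C \<in> sets borel" "emeasure lborel B = ennreal v" "emeasure lborel C = ennreal (m - v)"
    "\<bar>v - m1\<bar> \<le> e" "energy \<alpha> B + energy \<alpha> C \<le> ennreal (E + e)"
proof -
  have fm: "S \<in> fmeasurable lborel" if "S \<in> sets borel" "emeasure lborel S \<le> ennreal c" for S :: "'a set" and c
    using that by (intro fmeasurableI) (auto simp: less_top[symmetric] top_unique)
  have fm\<Omega>: "\<Omega> \<in> fmeasurable lborel" by (rule fm[of _ m1]) (use \<Omega> in auto)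
  have m\<Omega>: "measure lborel \<Omega> = m1" using \<Omega> by (simp add: measure_def)
  have "(\<lambda>n. measure lborel (\<Omega> \<inter> ball 0 (real n))) \<longlonglongrightarrow> measure lborel (\<Union>n. \<Omega> \<inter> ball 0 (real n))"
  proof (rule Lim_measure_incseq)
    show "incseq (\<lambda>n. \<Omega> \<inter> ball 0 (real n))" by (auto simp: incseq_def)
    show "emeasure lborel (\<Union>n. \<Omega> \<inter> ball 0 (real n)) \<noteq> \<infinity>"
    proof -
      have "emeasure lborel (\<Union>n. \<Omega> \<inter> ball 0 (real n)) \<le> emeasure lborel \<Omega>" using \<Omega>(1) by (intro emeasure_mono) auto
      then show ?thesis using \<Omega>(2) by (auto simp: top_unique)
    qed
  qed (use \<Omega> in auto)
  moreover have "(\<Union>n. \<Omega> \<inter> ball 0 (real n)) = \<Omega>" using reals_Archimedean2 by auto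
  ultimately have "(\<lambda>n. measure lborel (\<Omega> \<inter> ball 0 (real n))) \<longlonglongrightarrow> m1" using m\<Omega> by simp
  then have "\<forall>\<^sub>F n in sequentially. m1 - e / 2 < measure lborel (\<Omega> \<inter> ball 0 (real n))"
    using e by (intro order_tendstoD) auto
  moreover have "\<forall>\<^sub>F n in sequentially. 16 * m / e < real n"
    using filterlim_real_sequentially by (simp add: filterlim_at_top_dense)
  ultimately have "\<forall>\<^sub>F n in sequentially. m1 - e / 2 < measure lborel (\<Omega> \<inter> ball 0 (real n)) \<and> 16 * m / e < real n"
    by (rule eventually_conj)
  then obtain k where k: "m1 - e / 2 < measure lborel (\<Omega> \<inter> ball 0 (real k))" "16 * m / e < real k"
    by (auto simp: eventually_sequentially)
  define R where "R = real k"
  have "0 < 16 * m / e" using m e by simp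
  then have R: "0 < R" using k(2) by (simp add: R_def)
  \<comment> \<open>The threshold 16 m / e makes the cutting cost 8 m / R at most e/2; the other
    half absorbs the excess \<delta> n.\<close>
  have Re: "8 * m / R \<le> e / 2" using k(2) R e by (simp add: R_def field_simps)
  have "\<forall>\<^sub>F n in sequentially. \<delta> n < e / 2" using \<delta>(1) e by (intro order_tendstoD) auto
  moreover have "\<forall>\<^sub>F n in sequentially. m1 - e < measure lborel (A n \<inter> ball 0 R)"
    using k(1) by (intro order_tendstoD(1)[OF measure_Int_ball_tendsto[OF A \<Omega>(1) lim]]) (use e in \<open>simp add: R_def\<close>)
  moreover have "\<forall>\<^sub>F n in sequentially. measure lborel (A n \<inter> ball 0 (2 * R)) < m1 + e"
  proof (intro order_tendstoD(2)[OF measure_Int_ball_tendsto[OF A \<Omega>(1) lim]])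
    have "measure lborel (\<Omega> \<inter> ball 0 (2 * R)) \<le> measure lborel \<Omega>"
      using \<Omega>(1) by (intro measure_mono_fmeasurable fm\<Omega>) auto
    then show "measure lborel (\<Omega> \<inter> ball 0 (2 * R)) < m1 + e" using m\<Omega> e by simp
  qed
  ultimately have "\<forall>\<^sub>F n in sequentially. \<delta> n < e / 2 \<and> m1 - e < measure lborel (A n \<inter> ball 0 R) \<and> measure lborel (A n \<inter> ball 0 (2 * R)) < m1 + e"
    by (intro eventually_conj)
  then obtain n where n: "\<delta> n < e / 2" "m1 - e < measure lborel (A n \<inter> ball 0 R)" "measure lborel (A n \<inter> ball 0 (2 * R)) < m1 + e"
    by (auto simp: eventually_sequentially)
  obtain p d where pd: "perimeter (A n) = ennreal p" "0 \<le> p" "riesz_energy \<alpha> (A n) = ennreal d" "0 \<le> d"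
    using energy_finiteE[OF en] .
  have pdE: "p + d \<le> E + \<delta> n"
    using en[of n] pd E \<delta>(2)[of n] unfolding energy_def by (simp add: ennreal_le_iff flip: ennreal_plus)
  obtain r where r: "R \<le> r" "r \<le> 2 * R"
    "perimeter (A n \<inter> ball 0 r) + perimeter (A n - ball 0 r) \<le> ennreal (p + 8 * m / R)"
    using perimeter_cut[OF A eq_refl[OF mA] less_imp_le[OF m] eq_refl[OF pd(1)] pd(2) R] by blast
  let ?B = "A n \<inter> ball 0 r" and ?C = "A n - ball 0 r"
  have Bb: "?B \<in> sets borel" "?C \<in> sets borel" using A[of n] by auto
  define v where "v = measure lborel ?B"
  have fmA: "S \<in> fmeasurable lborel" if "S \<in> sets borel" "S \<subseteq> A n" for S
    using emeasure_mono[OF that(2), of lborel] A[of n] mA[of n] by (intro fm[OF that(1)]) auto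
  have v: "emeasure lborel ?B = ennreal v"
    unfolding v_def using fmA[OF Bb(1)] by (intro emeasure_eq_measure2) auto
  have vC: "emeasure lborel ?C = ennreal (m - v)"
  proof -
    have "measure lborel ?C = measure lborel (A n - ?B)" by (intro arg_cong[where f="measure lborel"]) auto
    also have "\<dots> = measure lborel (A n) - v"
      unfolding v_def using A[of n] Bb mA[of n] by (intro measure_Diff) auto
    also have "measure lborel (A n) = m" using mA[of n] m by (simp add: measure_def)
    finally show ?thesis using fmA[OF Bb(2)] emeasure_eq_measure2[of ?C lborel] by auto
  qed
  have "measure lborel (A n \<inter> ball 0 R) \<le> v" "v \<le> measure lborel (A n \<inter> ball 0 (2 * R))"
    unfolding v_def using r A[of n] by (intro measure_mono_fmeasurable fmA; auto)+
  then have vm: "\<bar>v - m1\<bar> \<le> e" using n by linarith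
  have "energy \<alpha> ?B + energy \<alpha> ?C = (perimeter ?B + perimeter ?C) + (riesz_energy \<alpha> ?B + riesz_energy \<alpha> ?C)"
    by (simp add: energy_def add_ac)
  also have "\<dots> \<le> ennreal (p + 8 * m / R) + riesz_energy \<alpha> (?B \<union> ?C)"
    by (intro add_mono r(3) riesz_energy_superadditive Bb) auto
  also have "?B \<union> ?C = A n" by auto
  also have "ennreal (p + 8 * m / R) + riesz_energy \<alpha> (A n) = ennreal (p + 8 * m / R + d)"
    unfolding pd(3) using pd m R by simp
  also have "\<dots> \<le> ennreal (E + e)" using pdE n(1) Re by (intro ennreal_leI) linarith
  finally show ?thesis using that[OF Bb v vC vm] by blast
qed

theorem theorem1:
  fixes \<alpha> m :: real
  assumes "DIM('a::euclidean_space) \<ge> 2"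
    and "0 < \<alpha>" and "\<alpha> < real DIM('a)"
    and "0 < m" and "m \<le> m_star TYPE('a) \<alpha>"
  shows "\<exists>\<Omega> :: 'a set. is_minimizer \<alpha> m \<Omega>"
proof -
  let ?N = "DIM('a)"
  note m = \<open>0 < m\<close> and \<alpha> = \<open>0 < \<alpha>\<close> \<open>\<alpha> < real ?N\<close>
  define a where "a = (real ?N - 1) / real ?N"
  define b where "b = (2 * real ?N - \<alpha>) / real ?N"
  define q where "q = enn2real (perimeter (ball (0::'a) 1)) * (m / measure lborel (ball (0::'a) 1)) powr ((real ?N - 1) / real ?N)"
  have N2: "2 \<le> real ?N" using assms(1) by simp
  have a: "0 < a" "a < 1" using N2 by (auto simp: a_def field_simps)
  have b: "1 < b" "b < 2" using N2 \<alpha> by (auto simp: b_def field_simps)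
  obtain B0 :: "'a set" and c where B0: "B0 \<in> sets borel" "emeasure lborel B0 = ennreal m"
    "energy \<alpha> B0 \<le> ennreal (q + q * c)" and c: "c * (1 - 2 powr (1 - b)) = 2 powr (1 - a) - 1" "0 \<le> c" and q0: "0 \<le> q"
    using ball_competitor[OF m assms(5) \<alpha> assms(1)] unfolding a_def b_def q_def by metis
  have minI: "is_minimizer \<alpha> m S" if "S \<in> sets borel" "emeasure lborel S = ennreal m" "energy \<alpha> S \<le> min_energy TYPE('a) \<alpha> m" for S :: "'a set"
    unfolding is_minimizer_def using that min_energy_le[OF that(1,2), of \<alpha>] by (auto intro: antisym)
  have "min_energy TYPE('a) \<alpha> m \<le> ennreal (q + q * c)"
    using min_energy_le[OF B0(1,2)] B0(3) by (rule order_trans)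
  then obtain E where E: "min_energy TYPE('a) \<alpha> m = ennreal E" "0 \<le> E"
    by (metis ennreal_cases ennreal_neq_top neq_top_trans)
  obtain A :: "nat \<Rightarrow> 'a set" and \<rho> where A: "\<And>n. A n \<in> sets borel" "\<And>n. emeasure lborel (A n) = ennreal m"
    "\<And>n. energy \<alpha> (A n) \<le> ennreal (E + inverse (real (Suc n)))" and \<rho>: "0 < \<rho>"
    "\<And>n. measure lborel (ball (0::'a) \<rho>) / 2 \<le> measure lborel (A n \<inter> ball 0 \<rho>)"
    using centered_minimizing_sequence[OF m E] by metis
  have per: "perimeter (A n) \<le> ennreal (E + 1)" for n
  proof -
    have "perimeter (A n) \<le> energy \<alpha> (A n)" by (simp add: energy_def)
    also have "\<dots> \<le> ennreal (E + inverse (real (Suc n)))" by (rule A(3))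
    also have "\<dots> \<le> ennreal (E + 1)" by (intro ennreal_leI) (simp add: inverse_le_1_iff)
    finally show ?thesis .
  qed
  obtain r \<Omega> where r: "strict_mono (r :: nat \<Rightarrow> nat)" and \<Omega>: "\<Omega> \<in> sets borel"
    and lim: "AE x in lborel. (\<lambda>n. indicat_real (A (r n)) x) \<longlonglongrightarrow> indicator \<Omega> x"
    using finite_perimeter_compactness[of A, OF A(1) eq_refl[OF A(2)] per] E by auto
  define A' where "A' n = A (r n)" for n
  define \<delta> where "\<delta> n = inverse (real (Suc (r n)))" for n
  have \<delta>: "\<delta> \<longlonglongrightarrow> 0" "\<And>n. 0 \<le> \<delta> n"
    using LIMSEQ_subseq_LIMSEQ[OF LIMSEQ_inverse_real_of_nat r] by (auto simp: \<delta>_def[abs_def] o_def)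
  have A': "\<And>n. A' n \<in> sets borel" "\<And>n. emeasure lborel (A' n) = ennreal m"
    "\<And>n. energy \<alpha> (A' n) \<le> ennreal (E + \<delta> n)"
    and lim': "AE x in lborel. (\<lambda>n. indicat_real (A' n) x) \<longlonglongrightarrow> indicator \<Omega> x"
    using A lim by (auto simp: A'_def \<delta>_def)
  have "energy \<alpha> \<Omega> \<le> liminf (\<lambda>n. energy \<alpha> (A' n))" by (rule energy_le_liminf[OF A'(1) \<Omega> lim'])
  also have "\<dots> \<le> liminf (\<lambda>n. ennreal (E + \<delta> n))" by (intro Liminf_mono always_eventually allI A')
  also have "\<dots> = ennreal E"
  proof (rule lim_imp_Liminf)
    have "(\<lambda>n. E + \<delta> n) \<longlonglongrightarrow> E + 0" by (intro tendsto_intros \<delta>)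
    then show "(\<lambda>n. ennreal (E + \<delta> n)) \<longlonglongrightarrow> ennreal E" by (intro tendsto_ennrealI) simp
  qed simp
  finally have en\<Omega>: "energy \<alpha> \<Omega> \<le> ennreal E" .
  have "emeasure lborel \<Omega> \<le> ennreal m"
  proof -
    have "emeasure lborel (\<Omega> \<inter> ball 0 (real j)) \<le> ennreal m" for j
    proof -
      have "measure lborel (A' n \<inter> ball 0 (real j)) \<le> m" for n
      proof -
        have "emeasure lborel (A' n \<inter> ball 0 (real j)) \<le> ennreal m"
          unfolding A'(2)[symmetric, of n] using A'(1) by (intro emeasure_mono) auto
        then show ?thesis using m by (simp add: measure_def enn2real_leI)
      qed
      then have "measure lborel (\<Omega> \<inter> ball 0 (real j)) \<le> m"
        by (intro LIMSEQ_le_const2[OF measure_Int_ball_tendsto[OF A'(1) \<Omega> lim']]) auto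
      then show ?thesis by (subst emeasure_bounded_eq) (auto intro: ennreal_leI bounded_subset[OF bounded_ball[of 0 "real j"]])
    qed
    moreover have "(\<lambda>j. emeasure lborel (\<Omega> \<inter> ball 0 (real j))) \<longlonglongrightarrow> emeasure lborel (\<Union>j. \<Omega> \<inter> ball 0 (real j))"
      using \<Omega> by (intro Lim_emeasure_incseq) (auto simp: incseq_def)
    moreover have "(\<Union>j. \<Omega> \<inter> ball 0 (real j)) = \<Omega>" using reals_Archimedean2 by auto
    ultimately show ?thesis by (auto intro: LIMSEQ_le_const2)
  qed
  then obtain m1 where m1: "emeasure lborel \<Omega> = ennreal m1" "0 \<le> m1" "m1 \<le> m"
    using m by (metis ennreal_cases ennreal_le_iff ennreal_neq_top less_imp_le neq_top_trans)
  have "0 < m1"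
  proof -
    have "measure lborel (ball (0::'a) \<rho>) / 2 \<le> measure lborel (\<Omega> \<inter> ball 0 \<rho>)"
      by (rule LIMSEQ_le_const[OF measure_Int_ball_tendsto[OF A'(1) \<Omega> lim']]) (use \<rho> in \<open>auto simp: A'_def\<close>)
    moreover have "measure lborel (\<Omega> \<inter> ball 0 \<rho>) \<le> m1"
    proof -
      have "emeasure lborel (\<Omega> \<inter> ball 0 \<rho>) \<le> ennreal m1" unfolding m1(1)[symmetric] using \<Omega> by (intro emeasure_mono) auto
      then show ?thesis using m1 by (simp add: measure_def enn2real_leI)
    qed
    moreover have "0 < measure lborel (ball (0::'a) \<rho>)" using \<rho> by (simp add: content_ball_pos)
    ultimately show ?thesis by linarith
  qed
  show ?thesis
  proof (cases "m1 = m")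
    case True
    then have "is_minimizer \<alpha> m \<Omega>" using \<Omega> m1 en\<Omega> E by (intro minI) auto
    then show ?thesis by blast
  next
    case False
    \<comment> \<open>The fraction of the volume that stays in the limit.\<close>
    define x where "x = m1 / m"
    have x: "0 < x" "x < 1" using \<open>0 < m1\<close> False m1 m by (auto simp: x_def)
    \<comment> \<open>\<open>y\<close> is the volume fraction of the inner piece. It approximates
      \<open>x\<close> but may leave (0, 1) for small \<open>n\<close>, hence the implication; by
      convergence the exceptions are finite in number.\<close>
    have "\<exists>y. \<bar>y - x\<bar> \<le> inverse (real (Suc n)) / m \<and> (0 < y \<and> y < 1 \<longrightarrow>
        q * (y powr a + (1 - y) powr a - y powr b - (1 - y) powr b) \<le> E * (1 - y powr b - (1 - y) powr b) + inverse (real (Suc n)))" for n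
    proof -
      define e where "e = inverse (real (Suc n))"
      have e: "0 < e" by (simp add: e_def)
      obtain B C :: "'a set" and v where BC: "B \<in> sets borel" "C \<in> sets borel" "emeasure lborel B = ennreal v" "emeasure lborel C = ennreal (m - v)"
        "\<bar>v - m1\<bar> \<le> e" "energy \<alpha> B + energy \<alpha> C \<le> ennreal (E + e)"
        using split_minimizing_sequence[OF A'(1,2) m A'(3) \<delta> E(2) \<Omega> m1(1,2) lim' e] by metis
      define y where "y = v / m"
      have yv: "v = y * m" "m - v = (1 - y) * m" using m by (auto simp: y_def algebra_simps)
      have "\<bar>y - x\<bar> = \<bar>v - m1\<bar> / m" using m by (simp add: x_def y_def diff_divide_distrib[symmetric])
      then have "\<bar>y - x\<bar> \<le> e / m" using BC(5) m by (simp add: divide_right_mono)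
      moreover have "q * (y powr a + (1 - y) powr a - y powr b - (1 - y) powr b) \<le> E * (1 - y powr b - (1 - y) powr b) + e"
        if "0 < y" "y < 1"
        unfolding q_def a_def b_def
        by (rule splitting_energy_bound[OF BC(1,2) m BC(3)[unfolded yv(1)] BC(4)[unfolded yv(2)] that E BC(6) _ \<alpha>(2)]) (use e in simp)
      ultimately show ?thesis unfolding e_def by blast
    qed
    then obtain y where y: "\<And>n. \<bar>y n - x\<bar> \<le> inverse (real (Suc n)) / m"
      "\<And>n. 0 < y n \<Longrightarrow> y n < 1 \<Longrightarrow> q * (y n powr a + (1 - y n) powr a - y n powr b - (1 - y n) powr b)
         \<le> E * (1 - y n powr b - (1 - y n) powr b) + inverse (real (Suc n))"
      by metis
    have lim0: "(\<lambda>n. inverse (real (Suc n))) \<longlonglongrightarrow> 0" by (rule LIMSEQ_inverse_real_of_nat)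
    have "(\<lambda>n. inverse (real (Suc n)) / m) \<longlonglongrightarrow> 0 / m" by (intro tendsto_intros lim0) (use m in simp)
    then have lim0m: "(\<lambda>n. inverse (real (Suc n)) / m) \<longlonglongrightarrow> 0" by simp
    have "(\<lambda>n. y n - x) \<longlonglongrightarrow> 0"
      by (rule Lim_null_comparison[OF _ lim0m]) (use y(1) in auto)
    then have yx: "y \<longlonglongrightarrow> x" by (rule LIM_zero_cancel)
    have evy: "\<forall>\<^sub>F n in sequentially. 0 < y n" "\<forall>\<^sub>F n in sequentially. y n < 1"
      using order_tendstoD[OF yx] x by auto
    have L1: "(\<lambda>n. q * (y n powr a + (1 - y n) powr a - y n powr b - (1 - y n) powr b))
      \<longlonglongrightarrow> q * (x powr a + (1 - x) powr a - x powr b - (1 - x) powr b)"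
      by (intro tendsto_intros yx) (use x in auto)
    have L2: "(\<lambda>n. E * (1 - y n powr b - (1 - y n) powr b) + inverse (real (Suc n)))
      \<longlonglongrightarrow> E * (1 - x powr b - (1 - x) powr b) + 0"
      by (intro tendsto_intros yx lim0) (use x in auto)
    have "q * (x powr a + (1 - x) powr a - x powr b - (1 - x) powr b) \<le> E * (1 - x powr b - (1 - x) powr b) + 0"
    proof (rule tendsto_le[OF _ L2 L1])
      show "\<forall>\<^sub>F n in sequentially. q * (y n powr a + (1 - y n) powr a - y n powr b - (1 - y n) powr b)
         \<le> E * (1 - y n powr b - (1 - y n) powr b) + inverse (real (Suc n))"
        using evy by eventually_elim (rule y(2))
    qed simp
    \<comment> \<open>The lower bound for the infimum meets the upper bound for the ball
      \<open>B0\<close>, so escaping mass makes the ball a minimizer.\<close>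
    then have "q + q * c \<le> E"
      by (intro splitting_bound_imp[OF a b x c(1) q0]) simp
    then have "energy \<alpha> B0 \<le> ennreal E" using order_trans[OF B0(3) ennreal_leI] by blast
    then have "is_minimizer \<alpha> m B0" using B0 E by (intro minI) auto
    then show ?thesis by blast
  qed
qed

end
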